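(* Let $\Omega\subset\mathbb{R}^d$, $d\in\{2,3\}$. There is a constant $C_{stab}>0$, independent of $h$, $\Delta t$, $\nu$ and of the discrete solution, such that the following holds. Let $N>1$, $u_h^0,u_h^1\in V_h$, and let $u_h^{n+1}$, $n=1,\dots,N-1$, be computed by the constant timestep BE-AB2+F algorithm. If for every $n=1,\dots,N-1$ $$1-\frac{C_{stab}\,\Delta t}{\nu h}\|\nabla(2u_h^n-u_h^{n-1})\|^2\geq0,$$ then $$\frac14\|u_h^N\|^2+\frac14\|2u_h^N-u_h^{N-1}\|^2+\frac14\|u_h^N-u_h^{N-1}\|^2+\frac{\nu\Delta t}{4}\sum_{n=1}^{N-1}\Big\|\nabla\Big(\tfrac32u_h^{n+1}-u_h^n+\tfrac12u_h^{n-1}\Big)\Big\|^2$$ $$\leq\sum_{n=1}^{N-1}\frac{\Delta t}{\nu}\|f^{n+1}\|_{-1}^2+\frac14\|u_h^1\|^2+\frac14\|2u_h^1-u_h^0\|^2+\frac14\|u_h^1-u_h^0\|^2 .$$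
   Context: $\Omega\subset\mathbb{R}^d$ bounded regular domain; $\|\cdot\|,(\cdot,\cdot)$ the $L^2(\Omega)$ norm and inner product; $\|f\|_{-1}=\sup_{0\ne v\in X}(f,v)/\|\nabla v\|$. $X=[H^1_0]^d$, $Q=L^2_0$; $X_h\subset X$, $Q_h\subset Q$ conforming finite element spaces on a quasi-uniform mesh of size $h$ satisfying discrete inf-sup and $\|v_h\|\le Ch^{-1}\|\nabla v_h\|$ on $X_h$; $V_h=\{v_h\in X_h:(\nabla\cdot v_h,q_h)=0\ \forall q_h\in Q_h\}$. $b^{\ast}(u,v,w)=\tfrac12(u\cdot\nabla v,w)-\tfrac12(u\cdot\nabla w,v)$, $\nu>0$, constant step $\Delta t>0$. Constant timestep BE-AB2+F: for $n=1,\dots,N-1$, find $(\hat u_h^{n+1},p_h^{n+1})\in X_h\times Q_h$ with $\big(\tfrac{\hat u_h^{n+1}-u_h^n}{\Delta t},v_h\big)+\nu(\nabla\hat u_h^{n+1},\nabla v_h)+b^{\ast}(2u_h^n-u_h^{n-1},2u_h^n-u_h^{n-1},v_h)-(p_h^{n+1},\nabla\cdot v_h)=(f^{n+1},v_h)$ $\forall v_h\in X_h$, $(\nabla\cdot\hat u_h^{n+1},q_h)=0$ $\forall q_h\in Q_h$; then set $u_h^{n+1}=\hat u_h^{n+1}-\tfrac13(\hat u_h^{n+1}-2u_h^n+u_h^{n-1})$. (Equivalently $\hat u_h^{n+1}=\tfrac32u_h^{n+1}-u_h^n+\tfrac12u_h^{n-1}$.) *)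

theory Defs
  imports "HOL-Analysis.Analysis"
begin

text \<open>Concrete setting. Points of R^d are of type real^'d, velocity fields are maps
  real^'d \<Rightarrow> real^'d, velocity gradients are matrix fields real^'d \<Rightarrow> real^'d^'d
  (row i = gradient of the i-th component). All integrals are Lebesgue integrals over \<Omega>.\<close>

type_synonym 'd vfield = "real^'d \<Rightarrow> real^'d"

definition L2 :: "(real^'d) set \<Rightarrow> (real^'d \<Rightarrow> 'b::euclidean_space) \<Rightarrow> bool" where
  "L2 \<Omega> u \<longleftrightarrow> set_borel_measurable lebesgue \<Omega> u \<and>
                 set_integrable lebesgue \<Omega> (\<lambda>x. (norm (u x))\<^sup>2)"

definition l2inner :: "(real^'d) set \<Rightarrow> (real^'d \<Rightarrow> 'b::euclidean_space) \<Rightarrow> (real^'d \<Rightarrow> 'b) \<Rightarrow> real" where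
  "l2inner \<Omega> u v = (LINT x:\<Omega>|lebesgue. u x \<bullet> v x)"

definition l2norm :: "(real^'d) set \<Rightarrow> (real^'d \<Rightarrow> 'b::euclidean_space) \<Rightarrow> real" where
  "l2norm \<Omega> u = sqrt (l2inner \<Omega> u u)"

definition pderiv :: "(real^'d \<Rightarrow> real) \<Rightarrow> 'd \<Rightarrow> real^'d \<Rightarrow> real" where
  "pderiv \<phi> j x = frechet_derivative \<phi> (at x) (axis j 1)"

definition tsupport :: "(real^'d \<Rightarrow> real) \<Rightarrow> (real^'d) set" where
  "tsupport \<phi> = closure {x. \<phi> x \<noteq> 0}"

definition testfn :: "(real^'d) set \<Rightarrow> (real^'d \<Rightarrow> real) \<Rightarrow> bool" where
  "testfn \<Omega> \<phi> \<longleftrightarrow> (\<forall>x. \<phi> differentiable (at x)) \<and>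
     (\<forall>j. continuous_on UNIV (pderiv \<phi> j)) \<and>
     compact (tsupport \<phi>) \<and> tsupport \<phi> \<subseteq> \<Omega>"

definition testvfield :: "(real^'d) set \<Rightarrow> 'd vfield \<Rightarrow> bool" where
  "testvfield \<Omega> \<Psi> \<longleftrightarrow> (\<forall>i. testfn \<Omega> (\<lambda>x. \<Psi> x $ i))"

definition jac :: "'d vfield \<Rightarrow> real^'d \<Rightarrow> real^'d^'d" where
  "jac \<Psi> x = (\<chi> i j. pderiv (\<lambda>y. \<Psi> y $ i) j x)"

definition weak_grad :: "(real^'d) set \<Rightarrow> 'd vfield \<Rightarrow> (real^'d \<Rightarrow> real^'d^'d) \<Rightarrow> bool" where
  "weak_grad \<Omega> u G \<longleftrightarrow> (\<forall>\<phi>. testfn \<Omega> \<phi> \<longrightarrow> (\<forall>i j.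
      (LINT x:\<Omega>|lebesgue. u x $ i * pderiv \<phi> j x) = - (LINT x:\<Omega>|lebesgue. G x $ i $ j * \<phi> x)))"

definition H1 :: "(real^'d) set \<Rightarrow> 'd vfield \<Rightarrow> bool" where
  "H1 \<Omega> u \<longleftrightarrow> L2 \<Omega> u \<and> (\<exists>G. L2 \<Omega> G \<and> weak_grad \<Omega> u G)"

text \<open>the (a.e. unique) weak gradient\<close>
definition grad :: "(real^'d) set \<Rightarrow> 'd vfield \<Rightarrow> real^'d \<Rightarrow> real^'d^'d" where
  "grad \<Omega> u = (SOME G. L2 \<Omega> G \<and> weak_grad \<Omega> u G)"

text \<open>X = [H^1_0(\<Omega>)]^d: closure of C^1_c(\<Omega>)^d in the H^1 norm\<close>
definition Xsp :: "(real^'d) set \<Rightarrow> 'd vfield set" where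
  "Xsp \<Omega> = {u. H1 \<Omega> u \<and> (\<exists>\<Psi>::nat \<Rightarrow> 'd vfield. (\<forall>k. testvfield \<Omega> (\<Psi> k)) \<and>
       (\<lambda>k. l2norm \<Omega> (\<lambda>x. \<Psi> k x - u x)) \<longlonglongrightarrow> 0 \<and>
       (\<lambda>k. l2norm \<Omega> (\<lambda>x. jac (\<Psi> k) x - grad \<Omega> u x)) \<longlonglongrightarrow> 0)}"

definition Qsp :: "(real^'d) set \<Rightarrow> (real^'d \<Rightarrow> real) set" where
  "Qsp \<Omega> = {q. L2 \<Omega> q \<and> (LINT x:\<Omega>|lebesgue. q x) = 0}"

definition gradnorm :: "(real^'d) set \<Rightarrow> 'd vfield \<Rightarrow> real" where
  "gradnorm \<Omega> u = l2norm \<Omega> (grad \<Omega> u)"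

definition gradinner :: "(real^'d) set \<Rightarrow> 'd vfield \<Rightarrow> 'd vfield \<Rightarrow> real" where
  "gradinner \<Omega> u v = l2inner \<Omega> (grad \<Omega> u) (grad \<Omega> v)"

definition divg :: "(real^'d) set \<Rightarrow> 'd vfield \<Rightarrow> real^'d \<Rightarrow> real" where
  "divg \<Omega> u x = (\<Sum>i\<in>UNIV. grad \<Omega> u x $ i $ i)"

definition bstar :: "(real^'d) set \<Rightarrow> 'd vfield \<Rightarrow> 'd vfield \<Rightarrow> 'd vfield \<Rightarrow> real" where
  "bstar \<Omega> u v w = 1/2 * (LINT x:\<Omega>|lebesgue. (grad \<Omega> v x *v u x) \<bullet> w x)
                  - 1/2 * (LINT x:\<Omega>|lebesgue. (grad \<Omega> w x *v u x) \<bullet> v x)"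

definition hm1norm :: "(real^'d) set \<Rightarrow> 'd vfield \<Rightarrow> real" where
  "hm1norm \<Omega> f = Sup {l2inner \<Omega> f v / gradnorm \<Omega> v | v. v \<in> Xsp \<Omega> \<and> gradnorm \<Omega> v \<noteq> 0}"

definition fin_subspace :: "(real^'d \<Rightarrow> 'b::real_vector) set \<Rightarrow> bool" where
  "fin_subspace S \<longleftrightarrow> (\<lambda>x. 0) \<in> S \<and>
     (\<forall>u\<in>S. \<forall>v\<in>S. (\<lambda>x. u x + v x) \<in> S) \<and>
     (\<forall>c. \<forall>u\<in>S. (\<lambda>x. c *\<^sub>R u x) \<in> S) \<and>
     (\<exists>B. finite B \<and> S \<subseteq> {(\<lambda>x. \<Sum>b\<in>B. c b *\<^sub>R b x) | c. True})"

definition inf_sup :: "(real^'d) set \<Rightarrow> real \<Rightarrow> 'd vfield set \<Rightarrow> (real^'d \<Rightarrow> real) set \<Rightarrow> bool" where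
  "inf_sup \<Omega> \<beta> Xh Qh \<longleftrightarrow> (\<forall>q\<in>Qh. l2norm \<Omega> q \<noteq> 0 \<longrightarrow> (\<exists>v\<in>Xh. gradnorm \<Omega> v \<noteq> 0 \<and>
      l2inner \<Omega> q (divg \<Omega> v) \<ge> \<beta> * l2norm \<Omega> q * gradnorm \<Omega> v))"

definition Vh :: "(real^'d) set \<Rightarrow> 'd vfield set \<Rightarrow> (real^'d \<Rightarrow> real) set \<Rightarrow> 'd vfield set" where
  "Vh \<Omega> Xh Qh = {v\<in>Xh. \<forall>q\<in>Qh. l2inner \<Omega> (divg \<Omega> v) q = 0}"

definition BE_AB2F :: "(real^'d) set \<Rightarrow> 'd vfield set \<Rightarrow> (real^'d \<Rightarrow> real) set \<Rightarrow> real \<Rightarrow> real \<Rightarrow>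
     nat \<Rightarrow> (nat \<Rightarrow> 'd vfield) \<Rightarrow> (nat \<Rightarrow> 'd vfield) \<Rightarrow> (nat \<Rightarrow> 'd vfield) \<Rightarrow>
     (nat \<Rightarrow> real^'d \<Rightarrow> real) \<Rightarrow> bool" where
  "BE_AB2F \<Omega> Xh Qh \<nu> dt N f u uhat p \<longleftrightarrow>
    (\<forall>n\<in>{1..N-1}.
       uhat (n+1) \<in> Xh \<and> p (n+1) \<in> Qh \<and>
       (\<forall>v\<in>Xh.
          l2inner \<Omega> (\<lambda>x. (uhat (n+1) x - u n x) /\<^sub>R dt) v
          + \<nu> * gradinner \<Omega> (uhat (n+1)) v
          + bstar \<Omega> (\<lambda>x. 2 *\<^sub>R u n x - u (n-1) x) (\<lambda>x. 2 *\<^sub>R u n x - u (n-1) x) v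
          - l2inner \<Omega> (p (n+1)) (divg \<Omega> v)
          = l2inner \<Omega> (f (n+1)) v) \<and>
       (\<forall>q\<in>Qh. l2inner \<Omega> (divg \<Omega> (uhat (n+1))) q = 0) \<and>
       u (n+1) = (\<lambda>x. uhat (n+1) x - (1/3) *\<^sub>R (uhat (n+1) x - 2 *\<^sub>R u n x + u (n-1) x)))"

end

theory Submission
  imports Defs
begin

text \<open>Testing the scheme with \<open>w = uhat (n+1)\<close> and writing \<open>L = 2 u n - u (n-1)\<close>, \<open>v = w - L\<close>, the
  time difference contributes the energy increment plus the numerical dissipation \<open>|v|\<^sup>2 / 3\<close>. Since
  \<open>b\<^sup>*(L, w, w) = 0\<close>, the explicit convective term equals \<open>- b\<^sup>*(L, v, w)\<close>, and integrating by
  parts to take the derivative off \<open>v\<close> bounds it by \<open>C |\<nabla>L| |\<nabla>w| (|v| |\<nabla>v|)^(1/2)\<close>. The inverse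
  inequality replaces \<open>|\<nabla>v|\<close> by \<open>|v| / h\<close>, and under the step restriction viscosity and numerical
  dissipation absorb the result. The only Sobolev-type input is the bound
  \<open>|a b|\<^sup>2 \<le> C |\<nabla>a|\<^sup>2 |b| |\<nabla>b|\<close> for scalar functions, which follows from Gagliardo's argument along
  coordinate lines and the Cauchy-Schwarz inequality.\<close>

section \<open>Test functions\<close>

text \<open>The power of h in the step restriction shapes the argument. Estimating
  \<open>b*(L, v, w)\<close> directly leaves the full factor |\<nabla>v|, hence 1/h, which Young's
  inequality squares to 1/h^2. With the derivative moved off v, the inverse inequality costs only
  h^(-1/2), and squaring gives exactly 1/h. The price is a term with the divergence of L; as L is
  only discretely divergence-free, that term is estimated like the others. The viscous energy \<nu>
  dt |\<nabla>w|^2 is shared out: one half absorbs convection, one quarter the forcing, one quarter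
  remains in the result. Matching the coefficient 1/3 of the numerical dissipation gives the factor
  3/2 in the stability constant. Two features of the setting add work. The index type is known only
  by its cardinality, so iterated integrals run along abstract axes. And \<open>grad\<close> selects
  some weak gradient, so it is additive only almost everywhere; the inverse inequality speaks of the
  gradient selected for v = w - L, while integration by parts produces the difference of those
  selected for w and L. Identifying their norms requires uniqueness of weak gradients.\<close>

lemma testfn_has_derivative:
  assumes "testfn \<Omega> \<phi>"
  shows "(\<phi> has_derivative frechet_derivative \<phi> (at x)) (at x)"
  using assms unfolding testfn_def by (simp add: frechet_derivative_works)

lemma pderiv_eqI:
  assumes "(\<phi> has_derivative D) (at x)"
  shows "pderiv \<phi> j x = D (axis j 1)"
  unfolding pderiv_def using frechet_derivative_at[OF assms] by simp

text \<open>Off the closed set \<open>tsupport \<phi>\<close> the function vanishes on a whole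
  neighbourhood, so its derivative is that of a constant.\<close>

lemma testfn_outside:
  assumes "testfn \<Omega> \<phi>" "x \<notin> \<Omega>"
  shows "\<phi> x = 0" "pderiv \<phi> j x = 0"
proof -
  have x: "x \<in> - tsupport \<phi>"
    using assms unfolding testfn_def by auto
  have zero: "\<phi> y = 0" if "y \<in> - tsupport \<phi>" for y
    using that closure_subset[of "{x. \<phi> x \<noteq> 0}"] unfolding tsupport_def by blast
  show "\<phi> x = 0" by (rule zero[OF x])
  have "open (- tsupport \<phi>)" unfolding tsupport_def by (simp add: open_Compl)
  then have "((\<lambda>y. 0) has_derivative (\<lambda>h. 0)) (at x) = (\<phi> has_derivative (\<lambda>h. 0)) (at x)"
    using x zero by (metis has_derivative_const has_derivative_transform_within_open)
  then show "pderiv \<phi> j x = 0" using pderiv_eqI by fastforce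
qed

lemma testfn_continuous:
  assumes "testfn \<Omega> \<phi>"
  shows "continuous_on S \<phi>" "continuous_on S (pderiv \<phi> j)"
proof -
  have "continuous_on UNIV \<phi>"
    using assms unfolding testfn_def
    by (meson continuous_at_imp_continuous_on differentiable_imp_continuous_within)
  then show "continuous_on S \<phi>" by (rule continuous_on_subset) simp
  have "continuous_on UNIV (pderiv \<phi> j)" using assms unfolding testfn_def by blast
  then show "continuous_on S (pderiv \<phi> j)" by (rule continuous_on_subset) simp
qed

lemma testfn_borel [measurable]:
  assumes "testfn \<Omega> \<phi>"
  shows "\<phi> \<in> borel_measurable borel" "pderiv \<phi> j \<in> borel_measurable borel"
  using testfn_continuous[OF assms] by (simp_all add: borel_measurable_continuous_onI)

lemma testfn_bounded:
  assumes "testfn \<Omega> \<phi>"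
  obtains B where "B > 0" "\<And>x. \<bar>\<phi> x\<bar> \<le> B" "\<And>x j. \<bar>pderiv \<phi> j x\<bar> \<le> B"
proof -
  have K: "compact (tsupport \<phi>)" using assms unfolding testfn_def by blast
  \<comment> \<open>\<phi> is also a test function on its own support, so
    \<open>testfn_outside\<close> yields vanishing off the support and not merely off
    \<Omega>.\<close>
  have out: "testfn (tsupport \<phi>) \<phi>" using assms unfolding testfn_def by blast
  have "\<exists>B. \<forall>x. \<bar>g x\<bar> \<le> B" if "continuous_on UNIV g" "\<And>x. x \<notin> tsupport \<phi> \<Longrightarrow> g x = 0" for g :: "real^'a \<Rightarrow> real"
  proof -
    have "bounded (g ` tsupport \<phi>)"
      using K that(1) by (meson compact_continuous_image compact_imp_bounded continuous_on_subset subset_UNIV)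
    then obtain B where "\<And>x. x \<in> tsupport \<phi> \<Longrightarrow> \<bar>g x\<bar> \<le> B"
      unfolding bounded_iff by auto
    then have "\<bar>g x\<bar> \<le> max B 0" for x using that(2)[of x] by (cases "x \<in> tsupport \<phi>") (auto simp: le_max_iff_disj)
    then show ?thesis by blast
  qed
  note * = this
  obtain B0 where B0: "\<And>x. \<bar>\<phi> x\<bar> \<le> B0"
    using *[OF testfn_continuous(1)[OF assms]] testfn_outside(1)[OF out] by metis
  have "\<forall>j. \<exists>B. \<forall>x. \<bar>pderiv \<phi> j x\<bar> \<le> B"
    using *[OF testfn_continuous(2)[OF assms]] testfn_outside(2)[OF out] by metis
  then obtain B1 where B1: "\<And>j x. \<bar>pderiv \<phi> j x\<bar> \<le> B1 j" by metis
  have le: "B1 j \<le> (\<Sum>i\<in>UNIV. \<bar>B1 i\<bar>)" for j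
    using abs_ge_self[of "B1 j"] member_le_sum[of j UNIV "\<lambda>i. \<bar>B1 i\<bar>"] by simp
  show thesis
  proof (rule that[of "\<bar>B0\<bar> + (\<Sum>i\<in>UNIV. \<bar>B1 i\<bar>) + 1"])
    have "0 \<le> (\<Sum>i\<in>UNIV. \<bar>B1 i\<bar>)" by (simp add: sum_nonneg)
    then show "0 < \<bar>B0\<bar> + (\<Sum>i\<in>UNIV. \<bar>B1 i\<bar>) + 1"
      "\<bar>\<phi> x\<bar> \<le> \<bar>B0\<bar> + (\<Sum>i\<in>UNIV. \<bar>B1 i\<bar>) + 1" for x
      using B0[of x] by linarith+
    show "\<bar>pderiv \<phi> j x\<bar> \<le> \<bar>B0\<bar> + (\<Sum>i\<in>UNIV. \<bar>B1 i\<bar>) + 1" for x j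
      using B1[of j x] le[of j] by linarith
  qed
qed

text \<open>A compact K off which \<phi> vanishes is closed and hence contains
  \<open>tsupport \<phi>\<close>; the closure itself never has to be computed.\<close>

lemma testfnI:
  assumes D: "\<And>x. (\<phi> has_derivative D x) (at x)"
    and cont: "\<And>j. continuous_on UNIV (\<lambda>x. D x (axis j 1))"
    and K: "compact K" "K \<subseteq> \<Omega>" "\<And>x. x \<notin> K \<Longrightarrow> \<phi> x = 0"
  shows "testfn \<Omega> \<phi>"
proof -
  have "pderiv \<phi> j = (\<lambda>x. D x (axis j 1))" for j
    using pderiv_eqI[OF D] by auto
  moreover have "tsupport \<phi> \<subseteq> K"
    unfolding tsupport_def using K by (intro closure_minimal compact_imp_closed) auto
  moreover have "compact (tsupport \<phi>)"
    using \<open>tsupport \<phi> \<subseteq> K\<close> K(1) unfolding tsupport_def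
    by (meson bounded_subset closed_closure compact_eq_bounded_closed)
  ultimately show ?thesis
    unfolding testfn_def using D cont K(2) differentiableI by fastforce
qed

lemma tsupport_props:
  assumes "testfn \<Omega> \<phi>"
  shows "compact (tsupport \<phi>)" "tsupport \<phi> \<subseteq> \<Omega>" "\<And>x. x \<notin> tsupport \<phi> \<Longrightarrow> \<phi> x = 0"
proof -
  show "compact (tsupport \<phi>)" "tsupport \<phi> \<subseteq> \<Omega>" using assms unfolding testfn_def by blast+
  show "\<phi> x = 0" if "x \<notin> tsupport \<phi>" for x
    using that closure_subset[of "{x. \<phi> x \<noteq> 0}"] unfolding tsupport_def by blast
qed

lemma testfn_zero: "testfn \<Omega> (\<lambda>x. 0)"
  by (rule testfnI[of _ "\<lambda>x h. 0" "{}"]) auto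

lemma testfn_lincomb:
  assumes "testfn \<Omega> \<phi>" "testfn \<Omega> \<psi>"
  shows "testfn \<Omega> (\<lambda>x. a * \<phi> x + b * \<psi> x)"
    "pderiv (\<lambda>x. a * \<phi> x + b * \<psi> x) j x = a * pderiv \<phi> j x + b * pderiv \<psi> j x"
proof -
  have D: "((\<lambda>x. a * \<phi> x + b * \<psi> x) has_derivative
      (\<lambda>h. a * frechet_derivative \<phi> (at x) h + b * frechet_derivative \<psi> (at x) h)) (at x)" for x
    using has_derivative_add[OF has_derivative_mult_right[OF testfn_has_derivative[OF assms(1)]]
      has_derivative_mult_right[OF testfn_has_derivative[OF assms(2)]]] by blast
  show "pderiv (\<lambda>x. a * \<phi> x + b * \<psi> x) j x = a * pderiv \<phi> j x + b * pderiv \<psi> j x"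
    using pderiv_eqI[OF D] by (simp add: pderiv_def)
  show "testfn \<Omega> (\<lambda>x. a * \<phi> x + b * \<psi> x)"
  proof (rule testfnI[OF D, of "tsupport \<phi> \<union> tsupport \<psi>"])
    show "continuous_on UNIV (\<lambda>x. a * frechet_derivative \<phi> (at x) (axis j 1) + b * frechet_derivative \<psi> (at x) (axis j 1))" for j
      using testfn_continuous(2)[OF assms(1)] testfn_continuous(2)[OF assms(2)]
      by (intro continuous_intros) (auto simp: pderiv_def[abs_def])
  qed (use tsupport_props[OF assms(1)] tsupport_props[OF assms(2)] in auto)
qed

text \<open>\<phi> alone cuts off the product, so \<psi> may be any C^1 function, such as a
  coordinate x_j in the Poincare inequality.\<close>

lemma testfn_mult:
  assumes \<phi>: "testfn \<Omega> \<phi>" and \<psi>: "\<And>x. (\<psi> has_derivative D x) (at x)"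
    "\<And>j. continuous_on UNIV (\<lambda>x. D x (axis j 1))"
  shows "testfn \<Omega> (\<lambda>x. \<phi> x * \<psi> x)"
    "pderiv (\<lambda>x. \<phi> x * \<psi> x) j x = \<phi> x * D x (axis j 1) + pderiv \<phi> j x * \<psi> x"
proof -
  have E: "((\<lambda>x. \<phi> x * \<psi> x) has_derivative
      (\<lambda>h. \<phi> x * D x h + frechet_derivative \<phi> (at x) h * \<psi> x)) (at x)" for x
    by (rule has_derivative_mult[OF testfn_has_derivative[OF \<phi>] \<psi>(1)])
  show "pderiv (\<lambda>x. \<phi> x * \<psi> x) j x = \<phi> x * D x (axis j 1) + pderiv \<phi> j x * \<psi> x"
    using pderiv_eqI[OF E] by (simp add: pderiv_def)
  have c: "continuous_on UNIV \<psi>"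
    using \<psi>(1) by (meson continuous_at_imp_continuous_on has_derivative_continuous)
  show "testfn \<Omega> (\<lambda>x. \<phi> x * \<psi> x)"
  proof (rule testfnI[OF E, of "tsupport \<phi>"])
    show "continuous_on UNIV (\<lambda>x. \<phi> x * D x (axis j 1) + frechet_derivative \<phi> (at x) (axis j 1) * \<psi> x)" for j
      using testfn_continuous[OF \<phi>] c \<psi>(2)
      by (intro continuous_intros) (auto simp: pderiv_def[abs_def])
  qed (use tsupport_props[OF \<phi>] in auto)
qed

lemma testfn_mult_testfn:
  assumes "testfn \<Omega> \<phi>" "testfn \<Omega> \<psi>"
  shows "testfn \<Omega> (\<lambda>x. \<phi> x * \<psi> x)"
    "pderiv (\<lambda>x. \<phi> x * \<psi> x) j x = \<phi> x * pderiv \<psi> j x + pderiv \<phi> j x * \<psi> x"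
  using testfn_mult[OF assms(1) testfn_has_derivative[OF assms(2)]]
    testfn_continuous(2)[OF assms(2)] by (auto simp: pderiv_def[abs_def])

text \<open>The condition \<open>\<theta> 0 = 0\<close> keeps the composition zero off the support
  of \<phi>. It serves for the fourth power in the Gagliardo argument and for 1 - exp(-n t) in the
  approximation of indicators.\<close>

lemma testfn_compose:
  fixes \<theta> :: "real \<Rightarrow> real"
  assumes \<phi>: "testfn \<Omega> \<phi>" and \<theta>: "\<And>t. (\<theta> has_real_derivative \<theta>' t) (at t)"
    "continuous_on UNIV \<theta>'" "\<theta> 0 = 0"
  shows "testfn \<Omega> (\<lambda>x. \<theta> (\<phi> x))"
    "pderiv (\<lambda>x. \<theta> (\<phi> x)) j x = \<theta>' (\<phi> x) * pderiv \<phi> j x"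
proof -
  have E: "((\<lambda>x. \<theta> (\<phi> x)) has_derivative (\<lambda>h. \<theta>' (\<phi> x) * frechet_derivative \<phi> (at x) h)) (at x)" for x
    using has_derivative_compose[OF testfn_has_derivative[OF \<phi>] \<theta>(1)[unfolded has_field_derivative_def]] .
  show "pderiv (\<lambda>x. \<theta> (\<phi> x)) j x = \<theta>' (\<phi> x) * pderiv \<phi> j x"
    using pderiv_eqI[OF E] by (simp add: pderiv_def)
  show "testfn \<Omega> (\<lambda>x. \<theta> (\<phi> x))"
  proof (rule testfnI[OF E, of "tsupport \<phi>"])
    have "continuous_on UNIV (\<lambda>x. \<theta>' (\<phi> x))"
      by (rule continuous_on_compose2[OF \<theta>(2) testfn_continuous(1)[OF \<phi>]]) simp
    then show "continuous_on UNIV (\<lambda>x. \<theta>' (\<phi> x) * frechet_derivative \<phi> (at x) (axis j 1))" for j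
      using testfn_continuous[OF \<phi>]
      by (intro continuous_intros) (auto simp: pderiv_def[abs_def])
  qed (use tsupport_props[OF \<phi>] \<theta>(3) in auto)
qed

lemma testfn_sum:
  assumes "finite I" "\<And>i. i \<in> I \<Longrightarrow> testfn \<Omega> (\<phi> i)"
  shows "testfn \<Omega> (\<lambda>x. \<Sum>i\<in>I. \<phi> i x)"
  using assms
proof (induction I rule: finite_induct)
  case empty then show ?case by (simp add: testfn_zero)
next
  case (insert i I)
  then show ?case using testfn_lincomb(1)[of \<Omega> "\<phi> i" "\<lambda>x. \<Sum>i\<in>I. \<phi> i x" 1 1] by simp
qed

text \<open>On a coordinate line the partial derivative becomes an ordinary one, which makes the
  mean value theorem and the fundamental theorem of calculus available.\<close>

lemma testfn_line_derivative:
  assumes "testfn \<Omega> \<phi>"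
  shows "((\<lambda>t. \<phi> (q + t *\<^sub>R axis j 1)) has_real_derivative pderiv \<phi> j (q + t *\<^sub>R axis j 1)) (at t)"
proof -
  have "((\<lambda>t. \<phi> (q + t *\<^sub>R axis j 1)) has_derivative
     (\<lambda>h. frechet_derivative \<phi> (at (q + t *\<^sub>R axis j 1)) (h *\<^sub>R axis j 1))) (at t)"
    by (rule has_derivative_compose[OF _ testfn_has_derivative[OF assms]])
       (auto intro!: derivative_eq_intros)
  moreover have "frechet_derivative \<phi> (at (q + t *\<^sub>R axis j 1)) (h *\<^sub>R axis j 1)
      = pderiv \<phi> j (q + t *\<^sub>R axis j 1) * h" for h
    using linear_scale[OF has_derivative_linear[OF testfn_has_derivative[OF assms]]]
    by (simp add: pderiv_def)
  ultimately show ?thesis unfolding has_field_derivative_def by simp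
qed

lemma integrable_compact_support:
  fixes g :: "'a::euclidean_space \<Rightarrow> real"
  assumes "continuous_on UNIV g" "bounded K" "\<And>x. x \<notin> K \<Longrightarrow> g x = 0"
  shows "integrable lborel g"
proof -
  obtain r where r: "K \<subseteq> cball 0 r" using bounded_subset_ballD[OF assms(2), of 0] ball_subset_cball by (meson order_trans)
  have "integrable lborel (\<lambda>x. indicator (cball 0 r) x *\<^sub>R g x)"
    by (rule borel_integrable_compact) (use assms(1) continuous_on_subset in auto)
  moreover have "(\<lambda>x. indicator (cball 0 r) x *\<^sub>R g x) = g"
    using r assms(3) by (fastforce simp: indicator_def)
  ultimately show ?thesis by simp
qed

lemma testfn_integrable:
  assumes "testfn \<Omega> \<phi>"
  shows "integrable lborel \<phi>" "integrable lborel (pderiv \<phi> j)"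
proof -
  have t: "testfn (tsupport \<phi>) \<phi>" using assms unfolding testfn_def by blast
  have b: "bounded (tsupport \<phi>)" using tsupport_props(1)[OF assms] compact_imp_bounded by blast
  show "integrable lborel \<phi>" "integrable lborel (pderiv \<phi> j)"
    using integrable_compact_support[OF testfn_continuous(1)[OF assms] b testfn_outside(1)[OF t]]
     integrable_compact_support[OF testfn_continuous(2)[OF assms] b testfn_outside(2)[OF t]] by auto
qed

section \<open>Partial derivatives of test functions integrate to zero\<close>

lemma integral_translation:
  fixes g :: "'a::euclidean_space \<Rightarrow> real"
  assumes "g \<in> borel_measurable borel"
  shows "(\<integral>x. g (c + x) \<partial>lborel) = (\<integral>x. g x \<partial>lborel)"
proof -
  have "(\<integral>x. g x \<partial>lborel) = (\<integral>x. g x \<partial>distr lborel borel ((+) c))"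
    by (simp add: lborel_distr_plus)
  also have "\<dots> = (\<integral>x. g (c + x) \<partial>lborel)"
    by (rule integral_distr) (use assms in auto)
  finally show ?thesis by simp
qed

text \<open>By translation invariance every difference quotient of \<open>\<phi>\<close> integrates to 0.\<close>

lemma integral_pderiv_eq_0:
  assumes "testfn \<Omega> \<phi>"
  shows "(\<integral>x. pderiv \<phi> j x \<partial>lborel) = 0"
proof -
  define e where "e = (axis j 1 :: real^'a)"
  define F where "F n x = (\<phi> (x + (1 / real (Suc n)) *\<^sub>R e) - \<phi> x) * real (Suc n)" for n x
  obtain B where B: "B > 0" "\<And>x. \<bar>\<phi> x\<bar> \<le> B" "\<And>x j. \<bar>pderiv \<phi> j x\<bar> \<le> B"
    using testfn_bounded[OF assms] by metis
  obtain r where r: "tsupport \<phi> \<subseteq> cball 0 r"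
    using bounded_subset_ballD[OF compact_imp_bounded[OF tsupport_props(1)[OF assms]], of 0]
      ball_subset_cball by (meson order_trans)
  have meas[measurable]: "\<phi> \<in> borel_measurable borel" using testfn_borel[OF assms] by simp
  have int: "integrable lborel (\<lambda>x. \<phi> (c + x))" for c
    using testfn_integrable(1)[OF assms] integrable_distr_eq[of "(+) c" lborel borel \<phi>]
    by (simp add: lborel_distr_plus comp_def)
  have zero: "(\<integral>x. F n x \<partial>lborel) = 0" for n
  proof -
    define c where "c = (1 / real (Suc n)) *\<^sub>R e"
    have "F n = (\<lambda>x. (\<phi> (c + x) - \<phi> (0 + x)) * real (Suc n))"
      by (auto simp: F_def c_def add.commute)
    then have "(\<integral>x. F n x \<partial>lborel) = (\<integral>x. \<phi> (c + x) - \<phi> (0 + x) \<partial>lborel) * real (Suc n)"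
      by simp
    also have "(\<integral>x. \<phi> (c + x) - \<phi> (0 + x) \<partial>lborel) = 0"
      using Bochner_Integration.integral_diff[OF int[of c] int[of 0]]
        integral_translation[OF meas, of c] by simp
    finally show ?thesis by simp
  qed
  have lim: "(\<lambda>n. F n x) \<longlonglongrightarrow> pderiv \<phi> j x" for x
  proof -
    have "(\<lambda>h. (\<phi> (x + (0 + h) *\<^sub>R e) - \<phi> (x + 0 *\<^sub>R e)) / h) \<midarrow>0\<rightarrow> pderiv \<phi> j (x + 0 *\<^sub>R e)"
      using testfn_line_derivative[OF assms, of x j 0] unfolding DERIV_def e_def by simp
    moreover have "filterlim (\<lambda>n. 1 / real (Suc n)) (at 0) sequentially"
      unfolding filterlim_at using LIMSEQ_inverse_real_of_nat by (auto simp: inverse_eq_divide)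
    ultimately have "(\<lambda>n. (\<phi> (x + (0 + 1 / real (Suc n)) *\<^sub>R e) - \<phi> (x + 0 *\<^sub>R e)) / (1 / real (Suc n)))
        \<longlonglongrightarrow> pderiv \<phi> j (x + 0 *\<^sub>R e)"
      by (rule filterlim_compose)
    then show ?thesis by (simp add: F_def)
  qed
  \<comment> \<open>The mean value theorem bounds every quotient by B. The shift has length at most
    1, so all quotients vanish outside the ball of radius r + 1, and one integrable majorant serves
    for all n.\<close>
  have bound: "norm (F n x) \<le> B * indicator (cball 0 (r+1)) x" for n x
  proof (cases "x \<in> cball 0 (r+1)")
    case True
    define h where "h = 1 / real (Suc n)"
    have h: "h > 0" by (simp add: h_def)
    obtain s where s: "0 < s" "s < h"
        "\<phi> (x + h *\<^sub>R e) - \<phi> (x + 0 *\<^sub>R e) = (h - 0) * pderiv \<phi> j (x + s *\<^sub>R e)"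
      using MVT2[OF h, of "\<lambda>t. \<phi> (x + t *\<^sub>R e)" "\<lambda>t. pderiv \<phi> j (x + t *\<^sub>R e)"]
        testfn_line_derivative[OF assms] unfolding e_def by metis
    then have "F n x = pderiv \<phi> j (x + s *\<^sub>R e)"
      unfolding F_def h_def by simp
    then show ?thesis using B(3) True by simp
  next
    case False
    define c where "c = (1 / real (Suc n)) *\<^sub>R e"
    have "norm c \<le> 1" by (simp add: c_def e_def norm_axis_1)
    moreover have "norm x \<le> norm (x + c) + norm c"
      by (metis add_diff_cancel_right' norm_triangle_ineq4)
    moreover have "norm x > r + 1" using False by (simp add: dist_norm)
    ultimately have "norm x > r" "norm (x + c) > r" by linarith+
    then have "x \<notin> tsupport \<phi>" "x + (1 / real (Suc n)) *\<^sub>R e \<notin> tsupport \<phi>"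
      using r unfolding c_def by (auto simp del: of_nat_Suc)
    then show ?thesis using tsupport_props(3)[OF assms] False unfolding F_def by simp
  qed
  have "(\<lambda>n. (\<integral>x. F n x \<partial>lborel)) \<longlonglongrightarrow> (\<integral>x. pderiv \<phi> j x \<partial>lborel)"
  proof (rule integral_dominated_convergence[where w = "\<lambda>x. B * indicator (cball 0 (r+1)) x"])
    show "integrable lborel (\<lambda>x::real^'a. B * indicator (cball 0 (r+1)) x)"
      using emeasure_bounded_finite[OF bounded_cball, of "0::real^'a" "r+1"]
      by (intro integrable_mult_right integrable_real_indicator) (auto simp: less_top)
    show "pderiv \<phi> j \<in> borel_measurable lborel" using testfn_borel[OF assms] by simp
    show "F n \<in> borel_measurable lborel" for n unfolding F_def by measurable
  qed (use lim bound in auto)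
  then show ?thesis using zero by (simp add: LIMSEQ_const_iff)
qed

section \<open>Gagliardo and Ladyzhenskaya inequalities\<close>

text \<open>The fundamental theorem of calculus, started at a point of the line beyond the support.
  What matters is that the bound no longer depends on s: it is a function of the remaining
  coordinates only.\<close>

lemma testfn_le_line_integral:
  assumes "testfn \<Omega> \<theta>"
  shows "ennreal \<bar>\<theta> (q + s *\<^sub>R axis j 1)\<bar>
    \<le> (\<integral>\<^sup>+t. ennreal \<bar>pderiv \<theta> j (q + t *\<^sub>R axis j 1)\<bar> \<partial>lborel)"
proof -
  obtain r where r: "r > 0" "tsupport \<theta> \<subseteq> ball 0 r"
    using bounded_subset_ballD[OF compact_imp_bounded[OF tsupport_props(1)[OF assms]], of 0] by auto
  define g where "g t = \<theta> (q + t *\<^sub>R axis j 1)" for t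
  define g' where "g' t = pderiv \<theta> j (q + t *\<^sub>R axis j 1)" for t
  \<comment> \<open>Chosen so that a lies left of s and the point with parameter a has norm at least
    r, hence lies off the support.\<close>
  define a where "a = - (r + norm q + \<bar>s\<bar>)"
  have as: "a \<le> s" using r(1) norm_ge_zero[of q] unfolding a_def by linarith
  have "norm (a *\<^sub>R (axis j 1 :: real^'a)) = r + norm q + \<bar>s\<bar>"
  proof -
    have "a \<le> 0" using r(1) norm_ge_zero[of q] unfolding a_def by linarith
    then show ?thesis by (simp add: norm_axis_1 a_def)
  qed
  moreover have "norm (a *\<^sub>R (axis j 1 :: real^'a)) \<le> norm (q + a *\<^sub>R axis j 1) + norm q"
    by (metis add.commute add_diff_cancel_right' norm_triangle_ineq4)
  ultimately have "\<not> norm (q + a *\<^sub>R axis j 1) < r" by linarith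
  then have "q + a *\<^sub>R axis j 1 \<notin> tsupport \<theta>" using r(2) by (auto simp: subset_iff)
  then have ga: "g a = 0" using tsupport_props(3)[OF assms] unfolding g_def by blast
  have cont: "continuous_on A g'" for A
  proof -
    have "continuous_on UNIV g'" unfolding g'_def
      by (rule continuous_on_compose2[OF testfn_continuous(2)[OF assms, of UNIV]])
         (auto intro!: continuous_intros)
    then show ?thesis by (rule continuous_on_subset) simp
  qed
  have meas[measurable]: "g' \<in> borel_measurable borel"
    by (rule borel_measurable_continuous_onI[OF cont])
  have int: "integrable lborel (\<lambda>t. indicator {a..s} t *\<^sub>R g' t)"
    by (rule borel_integrable_compact[OF _ cont]) simp
  have "(\<integral>t. indicator {a..s} t *\<^sub>R g' t \<partial>lborel) = g s - g a"
  proof (rule integral_FTC_atLeastAtMost[OF as _ cont])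
    show "(g has_vector_derivative g' x) (at x within {a..s})" for x
      using testfn_line_derivative[OF assms, of q j x] unfolding g_def g'_def
      by (simp add: has_real_derivative_iff_has_vector_derivative has_vector_derivative_at_within)
  qed
  then have "ennreal \<bar>g s\<bar> \<le> (\<integral>\<^sup>+t. ennreal (norm (indicator {a..s} t *\<^sub>R g' t)) \<partial>lborel)"
    using integral_norm_bound_ennreal[OF int] ga by simp
  also have "\<dots> \<le> (\<integral>\<^sup>+t. ennreal \<bar>g' t\<bar> \<partial>lborel)"
    by (intro nn_integral_mono) (auto simp: indicator_def)
  finally show ?thesis unfolding g_def g'_def .
qed

section \<open>Lebesgue measure in two and three abstract coordinates\<close>

lemma prod_Basis_vec:
  fixes f :: "real^'d \<Rightarrow> real"
  shows "(\<Prod>b\<in>Basis. f b) = (\<Prod>k\<in>UNIV. f (axis k 1))"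
proof -
  have "(Basis :: (real^'d) set) = (\<lambda>k. axis k 1) ` UNIV"
    by (auto simp: Basis_vec_def)
  then have "prod f Basis = prod f ((\<lambda>k. axis k 1) ` UNIV)" by metis
  also have "\<dots> = (\<Prod>k\<in>UNIV. f (axis k 1))"
    by (subst prod.reindex) (auto simp: inj_on_def axis_eq_axis)
  finally show ?thesis .
qed

lemma box_vec_iff: "x \<in> box l u \<longleftrightarrow> (\<forall>k. l $ k < x $ k \<and> x $ k < u $ k)" for x :: "real^'d"
  by (simp add: mem_box_cart)

text \<open>The preimage of a box under the coordinate map is a box with the same side lengths, and
  Lebesgue measure is determined by the volumes of boxes.\<close>

lemma lborel_distr_coords2:
  fixes i j :: "'d::finite"
  assumes ij: "i \<noteq> j" "UNIV = {i, j}"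
  shows "distr lborel borel (\<lambda>(x::real, y::real). x *\<^sub>R axis i 1 + y *\<^sub>R axis j 1) = (lborel :: (real^'d) measure)"
    (is "distr lborel borel ?T = _")
proof (rule lborel_eqI[symmetric])
  have m[measurable]: "?T \<in> borel_measurable borel"
    by (intro borel_measurable_continuous_onI) (auto intro!: continuous_intros simp: case_prod_beta)
  fix l u :: "real^'d"
  assume lu: "\<And>b. b \<in> Basis \<Longrightarrow> l \<bullet> b \<le> u \<bullet> b"
  have lu': "l $ k \<le> u $ k" for k
    using lu[of "axis k 1"] by (simp add: inner_axis)
  have ex: "(\<forall>k. P k) \<longleftrightarrow> P i \<and> P j" for P
    using ij(2) by (metis UNIV_I insert_iff singletonD)
  have "?T -` box l u = box (l $ i, l $ j) (u $ i, u $ j)"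
    using ij(1) by (auto simp: box_vec_iff ex mem_box Basis_prod_def axis_def)
  then have "emeasure (distr lborel borel ?T) (box l u) = emeasure lborel (box (l $ i, l $ j) (u $ i, u $ j))"
    by (simp add: emeasure_distr)
  also have "\<dots> = ennreal ((u $ i - l $ i) * (u $ j - l $ j))"
    using lu' by (simp add: emeasure_lborel_box_eq Basis_prod_def prod.union_disjoint)
  also have "(u $ i - l $ i) * (u $ j - l $ j) = (\<Prod>b\<in>Basis. (u - l) \<bullet> b)"
    unfolding prod_Basis_vec ij(2) using ij(1) by (simp add: inner_axis)
  finally show "emeasure (distr lborel borel ?T) (box l u) = ennreal (\<Prod>b\<in>Basis. (u - l) \<bullet> b)" .
qed simp

lemma lborel_distr_coords3:
  fixes i j k :: "'d::finite"
  assumes ij: "i \<noteq> j" "i \<noteq> k" "j \<noteq> k" "UNIV = {i, j, k}"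
  shows "distr lborel borel (\<lambda>(x::real, y::real, z::real). x *\<^sub>R axis i 1 + y *\<^sub>R axis j 1 + z *\<^sub>R axis k 1)
    = (lborel :: (real^'d) measure)" (is "distr lborel borel ?T = _")
proof (rule lborel_eqI[symmetric])
  have m[measurable]: "?T \<in> borel_measurable borel"
    by (intro borel_measurable_continuous_onI) (auto intro!: continuous_intros simp: case_prod_beta)
  fix l u :: "real^'d"
  assume lu: "\<And>b. b \<in> Basis \<Longrightarrow> l \<bullet> b \<le> u \<bullet> b"
  have lu': "l $ k \<le> u $ k" for k
    using lu[of "axis k 1"] by (simp add: inner_axis)
  have ex: "(\<forall>k. P k) \<longleftrightarrow> P i \<and> P j \<and> P k" for P
    using ij(4) by (metis UNIV_I insert_iff singletonD)
  have "?T -` box l u = box (l $ i, l $ j, l $ k) (u $ i, u $ j, u $ k)"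
    using ij(1-3) by (auto simp: box_vec_iff ex mem_box Basis_prod_def axis_def)
  then have "emeasure (distr lborel borel ?T) (box l u) = emeasure lborel (box (l $ i, l $ j, l $ k) (u $ i, u $ j, u $ k))"
    by (simp add: emeasure_distr)
  also have "\<dots> = ennreal ((u $ i - l $ i) * ((u $ j - l $ j) * (u $ k - l $ k)))"
    using lu' by (simp add: emeasure_lborel_box_eq Basis_prod_def prod.union_disjoint image_Un Un_assoc)
  also have "(u $ i - l $ i) * ((u $ j - l $ j) * (u $ k - l $ k)) = (\<Prod>b\<in>Basis. (u - l) \<bullet> b)"
    unfolding prod_Basis_vec ij(4) using ij(1-3) by (simp add: inner_axis)
  finally show "emeasure (distr lborel borel ?T) (box l u) = ennreal (\<Prod>b\<in>Basis. (u - l) \<bullet> b)" .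
qed simp

text \<open>i and j are interchangeable, so the variable of a line integral can be placed innermost
  by permuting the axes.\<close>

lemma nn_integral_coords2:
  fixes i j :: "'d::finite" and f :: "real^'d \<Rightarrow> ennreal"
  assumes ij: "i \<noteq> j" "UNIV = {i, j}" and f[measurable]: "f \<in> borel_measurable borel"
  shows "(\<integral>\<^sup>+p. f p \<partial>lborel) = (\<integral>\<^sup>+x. \<integral>\<^sup>+y. f (x *\<^sub>R axis i 1 + y *\<^sub>R axis j 1) \<partial>lborel \<partial>lborel)"
proof -
  let ?T = "\<lambda>(x::real, y::real). x *\<^sub>R axis i 1 + y *\<^sub>R axis j 1 :: real^'d"
  have m[measurable]: "?T \<in> borel_measurable borel"
    by (intro borel_measurable_continuous_onI) (auto intro!: continuous_intros simp: case_prod_beta)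
  have "(\<integral>\<^sup>+p. f p \<partial>lborel) = (\<integral>\<^sup>+p. f p \<partial>distr lborel borel ?T)"
    by (simp add: lborel_distr_coords2[OF ij])
  also have "\<dots> = (\<integral>\<^sup>+p. f (?T p) \<partial>(lborel \<Otimes>\<^sub>M lborel))"
    unfolding lborel_prod by (rule nn_integral_distr) auto
  also have "\<dots> = (\<integral>\<^sup>+x. \<integral>\<^sup>+y. f (?T (x, y)) \<partial>lborel \<partial>lborel)"
    by (rule lborel.nn_integral_fst[symmetric]) (simp add: lborel_prod measurable_compose[OF m f])
  finally show ?thesis by simp
qed

lemma nn_integral_coords3:
  fixes i j k :: "'d::finite" and f :: "real^'d \<Rightarrow> ennreal"
  assumes ij: "i \<noteq> j" "i \<noteq> k" "j \<noteq> k" "UNIV = {i, j, k}" and f[measurable]: "f \<in> borel_measurable borel"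
  shows "(\<integral>\<^sup>+p. f p \<partial>lborel) =
    (\<integral>\<^sup>+x. \<integral>\<^sup>+y. \<integral>\<^sup>+z. f (x *\<^sub>R axis i 1 + y *\<^sub>R axis j 1 + z *\<^sub>R axis k 1) \<partial>lborel \<partial>lborel \<partial>lborel)"
proof -
  let ?T = "\<lambda>(x::real, y::real, z::real). x *\<^sub>R axis i 1 + y *\<^sub>R axis j 1 + z *\<^sub>R axis k 1 :: real^'d"
  have m[measurable]: "?T \<in> borel_measurable borel"
    by (intro borel_measurable_continuous_onI) (auto intro!: continuous_intros simp: case_prod_beta)
  have m2: "(\<lambda>p. ?T (x, p)) \<in> borel_measurable borel" for x
    by (intro borel_measurable_continuous_onI) (auto intro!: continuous_intros simp: case_prod_beta)
  have "(\<integral>\<^sup>+p. f p \<partial>lborel) = (\<integral>\<^sup>+p. f p \<partial>distr lborel borel ?T)"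
    by (simp add: lborel_distr_coords3[OF ij])
  also have "\<dots> = (\<integral>\<^sup>+p. f (?T p) \<partial>(lborel \<Otimes>\<^sub>M lborel))"
    unfolding lborel_prod by (rule nn_integral_distr) auto
  also have "\<dots> = (\<integral>\<^sup>+x. \<integral>\<^sup>+q. f (?T (x, q)) \<partial>lborel \<partial>lborel)"
    by (rule lborel.nn_integral_fst[symmetric]) (simp add: lborel_prod measurable_compose[OF m f])
  also have "\<dots> = (\<integral>\<^sup>+x. \<integral>\<^sup>+y. \<integral>\<^sup>+z. f (?T (x, y, z)) \<partial>lborel \<partial>lborel \<partial>lborel)"
  proof (rule nn_integral_cong)
    fix x :: real
    have "(\<integral>\<^sup>+q. f (?T (x, q)) \<partial>lborel) = (\<integral>\<^sup>+q. f (?T (x, q)) \<partial>(lborel \<Otimes>\<^sub>M lborel))"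
      by (simp add: lborel_prod)
    also have "\<dots> = (\<integral>\<^sup>+y. \<integral>\<^sup>+z. f (?T (x, y, z)) \<partial>lborel \<partial>lborel)"
      by (rule lborel.nn_integral_fst[symmetric]) (use measurable_compose[OF m2 f] in \<open>simp add: lborel_prod\<close>)
    finally show "(\<integral>\<^sup>+q. f (?T (x, q)) \<partial>lborel) = (\<integral>\<^sup>+y. \<integral>\<^sup>+z. f (?T (x, y, z)) \<partial>lborel \<partial>lborel)" .
  qed
  finally show ?thesis by simp
qed

text \<open>Two applications of Cauchy-Schwarz: in z for fixed x and y, which separates f from g,
  and then in the pair (x, y) against h, which is constant in z.\<close>

lemma Loomis_Whitney_3:
  fixes f g h :: "real \<times> real \<Rightarrow> ennreal"
  assumes [measurable]: "f \<in> borel_measurable (lborel \<Otimes>\<^sub>M lborel)"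
    "g \<in> borel_measurable (lborel \<Otimes>\<^sub>M lborel)" "h \<in> borel_measurable (lborel \<Otimes>\<^sub>M lborel)"
  shows "(\<integral>\<^sup>+x. \<integral>\<^sup>+y. \<integral>\<^sup>+z. f (y, z) * g (x, z) * h (x, y) \<partial>lborel \<partial>lborel \<partial>lborel)\<^sup>2
    \<le> (\<integral>\<^sup>+y. \<integral>\<^sup>+z. (f (y, z))\<^sup>2 \<partial>lborel \<partial>lborel) * (\<integral>\<^sup>+x. \<integral>\<^sup>+z. (g (x, z))\<^sup>2 \<partial>lborel \<partial>lborel)
      * (\<integral>\<^sup>+x. \<integral>\<^sup>+y. (h (x, y))\<^sup>2 \<partial>lborel \<partial>lborel)"
proof -
  \<comment> \<open>The inner integral over z; its square is at most \<open>A y * B x\<close>, a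
    product of functions of one variable each.\<close>
  define Q where "Q p = (\<integral>\<^sup>+z. f (snd p, z) * g (fst p, z) \<partial>lborel)" for p
  define A where "A y = (\<integral>\<^sup>+z. (f (y, z))\<^sup>2 \<partial>lborel)" for y
  define B where "B x = (\<integral>\<^sup>+z. (g (x, z))\<^sup>2 \<partial>lborel)" for x
  have [measurable]: "Q \<in> borel_measurable (lborel \<Otimes>\<^sub>M lborel)" "A \<in> borel_measurable lborel"
    "B \<in> borel_measurable lborel"
    unfolding Q_def[abs_def] A_def[abs_def] B_def[abs_def] by measurable
  have QAB: "(Q (x, y))\<^sup>2 \<le> A y * B x" for x y
    unfolding Q_def A_def B_def using Cauchy_Schwarz_nn_integral[of "\<lambda>z. f (y, z)" lborel "\<lambda>z. g (x, z)"] by simp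
  have "(\<integral>\<^sup>+x. \<integral>\<^sup>+y. \<integral>\<^sup>+z. f (y, z) * g (x, z) * h (x, y) \<partial>lborel \<partial>lborel \<partial>lborel)
      = (\<integral>\<^sup>+x. \<integral>\<^sup>+y. Q (x, y) * h (x, y) \<partial>lborel \<partial>lborel)"
    unfolding Q_def by (simp add: nn_integral_multc)
  also have "\<dots> = (\<integral>\<^sup>+p. Q p * h p \<partial>(lborel \<Otimes>\<^sub>M lborel))"
    by (rule lborel.nn_integral_fst) measurable
  finally have "(\<integral>\<^sup>+x. \<integral>\<^sup>+y. \<integral>\<^sup>+z. f (y, z) * g (x, z) * h (x, y) \<partial>lborel \<partial>lborel \<partial>lborel)\<^sup>2
      \<le> (\<integral>\<^sup>+p. (Q p)\<^sup>2 \<partial>(lborel \<Otimes>\<^sub>M lborel)) * (\<integral>\<^sup>+p. (h p)\<^sup>2 \<partial>(lborel \<Otimes>\<^sub>M lborel))"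
    using Cauchy_Schwarz_nn_integral[of Q "lborel \<Otimes>\<^sub>M lborel" h] by simp
  also have "(\<integral>\<^sup>+p. (Q p)\<^sup>2 \<partial>(lborel \<Otimes>\<^sub>M lborel)) = (\<integral>\<^sup>+x. \<integral>\<^sup>+y. (Q (x, y))\<^sup>2 \<partial>lborel \<partial>lborel)"
    by (rule lborel.nn_integral_fst[symmetric]) measurable
  also have "\<dots> \<le> (\<integral>\<^sup>+x. \<integral>\<^sup>+y. A y * B x \<partial>lborel \<partial>lborel)"
    by (intro nn_integral_mono QAB)
  also have "\<dots> = (\<integral>\<^sup>+y. A y \<partial>lborel) * (\<integral>\<^sup>+x. B x \<partial>lborel)"
    by (simp add: nn_integral_multc nn_integral_cmult)
  also have "(\<integral>\<^sup>+p. (h p)\<^sup>2 \<partial>(lborel \<Otimes>\<^sub>M lborel)) = (\<integral>\<^sup>+x. \<integral>\<^sup>+y. (h (x, y))\<^sup>2 \<partial>lborel \<partial>lborel)"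
    by (rule lborel.nn_integral_fst[symmetric]) measurable
  finally show ?thesis unfolding A_def B_def by (simp add: mult_right_mono)
qed


text \<open>Line integrals may a priori be infinite for some lines. Sending \<open>top\<close> to
  \<open>top\<close> makes squaring an exact inverse on all extended values.\<close>

definition ennreal_sqrt :: "ennreal \<Rightarrow> ennreal" where
  "ennreal_sqrt a = (if a = top then top else ennreal (sqrt (enn2real a)))"

lemma ennreal_sqrt_power2 [simp]: "(ennreal_sqrt a)\<^sup>2 = a"
  by (cases a) (auto simp: ennreal_sqrt_def ennreal_power)

lemma le_ennreal_sqrt: "0 \<le> r \<Longrightarrow> ennreal (r\<^sup>2) \<le> a \<Longrightarrow> ennreal r \<le> ennreal_sqrt a"
  by (cases a) (auto simp: ennreal_sqrt_def intro!: ennreal_leI real_le_rsqrt)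

lemma measurable_ennreal_sqrt [measurable]: "ennreal_sqrt \<in> borel_measurable borel"
  unfolding ennreal_sqrt_def[abs_def] by measurable

text \<open>\<phi> is dominated by its line integral in direction i, which depends on y alone, and
  \<psi> by the one in direction j, which depends on x alone. The double integral of the product of
  these bounds factorizes.\<close>

lemma nn_Ladyzhenskaya:
  fixes i j :: "'d::finite" and \<phi> \<psi> :: "real^'d \<Rightarrow> real"
  assumes ij: "i \<noteq> j" "UNIV = {i, j}" and \<phi>: "testfn \<Omega> \<phi>" and \<psi>: "testfn \<Omega> \<psi>"
  shows "(\<integral>\<^sup>+p. ennreal \<bar>\<phi> p * \<psi> p\<bar> \<partial>lborel)
    \<le> (\<integral>\<^sup>+p. ennreal \<bar>pderiv \<phi> i p\<bar> \<partial>lborel) * (\<integral>\<^sup>+p. ennreal \<bar>pderiv \<psi> j p\<bar> \<partial>lborel)"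
proof -
  note [measurable] = testfn_borel[OF \<phi>] testfn_borel[OF \<psi>]
  define T where "T x y = x *\<^sub>R axis i 1 + y *\<^sub>R (axis j 1 :: real^'d)" for x y
  define A where "A y = (\<integral>\<^sup>+t. ennreal \<bar>pderiv \<phi> i (T t y)\<bar> \<partial>lborel)" for y
  define B where "B x = (\<integral>\<^sup>+t. ennreal \<bar>pderiv \<psi> j (T x t)\<bar> \<partial>lborel)" for x
  have [measurable]: "A \<in> borel_measurable lborel" "B \<in> borel_measurable lborel"
    unfolding A_def[abs_def] B_def[abs_def] T_def by measurable
  have A: "ennreal \<bar>\<phi> (T x y)\<bar> \<le> A y" for x y
    using testfn_le_line_integral[OF \<phi>, of "y *\<^sub>R axis j 1" x i] unfolding A_def T_def by (simp add: add.commute)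
  have B: "ennreal \<bar>\<psi> (T x y)\<bar> \<le> B x" for x y
    using testfn_le_line_integral[OF \<psi>, of "x *\<^sub>R axis i 1" y j] unfolding B_def T_def by simp
  have "(\<integral>\<^sup>+p. ennreal \<bar>\<phi> p * \<psi> p\<bar> \<partial>lborel) = (\<integral>\<^sup>+x. \<integral>\<^sup>+y. ennreal \<bar>\<phi> (T x y) * \<psi> (T x y)\<bar> \<partial>lborel \<partial>lborel)"
    unfolding T_def by (rule nn_integral_coords2[OF ij]) measurable
  also have "\<dots> \<le> (\<integral>\<^sup>+x. \<integral>\<^sup>+y. A y * B x \<partial>lborel \<partial>lborel)"
    by (intro nn_integral_mono) (simp add: abs_mult ennreal_mult mult_mono A B)
  also have "\<dots> = (\<integral>\<^sup>+y. A y \<partial>lborel) * (\<integral>\<^sup>+x. B x \<partial>lborel)"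
    by (simp add: nn_integral_multc nn_integral_cmult)
  also have "(\<integral>\<^sup>+x. B x \<partial>lborel) = (\<integral>\<^sup>+p. ennreal \<bar>pderiv \<psi> j p\<bar> \<partial>lborel)"
    unfolding B_def T_def by (rule nn_integral_coords2[OF ij, symmetric]) measurable
  also have "(\<integral>\<^sup>+y. A y \<partial>lborel) = (\<integral>\<^sup>+p. ennreal \<bar>pderiv \<phi> i p\<bar> \<partial>lborel)"
    unfolding A_def T_def using ij
    by (subst nn_integral_coords2[of j i]) (auto simp: add.commute)
  finally show ?thesis .
qed

text \<open>Each of the three axes bounds \<phi> by the square root of a line integral of \<theta>
  that is constant along that axis. Multiplying the three bounds gives the integrand of
  Loomis-Whitney. The root \<phi> is a parameter because the later instance has \<theta> as a fourth
  power and \<phi> as a square, so no root of a test function is ever differentiated.\<close>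

lemma nn_Gagliardo:
  fixes i j k :: "'d::finite" and \<theta> \<phi> :: "real^'d \<Rightarrow> real"
  assumes ij: "i \<noteq> j" "i \<noteq> k" "j \<noteq> k" "UNIV = {i, j, k}" and \<theta>: "testfn \<Omega> \<theta>"
    and sq: "\<And>x. \<theta> x = (\<phi> x)\<^sup>2" "\<And>x. \<phi> x \<ge> 0" "\<phi> \<in> borel_measurable borel"
  shows "(\<integral>\<^sup>+p. ennreal (\<phi> p ^ 3) \<partial>lborel)\<^sup>2
    \<le> (\<integral>\<^sup>+p. ennreal \<bar>pderiv \<theta> i p\<bar> \<partial>lborel) * (\<integral>\<^sup>+p. ennreal \<bar>pderiv \<theta> j p\<bar> \<partial>lborel)
      * (\<integral>\<^sup>+p. ennreal \<bar>pderiv \<theta> k p\<bar> \<partial>lborel)"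
proof -
  note [measurable] = testfn_borel[OF \<theta>] sq(3)
  define T where "T x y z = x *\<^sub>R axis i 1 + y *\<^sub>R axis j 1 + z *\<^sub>R (axis k 1 :: real^'d)" for x y z
  define F where "F p = (\<integral>\<^sup>+t. ennreal \<bar>pderiv \<theta> i (T t (fst p) (snd p))\<bar> \<partial>lborel)" for p
  define G where "G p = (\<integral>\<^sup>+t. ennreal \<bar>pderiv \<theta> j (T (fst p) t (snd p))\<bar> \<partial>lborel)" for p
  define H where "H p = (\<integral>\<^sup>+t. ennreal \<bar>pderiv \<theta> k (T (fst p) (snd p) t)\<bar> \<partial>lborel)" for p
  have [measurable]: "F \<in> borel_measurable (lborel \<Otimes>\<^sub>M lborel)" "G \<in> borel_measurable (lborel \<Otimes>\<^sub>M lborel)"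
     "H \<in> borel_measurable (lborel \<Otimes>\<^sub>M lborel)"
    unfolding F_def[abs_def] G_def[abs_def] H_def[abs_def] T_def by measurable
  have F: "ennreal (\<phi> (T x y z)) \<le> ennreal_sqrt (F (y, z))" for x y z
  proof (rule le_ennreal_sqrt[OF sq(2)])
    show "ennreal ((\<phi> (T x y z))\<^sup>2) \<le> F (y, z)"
      using testfn_le_line_integral[OF \<theta>, of "y *\<^sub>R axis j 1 + z *\<^sub>R axis k 1" x i]
      unfolding F_def T_def by (simp add: sq(1) add_ac)
  qed
  have G: "ennreal (\<phi> (T x y z)) \<le> ennreal_sqrt (G (x, z))" for x y z
  proof (rule le_ennreal_sqrt[OF sq(2)])
    show "ennreal ((\<phi> (T x y z))\<^sup>2) \<le> G (x, z)"
      using testfn_le_line_integral[OF \<theta>, of "x *\<^sub>R axis i 1 + z *\<^sub>R axis k 1" y j]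
      unfolding G_def T_def by (simp add: sq(1) add_ac)
  qed
  have H: "ennreal (\<phi> (T x y z)) \<le> ennreal_sqrt (H (x, y))" for x y z
  proof (rule le_ennreal_sqrt[OF sq(2)])
    show "ennreal ((\<phi> (T x y z))\<^sup>2) \<le> H (x, y)"
      using testfn_le_line_integral[OF \<theta>, of "x *\<^sub>R axis i 1 + y *\<^sub>R axis j 1" z k]
      unfolding H_def T_def by (simp add: sq(1) add_ac)
  qed
  have "(\<integral>\<^sup>+p. ennreal (\<phi> p ^ 3) \<partial>lborel) =
      (\<integral>\<^sup>+x. \<integral>\<^sup>+y. \<integral>\<^sup>+z. ennreal (\<phi> (T x y z) ^ 3) \<partial>lborel \<partial>lborel \<partial>lborel)"
    unfolding T_def by (rule nn_integral_coords3[OF ij]) measurable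
  also have "\<dots> \<le> (\<integral>\<^sup>+x. \<integral>\<^sup>+y. \<integral>\<^sup>+z. ennreal_sqrt (F (y, z)) * ennreal_sqrt (G (x, z)) * ennreal_sqrt (H (x, y))
      \<partial>lborel \<partial>lborel \<partial>lborel)"
    by (intro nn_integral_mono) (simp add: power3_eq_cube ennreal_mult sq(2) mult_mono F G H)
  finally have "(\<integral>\<^sup>+p. ennreal (\<phi> p ^ 3) \<partial>lborel)\<^sup>2 \<le> (\<integral>\<^sup>+x. \<integral>\<^sup>+y. \<integral>\<^sup>+z. ennreal_sqrt (F (y, z)) * ennreal_sqrt (G (x, z)) * ennreal_sqrt (H (x, y))
      \<partial>lborel \<partial>lborel \<partial>lborel)\<^sup>2"
    by (rule power_mono) simp
  also have "\<dots> \<le> (\<integral>\<^sup>+y. \<integral>\<^sup>+z. F (y, z) \<partial>lborel \<partial>lborel) * (\<integral>\<^sup>+x. \<integral>\<^sup>+z. G (x, z) \<partial>lborel \<partial>lborel)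
      * (\<integral>\<^sup>+x. \<integral>\<^sup>+y. H (x, y) \<partial>lborel \<partial>lborel)"
    using Loomis_Whitney_3[of "\<lambda>p. ennreal_sqrt (F p)" "\<lambda>p. ennreal_sqrt (G p)" "\<lambda>p. ennreal_sqrt (H p)"] by simp
  also have "(\<integral>\<^sup>+y. \<integral>\<^sup>+z. F (y, z) \<partial>lborel \<partial>lborel) = (\<integral>\<^sup>+p. ennreal \<bar>pderiv \<theta> i p\<bar> \<partial>lborel)"
    unfolding F_def T_def using ij
    by (subst nn_integral_coords3[of j k i]) (auto simp: add_ac)
  also have "(\<integral>\<^sup>+x. \<integral>\<^sup>+z. G (x, z) \<partial>lborel \<partial>lborel) = (\<integral>\<^sup>+p. ennreal \<bar>pderiv \<theta> j p\<bar> \<partial>lborel)"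
    unfolding G_def T_def using ij
    by (subst nn_integral_coords3[of i k j]) (auto simp: add_ac)
  also have "(\<integral>\<^sup>+x. \<integral>\<^sup>+y. H (x, y) \<partial>lborel \<partial>lborel) = (\<integral>\<^sup>+p. ennreal \<bar>pderiv \<theta> k p\<bar> \<partial>lborel)"
    unfolding H_def T_def using ij
    by (subst nn_integral_coords3[of i j k]) auto
  finally show ?thesis .
qed

section \<open>Inequalities in L^2 norms for test functions\<close>

lemma real_Cauchy_Schwarz:
  fixes f g :: "'a \<Rightarrow> real"
  assumes [measurable]: "f \<in> borel_measurable M" "g \<in> borel_measurable M"
    and f: "integrable M (\<lambda>x. (f x)\<^sup>2)" and g: "integrable M (\<lambda>x. (g x)\<^sup>2)"
  shows "integrable M (\<lambda>x. f x * g x)"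
    "(\<integral>x. \<bar>f x * g x\<bar> \<partial>M)\<^sup>2 \<le> (\<integral>x. (f x)\<^sup>2 \<partial>M) * (\<integral>x. (g x)\<^sup>2 \<partial>M)"
    "(\<integral>x. \<bar>f x * g x\<bar> \<partial>M) \<le> sqrt (\<integral>x. (f x)\<^sup>2 \<partial>M) * sqrt (\<integral>x. (g x)\<^sup>2 \<partial>M)"
proof -
  show int: "integrable M (\<lambda>x. f x * g x)"
  proof (rule Bochner_Integration.integrable_bound[of _ "\<lambda>x. (f x)\<^sup>2 + (g x)\<^sup>2"])
    have "\<bar>a * b\<bar> \<le> a\<^sup>2 + b\<^sup>2" for a b :: real
    proof -
      have "0 \<le> (\<bar>a\<bar> - \<bar>b\<bar>)\<^sup>2 + a\<^sup>2 + b\<^sup>2" by simp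
      then show ?thesis by (simp add: power2_eq_square abs_mult algebra_simps)
    qed
    then show "AE x in M. norm (f x * g x) \<le> norm ((f x)\<^sup>2 + (g x)\<^sup>2)" by simp
  qed (use f g in auto)
  have "(\<integral>\<^sup>+x. ennreal \<bar>f x\<bar> * ennreal \<bar>g x\<bar> \<partial>M)\<^sup>2
      \<le> (\<integral>\<^sup>+x. (ennreal \<bar>f x\<bar>)\<^sup>2 \<partial>M) * (\<integral>\<^sup>+x. (ennreal \<bar>g x\<bar>)\<^sup>2 \<partial>M)"
    by (rule Cauchy_Schwarz_nn_integral) auto
  moreover have "(\<integral>\<^sup>+x. ennreal \<bar>f x\<bar> * ennreal \<bar>g x\<bar> \<partial>M) = ennreal (\<integral>x. \<bar>f x * g x\<bar> \<partial>M)"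
    using nn_integral_eq_integral[OF integrable_abs[OF int]] by (simp add: abs_mult ennreal_mult)
  moreover have "(\<integral>\<^sup>+x. (ennreal \<bar>f x\<bar>)\<^sup>2 \<partial>M) = ennreal (\<integral>x. (f x)\<^sup>2 \<partial>M)"
    using nn_integral_eq_integral[OF f] by (simp add: ennreal_power)
  moreover have "(\<integral>\<^sup>+x. (ennreal \<bar>g x\<bar>)\<^sup>2 \<partial>M) = ennreal (\<integral>x. (g x)\<^sup>2 \<partial>M)"
    using nn_integral_eq_integral[OF g] by (simp add: ennreal_power)
  ultimately show *: "(\<integral>x. \<bar>f x * g x\<bar> \<partial>M)\<^sup>2 \<le> (\<integral>x. (f x)\<^sup>2 \<partial>M) * (\<integral>x. (g x)\<^sup>2 \<partial>M)"
    by (simp add: ennreal_power flip: ennreal_mult)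
  then show "(\<integral>x. \<bar>f x * g x\<bar> \<partial>M) \<le> sqrt (\<integral>x. (f x)\<^sup>2 \<partial>M) * sqrt (\<integral>x. (g x)\<^sup>2 \<partial>M)"
    by (simp add: real_le_rsqrt flip: real_sqrt_mult)
qed

definition pgrad :: "(real^'d \<Rightarrow> real) \<Rightarrow> real^'d \<Rightarrow> real^'d" where
  "pgrad \<phi> x = (\<chi> j. pderiv \<phi> j x)"

lemma norm_pgrad_power2: "(norm (pgrad \<phi> x))\<^sup>2 = (\<Sum>j\<in>UNIV. (pderiv \<phi> j x)\<^sup>2)"
  unfolding pgrad_def norm_vec_def L2_set_def by (simp add: sum_nonneg)

lemma testfn_integrable_mult:
  assumes "testfn \<Omega> \<phi>" "continuous_on UNIV g"
  shows "integrable lborel (\<lambda>x. \<phi> x * g x)" "integrable lborel (\<lambda>x. pderiv \<phi> j x * g x)"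
proof -
  have t: "testfn (tsupport \<phi>) \<phi>" using assms unfolding testfn_def by blast
  have b: "bounded (tsupport \<phi>)" using tsupport_props(1)[OF assms(1)] compact_imp_bounded by blast
  show "integrable lborel (\<lambda>x. \<phi> x * g x)"
    using testfn_outside(1)[OF t] testfn_continuous(1)[OF assms(1)] assms(2)
    by (intro integrable_compact_support[OF _ b] continuous_intros) auto
  show "integrable lborel (\<lambda>x. pderiv \<phi> j x * g x)"
    using testfn_outside(2)[OF t] testfn_continuous(2)[OF assms(1)] assms(2)
    by (intro integrable_compact_support[OF _ b] continuous_intros) auto
qed

lemma testfn_integrable_squares:
  assumes "testfn \<Omega> \<phi>"
  shows "integrable lborel (\<lambda>x. (\<phi> x)\<^sup>2)" "integrable lborel (\<lambda>x. (pderiv \<phi> j x)\<^sup>2)"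
    "integrable lborel (\<lambda>x. (norm (pgrad \<phi> x))\<^sup>2)"
  unfolding norm_pgrad_power2
  using testfn_integrable_mult[OF assms testfn_continuous(1)[OF assms]]
    testfn_integrable_mult(2)[OF assms testfn_continuous(2)[OF assms]]
  by (auto simp: power2_eq_square)

lemma integral_pderiv_le:
  assumes "testfn \<Omega> \<phi>"
  shows "(\<integral>x. (pderiv \<phi> j x)\<^sup>2 \<partial>lborel) \<le> (\<integral>x. (norm (pgrad \<phi> x))\<^sup>2 \<partial>lborel)"
  by (intro integral_mono testfn_integrable_squares[OF assms])
     (auto simp: norm_pgrad_power2 intro: member_le_sum)

text \<open>Integrate \<open>\<partial>\<^sub>j (\<phi>\<^sup>2 x\<^sub>j)\<close>.\<close>

lemma testfn_Poincare:
  assumes \<phi>: "testfn \<Omega> \<phi>" and R: "\<Omega> \<subseteq> cball 0 R" "R \<ge> 0"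
  shows "(\<integral>x. (\<phi> x)\<^sup>2 \<partial>lborel) \<le> 4 * R\<^sup>2 * (\<integral>x. (norm (pgrad \<phi> x))\<^sup>2 \<partial>lborel)"
proof -
  fix j :: 'a
  note [measurable] = testfn_borel[OF \<phi>]
  define I where "I = (\<integral>x. (\<phi> x)\<^sup>2 \<partial>lborel)"
  define D where "D = (\<integral>x. (norm (pgrad \<phi> x))\<^sup>2 \<partial>lborel)"
  have nn: "I \<ge> 0" "D \<ge> 0" by (simp_all add: I_def D_def)
  have c: "continuous_on UNIV (\<lambda>x::real^'a. x $ j)"
    by (intro continuous_intros)
  have c': "continuous_on UNIV (\<lambda>x. pderiv \<phi> j x * x $ j)"
    using testfn_continuous(2)[OF \<phi>] c by (intro continuous_intros)
  have int: "integrable lborel (\<lambda>x. (\<phi> x)\<^sup>2)" "integrable lborel (\<lambda>x. \<phi> x * (pderiv \<phi> j x * x $ j))"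
    "integrable lborel (\<lambda>x. \<phi> x * pderiv \<phi> j x)"
    using testfn_integrable_squares[OF \<phi>] testfn_integrable_mult(1)[OF \<phi> c']
      testfn_integrable_mult(1)[OF \<phi> testfn_continuous(2)[OF \<phi>]] by auto
  note sq = testfn_mult_testfn[OF \<phi> \<phi>]
  have d: "((\<lambda>x. x $ j) has_derivative (\<lambda>h. h $ j)) (at x)" for x :: "real^'a"
    by (rule bounded_linear.has_derivative[OF bounded_linear_vec_nth has_derivative_ident])
  note t = testfn_mult[OF sq(1) d]
  have "(\<integral>x. pderiv (\<lambda>x. \<phi> x * \<phi> x * x $ j) j x \<partial>lborel) = 0"
    by (rule integral_pderiv_eq_0[OF t(1)]) simp
  also have "(\<lambda>x. pderiv (\<lambda>x. \<phi> x * \<phi> x * x $ j) j x) = (\<lambda>x. (\<phi> x)\<^sup>2 + 2 * (\<phi> x * (pderiv \<phi> j x * x $ j)))"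
    by (subst t(2)) (auto simp: sq(2) axis_def power2_eq_square algebra_simps)
  finally have "I = - 2 * (\<integral>x. \<phi> x * (pderiv \<phi> j x * x $ j) \<partial>lborel)"
    using int by (simp add: I_def)
  also have "\<dots> \<le> 2 * \<bar>\<integral>x. \<phi> x * (pderiv \<phi> j x * x $ j) \<partial>lborel\<bar>" by linarith
  also have "\<bar>\<integral>x. \<phi> x * (pderiv \<phi> j x * x $ j) \<partial>lborel\<bar> \<le> (\<integral>x. \<bar>\<phi> x * (pderiv \<phi> j x * x $ j)\<bar> \<partial>lborel)"
    by (rule integral_abs_bound)
  also have "\<dots> \<le> (\<integral>x. R * \<bar>\<phi> x * pderiv \<phi> j x\<bar> \<partial>lborel)"
  proof (rule integral_mono)
    fix x
    show "\<bar>\<phi> x * (pderiv \<phi> j x * x $ j)\<bar> \<le> R * \<bar>\<phi> x * pderiv \<phi> j x\<bar>"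
    proof (cases "x \<in> \<Omega>")
      case True
      then have "\<bar>x $ j\<bar> \<le> R" using R component_le_norm_cart[of x j] by (force simp: dist_norm)
      then have "\<bar>\<phi> x * pderiv \<phi> j x\<bar> * \<bar>x $ j\<bar> \<le> \<bar>\<phi> x * pderiv \<phi> j x\<bar> * R"
        by (rule mult_left_mono) simp
      then show ?thesis by (simp add: abs_mult mult_ac)
    qed (simp add: testfn_outside[OF \<phi>])
  qed (use int in auto)
  also have "\<dots> = R * (\<integral>x. \<bar>\<phi> x * pderiv \<phi> j x\<bar> \<partial>lborel)" by simp
  also have "\<dots> \<le> R * (sqrt I * sqrt (\<integral>x. (pderiv \<phi> j x)\<^sup>2 \<partial>lborel))"
    unfolding I_def using R(2) testfn_integrable_squares[OF \<phi>]
    by (intro mult_left_mono real_Cauchy_Schwarz(3)) auto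
  also have "\<dots> \<le> R * (sqrt I * sqrt D)"
    unfolding D_def using R(2) nn integral_pderiv_le[OF \<phi>] by (intro mult_left_mono) auto
  \<comment> \<open>Both sides carry the factor \<open>sqrt I\<close>. Cancelling it, with I = 0 as
    a trivial case, and squaring produces the constant (2 R)^2.\<close>
  finally have "sqrt I * sqrt I \<le> sqrt I * (2 * R * sqrt D)"
    using nn by (simp add: mult_ac)
  then have "sqrt I \<le> 2 * R * sqrt D"
    using nn R(2) by (cases "I = 0") (auto simp del: real_sqrt_mult_self dest: mult_left_le_imp_le)
  then have "(sqrt I)\<^sup>2 \<le> (2 * R * sqrt D)\<^sup>2" using nn by (intro power_mono) auto
  then have "I \<le> 4 * R\<^sup>2 * D" using nn by (simp add: power_mult_distrib)
  then show ?thesis by (simp add: I_def D_def)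
qed

text \<open>The separated estimate is applied to the squares of \<phi> and \<psi>. Since the
  derivative of \<phi>^2 is 2 \<phi> times that of \<phi>, Cauchy-Schwarz bounds each factor with a
  constant 2, hence the 4.\<close>

lemma testfn_Ladyzhenskaya:
  fixes i j :: "'d::finite" and \<phi> \<psi> :: "real^'d \<Rightarrow> real"
  assumes ij: "i \<noteq> j" "UNIV = {i, j}" and \<phi>: "testfn \<Omega> \<phi>" and \<psi>: "testfn \<Omega> \<psi>"
  shows "(\<integral>x. (\<phi> x)\<^sup>2 * (\<psi> x)\<^sup>2 \<partial>lborel) \<le> 4 * (sqrt (\<integral>x. (\<phi> x)\<^sup>2 \<partial>lborel) * sqrt (\<integral>x. (norm (pgrad \<phi> x))\<^sup>2 \<partial>lborel))
      * (sqrt (\<integral>x. (\<psi> x)\<^sup>2 \<partial>lborel) * sqrt (\<integral>x. (norm (pgrad \<psi> x))\<^sup>2 \<partial>lborel))"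
proof -
  note sq\<phi> = testfn_mult_testfn[OF \<phi> \<phi>] and sq\<psi> = testfn_mult_testfn[OF \<psi> \<psi>]
  have *: "0 \<le> (\<integral>x. \<bar>pderiv (\<lambda>x. \<phi> x * \<phi> x) k x\<bar> \<partial>lborel) \<and>
     (\<integral>\<^sup>+x. ennreal \<bar>pderiv (\<lambda>x. \<phi> x * \<phi> x) k x\<bar> \<partial>lborel) = ennreal (\<integral>x. \<bar>pderiv (\<lambda>x. \<phi> x * \<phi> x) k x\<bar> \<partial>lborel) \<and>
     (\<integral>x. \<bar>pderiv (\<lambda>x. \<phi> x * \<phi> x) k x\<bar> \<partial>lborel) \<le>
      2 * (sqrt (\<integral>x. (\<phi> x)\<^sup>2 \<partial>lborel) * sqrt (\<integral>x. (norm (pgrad \<phi> x))\<^sup>2 \<partial>lborel))"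
    if \<phi>: "testfn \<Omega> \<phi>" for \<phi> :: "real^'d \<Rightarrow> real" and k
  proof (intro conjI)
    note [measurable] = testfn_borel[OF \<phi>]
    note sq = testfn_mult_testfn[OF \<phi> \<phi>]
    show "(\<integral>\<^sup>+x. ennreal \<bar>pderiv (\<lambda>x. \<phi> x * \<phi> x) k x\<bar> \<partial>lborel) = ennreal (\<integral>x. \<bar>pderiv (\<lambda>x. \<phi> x * \<phi> x) k x\<bar> \<partial>lborel)"
      by (rule nn_integral_eq_integral[OF integrable_abs[OF testfn_integrable(2)[OF sq(1)]]]) simp
    have "(\<lambda>x. pderiv (\<lambda>x. \<phi> x * \<phi> x) k x) = (\<lambda>x. 2 * (\<phi> x * pderiv \<phi> k x))"
      by (auto simp: sq(2))
    then have "(\<integral>x. \<bar>pderiv (\<lambda>x. \<phi> x * \<phi> x) k x\<bar> \<partial>lborel) = 2 * (\<integral>x. \<bar>\<phi> x * pderiv \<phi> k x\<bar> \<partial>lborel)"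
      by (simp add: abs_mult)
    also have "\<dots> \<le> 2 * (sqrt (\<integral>x. (\<phi> x)\<^sup>2 \<partial>lborel) * sqrt (\<integral>x. (pderiv \<phi> k x)\<^sup>2 \<partial>lborel))"
      using testfn_integrable_squares[OF \<phi>] by (intro mult_left_mono real_Cauchy_Schwarz(3)) auto
    also have "\<dots> \<le> 2 * (sqrt (\<integral>x. (\<phi> x)\<^sup>2 \<partial>lborel) * sqrt (\<integral>x. (norm (pgrad \<phi> x))\<^sup>2 \<partial>lborel))"
      using integral_pderiv_le[OF \<phi>] by (intro mult_left_mono) auto
    finally show "(\<integral>x. \<bar>pderiv (\<lambda>x. \<phi> x * \<phi> x) k x\<bar> \<partial>lborel) \<le>
      2 * (sqrt (\<integral>x. (\<phi> x)\<^sup>2 \<partial>lborel) * sqrt (\<integral>x. (norm (pgrad \<phi> x))\<^sup>2 \<partial>lborel))" .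
  qed simp
  note F = *[OF \<phi>, of i] and P = *[OF \<psi>, of j]
  have int: "integrable lborel (\<lambda>x. (\<phi> x * \<phi> x) * (\<psi> x * \<psi> x))"
    by (rule testfn_integrable_mult(1)[OF sq\<phi>(1) testfn_continuous(1)[OF sq\<psi>(1)]])
  have "ennreal (\<integral>x. \<bar>(\<phi> x * \<phi> x) * (\<psi> x * \<psi> x)\<bar> \<partial>lborel) = (\<integral>\<^sup>+x. ennreal \<bar>(\<phi> x * \<phi> x) * (\<psi> x * \<psi> x)\<bar> \<partial>lborel)"
    by (rule nn_integral_eq_integral[symmetric, OF integrable_abs[OF int]]) simp
  also have "\<dots> \<le> ennreal (\<integral>x. \<bar>pderiv (\<lambda>x. \<phi> x * \<phi> x) i x\<bar> \<partial>lborel) * ennreal (\<integral>x. \<bar>pderiv (\<lambda>x. \<psi> x * \<psi> x) j x\<bar> \<partial>lborel)"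
    using nn_Ladyzhenskaya[OF ij sq\<phi>(1) sq\<psi>(1)] F P by simp
  finally have "(\<integral>x. \<bar>(\<phi> x * \<phi> x) * (\<psi> x * \<psi> x)\<bar> \<partial>lborel)
      \<le> (\<integral>x. \<bar>pderiv (\<lambda>x. \<phi> x * \<phi> x) i x\<bar> \<partial>lborel) * (\<integral>x. \<bar>pderiv (\<lambda>x. \<psi> x * \<psi> x) j x\<bar> \<partial>lborel)"
    using F P by (simp flip: ennreal_mult)
  also have "\<dots> \<le> (2 * (sqrt (\<integral>x. (\<phi> x)\<^sup>2 \<partial>lborel) * sqrt (\<integral>x. (norm (pgrad \<phi> x))\<^sup>2 \<partial>lborel)))
      * (2 * (sqrt (\<integral>x. (\<psi> x)\<^sup>2 \<partial>lborel) * sqrt (\<integral>x. (norm (pgrad \<psi> x))\<^sup>2 \<partial>lborel)))"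
    using F P by (intro mult_mono) auto
  finally show ?thesis by (simp add: abs_mult power2_eq_square mult_ac)
qed

text \<open>The Sobolev embedding of H^1_0 into L^6 in three dimensions. The fourth power is chosen
  so that Cauchy-Schwarz on its derivative, 4 \<phi>^3 times that of \<phi>, reproduces the integral
  I of \<phi>^6: with D the squared gradient norm, \<open>J l\<close> squared is at most 16 I D.
  Then I^4 is at most 16^3 I^3 D^3, and dividing by I^3 leaves the constant 4096.\<close>

lemma testfn_Gagliardo:
  fixes i j k :: "'d::finite" and \<phi> :: "real^'d \<Rightarrow> real"
  assumes ij: "i \<noteq> j" "i \<noteq> k" "j \<noteq> k" "UNIV = {i, j, k}" and \<phi>: "testfn \<Omega> \<phi>"
  shows "(\<integral>x. \<phi> x ^ 6 \<partial>lborel) \<le> 4096 * (\<integral>x. (norm (pgrad \<phi> x))\<^sup>2 \<partial>lborel) ^ 3"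
proof -
  note [measurable] = testfn_borel[OF \<phi>]
  have d4: "((\<lambda>t. t ^ 4) has_real_derivative 4 * t ^ 3) (at t)" for t :: real
    by (auto intro!: derivative_eq_intros)
  have c: "continuous_on UNIV (\<lambda>t::real. 4 * t ^ 3)" by (intro continuous_intros)
  have t4: "testfn \<Omega> (\<lambda>x. \<phi> x ^ 4)" "pderiv (\<lambda>x. \<phi> x ^ 4) l x = 4 * \<phi> x ^ 3 * pderiv \<phi> l x" for l x
    using testfn_compose[OF \<phi> d4 c] by auto
  define I where "I = (\<integral>x. \<phi> x ^ 6 \<partial>lborel)"
  define D where "D = (\<integral>x. (norm (pgrad \<phi> x))\<^sup>2 \<partial>lborel)"
  define J where "J l = (\<integral>x. \<bar>pderiv (\<lambda>x. \<phi> x ^ 4) l x\<bar> \<partial>lborel)" for l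
  have cont: "continuous_on UNIV \<phi>" by (rule testfn_continuous(1)[OF \<phi>])
  have "integrable lborel (\<lambda>x. \<phi> x * \<phi> x ^ 5)"
    by (rule testfn_integrable_mult[OF \<phi>]) (intro continuous_intros cont)
  then have I6: "integrable lborel (\<lambda>x. \<phi> x ^ 6)"
    by (simp flip: power_Suc)
  have nn: "I \<ge> 0" "D \<ge> 0" "J l \<ge> 0" for l
    by (simp_all add: I_def D_def J_def)
  have J: "(\<integral>\<^sup>+x. ennreal \<bar>pderiv (\<lambda>x. \<phi> x ^ 4) l x\<bar> \<partial>lborel) = ennreal (J l)" for l
    unfolding J_def by (rule nn_integral_eq_integral[OF integrable_abs[OF testfn_integrable(2)[OF t4(1)]]]) simp
  have "(\<integral>\<^sup>+x. ennreal (((\<phi> x)\<^sup>2) ^ 3) \<partial>lborel)\<^sup>2 \<le> ennreal (J i) * ennreal (J j) * ennreal (J k)"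
    using nn_Gagliardo[OF ij t4(1), of "\<lambda>x. (\<phi> x)\<^sup>2"] by (simp add: J)
  also have "(\<integral>\<^sup>+x. ennreal (((\<phi> x)\<^sup>2) ^ 3) \<partial>lborel) = ennreal I"
    unfolding I_def using nn_integral_eq_integral[OF I6] by simp
  finally have "I\<^sup>2 \<le> J i * J j * J k"
    using nn by (simp add: ennreal_power flip: ennreal_mult)
  then have "(I\<^sup>2)\<^sup>2 \<le> (J i * J j * J k)\<^sup>2" by (rule power_mono) simp
  also have "\<dots> = (J i)\<^sup>2 * (J j)\<^sup>2 * (J k)\<^sup>2" by (simp add: power_mult_distrib)
  also have "\<dots> \<le> (16 * I * D) * (16 * I * D) * (16 * I * D)"
  proof -
    have "(J l)\<^sup>2 \<le> 16 * I * D" for l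
    proof -
      have "J l = 4 * (\<integral>x. \<bar>\<phi> x ^ 3 * pderiv \<phi> l x\<bar> \<partial>lborel)"
        unfolding J_def t4(2) by (simp add: abs_mult mult.assoc)
      then have "(J l)\<^sup>2 = 16 * (\<integral>x. \<bar>\<phi> x ^ 3 * pderiv \<phi> l x\<bar> \<partial>lborel)\<^sup>2"
        by (simp add: power_mult_distrib)
      also have "\<dots> \<le> 16 * ((\<integral>x. (\<phi> x ^ 3)\<^sup>2 \<partial>lborel) * (\<integral>x. (pderiv \<phi> l x)\<^sup>2 \<partial>lborel))"
        using testfn_integrable_squares[OF \<phi>] I6
        by (intro mult_left_mono real_Cauchy_Schwarz(2)) (auto simp flip: power_mult)
      also have "\<dots> \<le> 16 * (I * D)"
        using integral_pderiv_le[OF \<phi>, of l] nn unfolding I_def D_def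
        by (intro mult_left_mono mult_mono) (auto simp flip: power_mult)
      finally show ?thesis by simp
    qed
    then show ?thesis using nn by (intro mult_mono) auto
  qed
  finally have "I ^ 3 * I \<le> I ^ 3 * (4096 * D ^ 3)"
    by (simp add: power2_eq_square power3_eq_cube mult_ac)
  then have "I \<le> 4096 * D ^ 3"
    using nn by (cases "I = 0") auto
  then show ?thesis by (simp add: I_def D_def)
qed

text \<open>With \<open>P = \<integral> \<phi>\<^sup>4 \<psi>\<^sup>2\<close> and \<open>Q = \<integral> \<phi>\<^sup>2 \<psi>\<^sup>4\<close>, Cauchy-Schwarz gives
  \<open>P\<^sup>2 \<le> (\<integral> \<phi>\<^sup>6) Q\<close> and \<open>Q\<^sup>2 \<le> (\<integral> \<psi>\<^sup>6) P\<close>; eliminating \<open>Q\<close> replaces Hoelder's inequality.\<close>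

lemma testfn_product_bound_3:
  fixes i j k :: "'d::finite" and \<phi> \<psi> :: "real^'d \<Rightarrow> real"
  assumes ij: "i \<noteq> j" "i \<noteq> k" "j \<noteq> k" "UNIV = {i, j, k}" and \<phi>: "testfn \<Omega> \<phi>" and \<psi>: "testfn \<Omega> \<psi>"
  shows "(\<integral>x. (\<phi> x)\<^sup>2 * (\<psi> x)\<^sup>2 \<partial>lborel) \<le> 64 * (\<integral>x. (norm (pgrad \<phi> x))\<^sup>2 \<partial>lborel)
      * (sqrt (\<integral>x. (\<psi> x)\<^sup>2 \<partial>lborel) * sqrt (\<integral>x. (norm (pgrad \<psi> x))\<^sup>2 \<partial>lborel))"
proof -
  note [measurable] = testfn_borel[OF \<phi>] testfn_borel[OF \<psi>]
  note cont[continuous_intros] = testfn_continuous(1)[OF \<phi>] testfn_continuous(1)[OF \<psi>]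
  define D where "D = (\<integral>x. (norm (pgrad \<phi> x))\<^sup>2 \<partial>lborel)"
  define E where "E = (\<integral>x. (norm (pgrad \<psi> x))\<^sup>2 \<partial>lborel)"
  define P where "P = (\<integral>x. \<phi> x ^ 4 * (\<psi> x)\<^sup>2 \<partial>lborel)"
  define Q where "Q = (\<integral>x. (\<phi> x)\<^sup>2 * \<psi> x ^ 4 \<partial>lborel)"
  define S where "S = (\<integral>x. (\<phi> x)\<^sup>2 * (\<psi> x)\<^sup>2 \<partial>lborel)"
  define N where "N = (\<integral>x. (\<psi> x)\<^sup>2 \<partial>lborel)"
  have nn: "D \<ge> 0" "E \<ge> 0" "P \<ge> 0" "Q \<ge> 0" "S \<ge> 0" "N \<ge> 0"
    by (simp_all add: D_def E_def P_def Q_def S_def N_def)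
  have i6: "integrable lborel (\<lambda>x. (\<phi> x ^ 3)\<^sup>2)" if "testfn \<Omega> \<phi>" for \<phi> :: "real^'d \<Rightarrow> real"
  proof -
    have "integrable lborel (\<lambda>x. \<phi> x * \<phi> x ^ 5)"
      by (rule testfn_integrable_mult[OF that]) (intro continuous_intros testfn_continuous[OF that])
    then show ?thesis by (simp flip: power_Suc power_mult)
  qed
  have iP: "integrable lborel (\<lambda>x. (\<phi> x ^ 2 * \<psi> x)\<^sup>2)"
  proof -
    have "integrable lborel (\<lambda>x. \<psi> x * (\<phi> x ^ 4 * \<psi> x))"
      by (rule testfn_integrable_mult[OF \<psi>]) (intro continuous_intros)
    then show ?thesis by (simp add: power_mult_distrib power2_eq_square mult_ac flip: power_mult)
       (simp add: eval_nat_numeral mult_ac)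
  qed
  have iQ: "integrable lborel (\<lambda>x. (\<phi> x * \<psi> x ^ 2)\<^sup>2)"
  proof -
    have "integrable lborel (\<lambda>x. \<phi> x * (\<phi> x * \<psi> x ^ 4))"
      by (rule testfn_integrable_mult[OF \<phi>]) (intro continuous_intros)
    then show ?thesis by (simp add: power_mult_distrib power2_eq_square mult_ac flip: power_mult)
       (simp add: eval_nat_numeral mult_ac)
  qed
  have "P\<^sup>2 = (\<integral>x. \<bar>\<phi> x ^ 3 * (\<phi> x * \<psi> x ^ 2)\<bar> \<partial>lborel)\<^sup>2"
    unfolding P_def by (simp add: abs_mult eval_nat_numeral mult_ac)
  also have "\<dots> \<le> (\<integral>x. (\<phi> x ^ 3)\<^sup>2 \<partial>lborel) * (\<integral>x. (\<phi> x * \<psi> x ^ 2)\<^sup>2 \<partial>lborel)"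
    by (rule real_Cauchy_Schwarz(2)) (use i6[OF \<phi>] iQ in auto)
  also have "\<dots> = (\<integral>x. \<phi> x ^ 6 \<partial>lborel) * Q"
    unfolding Q_def by (simp add: power_mult_distrib flip: power_mult)
  also have "\<dots> \<le> 4096 * D ^ 3 * Q"
    using testfn_Gagliardo[OF ij \<phi>] nn unfolding D_def by (intro mult_right_mono) auto
  finally have PQ: "P\<^sup>2 \<le> 4096 * D ^ 3 * Q" .
  have "Q\<^sup>2 = (\<integral>x. \<bar>\<psi> x ^ 3 * (\<phi> x ^ 2 * \<psi> x)\<bar> \<partial>lborel)\<^sup>2"
    unfolding Q_def by (simp add: abs_mult eval_nat_numeral mult_ac)
  also have "\<dots> \<le> (\<integral>x. (\<psi> x ^ 3)\<^sup>2 \<partial>lborel) * (\<integral>x. (\<phi> x ^ 2 * \<psi> x)\<^sup>2 \<partial>lborel)"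
    by (rule real_Cauchy_Schwarz(2)) (use i6[OF \<psi>] iP in auto)
  also have "\<dots> = (\<integral>x. \<psi> x ^ 6 \<partial>lborel) * P"
    unfolding P_def by (simp add: power_mult_distrib flip: power_mult)
  also have "\<dots> \<le> 4096 * E ^ 3 * P"
    using testfn_Gagliardo[OF ij \<psi>] nn unfolding E_def by (intro mult_right_mono) auto
  finally have QP: "Q\<^sup>2 \<le> 4096 * E ^ 3 * P" .
  \<comment> \<open>Inserting the bound for Q^2 into the square of the bound for P^2 leaves one
    factor P on the right; after cancelling it both sides are perfect cubes.\<close>
  have "P * P ^ 3 = (P\<^sup>2)\<^sup>2" by (simp add: eval_nat_numeral)
  also have "\<dots> \<le> (4096 * D ^ 3 * Q)\<^sup>2" using PQ by (intro power_mono) auto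
  also have "\<dots> = (4096 * D ^ 3)\<^sup>2 * Q\<^sup>2" by (simp add: power_mult_distrib)
  also have "\<dots> \<le> (4096 * D ^ 3)\<^sup>2 * (4096 * E ^ 3 * P)" using QP by (intro mult_left_mono) auto
  also have "\<dots> = P * (4096 * D\<^sup>2 * E) ^ 3" by (simp add: power_mult_distrib mult_ac flip: power_mult)
  finally have "P ^ 3 \<le> (4096 * D\<^sup>2 * E) ^ 3"
    using nn by (cases "P = 0") auto
  then have P: "P \<le> 4096 * D\<^sup>2 * E"
    using nn power_mono_iff[of P "4096 * D\<^sup>2 * E" 3] by simp
  \<comment> \<open>A last Cauchy-Schwarz pairs \<psi> with \<phi>^2 \<psi> and brings in the L^2
    norm of \<psi>; the constant 64 is the root of 4096.\<close>
  have "S\<^sup>2 = (\<integral>x. \<bar>\<psi> x * (\<phi> x ^ 2 * \<psi> x)\<bar> \<partial>lborel)\<^sup>2"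
    unfolding S_def by (simp add: abs_mult eval_nat_numeral mult_ac)
  also have "\<dots> \<le> N * (\<integral>x. (\<phi> x ^ 2 * \<psi> x)\<^sup>2 \<partial>lborel)"
    unfolding N_def by (rule real_Cauchy_Schwarz(2)) (use testfn_integrable_squares[OF \<psi>] iP in auto)
  also have "\<dots> = N * P" unfolding P_def by (simp add: power_mult_distrib flip: power_mult)
  also have "\<dots> \<le> N * (4096 * D\<^sup>2 * E)" using P nn by (intro mult_left_mono)
  also have "\<dots> = (64 * D * (sqrt N * sqrt E))\<^sup>2" using nn by (simp add: power_mult_distrib)
  finally have "S \<le> 64 * D * (sqrt N * sqrt E)"
    by (rule power2_le_imp_le) (use nn in auto)
  then show ?thesis unfolding S_def D_def N_def E_def .
qed

lemma card3E:
  assumes "CARD('d::finite) = 3"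
  obtains i j k :: "'d::finite" where "i \<noteq> j" "i \<noteq> k" "j \<noteq> k" "UNIV = {i, j, k}"
  using assms that by (auto simp: card_3_iff)

lemma card2E:
  assumes "CARD('d::finite) = 2"
  obtains i j :: "'d::finite" where "i \<noteq> j" "UNIV = {i, j}"
  using assms that by (auto simp: card_2_iff)

text \<open>One form for both dimensions: the full gradient norm for \<phi>, the interpolated norm
  for \<psi>. In dimension 2 the Ladyzhenskaya bound is symmetric, and Poincare replaces |\<phi>| by
  2 R |\<nabla>\<phi>|, which turns the factor 4 into 8 R.\<close>

lemma testfn_product_bound:
  fixes \<Omega> :: "(real^'d) set"
  assumes dim: "CARD('d) = 2 \<or> CARD('d) = 3" and \<Omega>: "bounded \<Omega>"
  obtains C where "C > 0" "\<And>\<phi> \<psi>. testfn \<Omega> \<phi> \<Longrightarrow> testfn \<Omega> \<psi> \<Longrightarrow>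
    (\<integral>x. (\<phi> x)\<^sup>2 * (\<psi> x)\<^sup>2 \<partial>lborel) \<le> C * (\<integral>x. (norm (pgrad \<phi> x))\<^sup>2 \<partial>lborel)
      * (sqrt (\<integral>x. (\<psi> x)\<^sup>2 \<partial>lborel) * sqrt (\<integral>x. (norm (pgrad \<psi> x))\<^sup>2 \<partial>lborel))"
  using dim
proof
  assume "CARD('d) = 3"
  then obtain i j k :: 'd where "i \<noteq> j" "i \<noteq> k" "j \<noteq> k" "UNIV = {i, j, k}" by (rule card3E)
  from testfn_product_bound_3[OF this] show thesis by (intro that[of 64]) auto
next
  assume "CARD('d) = 2"
  then obtain i j :: 'd where ij: "i \<noteq> j" "UNIV = {i, j}" by (rule card2E)
  obtain R where R: "R > 0" "\<Omega> \<subseteq> cball 0 R"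
    using bounded_subset_ballD[OF \<Omega>, of 0] ball_subset_cball by (meson order_trans)
  show thesis
  proof (rule that[of "8 * R"])
    fix \<phi> \<psi> :: "real^'d \<Rightarrow> real"
    assume \<phi>: "testfn \<Omega> \<phi>" and \<psi>: "testfn \<Omega> \<psi>"
    define D where "D = (\<integral>x. (norm (pgrad \<phi> x))\<^sup>2 \<partial>lborel)"
    have D: "D \<ge> 0" by (simp add: D_def)
    have "sqrt (\<integral>x. (\<phi> x)\<^sup>2 \<partial>lborel) \<le> sqrt (4 * R\<^sup>2 * D)"
      using testfn_Poincare[OF \<phi> R(2)] R(1) unfolding D_def by simp
    also have "\<dots> = 2 * R * sqrt D" using R(1) by (simp add: real_sqrt_mult)
    finally have "sqrt (\<integral>x. (\<phi> x)\<^sup>2 \<partial>lborel) * sqrt D \<le> 2 * R * sqrt D * sqrt D"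
      using D by (intro mult_right_mono) auto
    then have "4 * (sqrt (\<integral>x. (\<phi> x)\<^sup>2 \<partial>lborel) * sqrt D) \<le> 8 * R * D"
      using real_sqrt_mult_self[of D] D by (simp add: mult.assoc) (simp add: mult_ac)
    then show "(\<integral>x. (\<phi> x)\<^sup>2 * (\<psi> x)\<^sup>2 \<partial>lborel) \<le> 8 * R * (\<integral>x. (norm (pgrad \<phi> x))\<^sup>2 \<partial>lborel)
      * (sqrt (\<integral>x. (\<psi> x)\<^sup>2 \<partial>lborel) * sqrt (\<integral>x. (norm (pgrad \<psi> x))\<^sup>2 \<partial>lborel))"
      using testfn_Ladyzhenskaya[OF ij \<phi> \<psi>] unfolding D_def
      by (elim order_trans) (intro mult_right_mono, auto)
  qed (use R in auto)
qed

section \<open>Square-integrable fields and their limits of test functions\<close>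

text \<open>The definition extends by zero off \<Omega>; the restricted measure
  \<open>lebesgue_on \<Omega>\<close> allows computation without indicator factors.\<close>

lemma L2_iff:
  assumes "\<Omega> \<in> sets lebesgue"
  shows "L2 \<Omega> u \<longleftrightarrow> u \<in> borel_measurable (lebesgue_on \<Omega>) \<and> integrable (lebesgue_on \<Omega>) (\<lambda>x. (norm (u x))\<^sup>2)"
  unfolding L2_def set_borel_measurable_def set_integrable_def using assms
  by (simp add: borel_measurable_restrict_space_iff integrable_restrict_space)

lemma l2inner_eq:
  assumes "\<Omega> \<in> sets lebesgue"
  shows "l2inner \<Omega> u v = (\<integral>x. u x \<bullet> v x \<partial>lebesgue_on \<Omega>)"
  unfolding l2inner_def set_lebesgue_integral_def using assms
  by (simp add: integral_restrict_space)

lemma l2norm_power2: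
  assumes "\<Omega> \<in> sets lebesgue"
  shows "(l2norm \<Omega> u)\<^sup>2 = (\<integral>x. (norm (u x))\<^sup>2 \<partial>lebesgue_on \<Omega>)" "l2norm \<Omega> u \<ge> 0"
    "l2norm \<Omega> u = sqrt (\<integral>x. (norm (u x))\<^sup>2 \<partial>lebesgue_on \<Omega>)"
  unfolding l2norm_def l2inner_eq[OF assms] by (simp_all add: power2_norm_eq_inner)

context
  fixes \<Omega> :: "(real^'d) set"
  assumes meas: "\<Omega> \<in> sets lebesgue"
begin

lemma L2_le:
  assumes "L2 \<Omega> v" "u \<in> borel_measurable (lebesgue_on \<Omega>)" "\<And>x. norm (u x) \<le> norm (v x)"
  shows "L2 \<Omega> u" "l2norm \<Omega> u \<le> l2norm \<Omega> v"
proof -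
  have v: "integrable (lebesgue_on \<Omega>) (\<lambda>x. (norm (v x))\<^sup>2)" using assms(1) L2_iff[OF meas] by blast
  have [measurable]: "u \<in> borel_measurable (lebesgue_on \<Omega>)" by fact
  have u: "integrable (lebesgue_on \<Omega>) (\<lambda>x. (norm (u x))\<^sup>2)"
    by (rule Bochner_Integration.integrable_bound[OF v]) (auto simp: assms(3))
  then show "L2 \<Omega> u" using L2_iff[OF meas] assms(2) by blast
  show "l2norm \<Omega> u \<le> l2norm \<Omega> v"
    unfolding l2norm_power2(3)[OF meas] by (intro real_sqrt_le_mono integral_mono u v) (simp add: assms(3))
qed

lemma L2_lincomb:
  fixes u v :: "real^'d \<Rightarrow> 'b::euclidean_space"
  assumes "L2 \<Omega> u" "L2 \<Omega> v"
  shows "L2 \<Omega> (\<lambda>x. a *\<^sub>R u x + b *\<^sub>R v x)"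
proof -
  have [measurable]: "u \<in> borel_measurable (lebesgue_on \<Omega>)" "v \<in> borel_measurable (lebesgue_on \<Omega>)"
    and i: "integrable (lebesgue_on \<Omega>) (\<lambda>x. (norm (u x))\<^sup>2)" "integrable (lebesgue_on \<Omega>) (\<lambda>x. (norm (v x))\<^sup>2)"
    using assms L2_iff[OF meas] by blast+
  have "integrable (lebesgue_on \<Omega>) (\<lambda>x. (norm (a *\<^sub>R u x + b *\<^sub>R v x))\<^sup>2)"
  proof (rule Bochner_Integration.integrable_bound[of _ "\<lambda>x. 2 * a\<^sup>2 * (norm (u x))\<^sup>2 + 2 * b\<^sup>2 * (norm (v x))\<^sup>2"])
    have "(norm (a *\<^sub>R p + b *\<^sub>R q))\<^sup>2 \<le> 2 * a\<^sup>2 * (norm p)\<^sup>2 + 2 * b\<^sup>2 * (norm q)\<^sup>2" for p q :: 'b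
    proof -
      have "norm (a *\<^sub>R p + b *\<^sub>R q) \<le> \<bar>a\<bar> * norm p + \<bar>b\<bar> * norm q"
        by (metis norm_scaleR norm_triangle_ineq)
      then have "(norm (a *\<^sub>R p + b *\<^sub>R q))\<^sup>2 \<le> (\<bar>a\<bar> * norm p + \<bar>b\<bar> * norm q)\<^sup>2"
        by (rule power_mono) simp
      also have "\<dots> \<le> 2 * (\<bar>a\<bar> * norm p)\<^sup>2 + 2 * (\<bar>b\<bar> * norm q)\<^sup>2"
        using zero_le_power2[of "\<bar>a\<bar> * norm p - \<bar>b\<bar> * norm q"]
        unfolding power2_diff power2_sum by linarith
      finally show ?thesis by (simp add: power_mult_distrib)
    qed
    then show "AE x in lebesgue_on \<Omega>. norm ((norm (a *\<^sub>R u x + b *\<^sub>R v x))\<^sup>2)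
        \<le> norm (2 * a\<^sup>2 * (norm (u x))\<^sup>2 + 2 * b\<^sup>2 * (norm (v x))\<^sup>2)" by simp
  qed (use i in auto)
  then show ?thesis unfolding L2_iff[OF meas] by auto
qed

lemma L2_diff: "L2 \<Omega> u \<Longrightarrow> L2 \<Omega> v \<Longrightarrow> L2 \<Omega> (\<lambda>x. u x - v x)"
  using L2_lincomb[of u v 1 "-1"] by simp

lemma L2_nth:
  fixes u :: "real^'d \<Rightarrow> 'b::euclidean_space^'n"
  assumes "L2 \<Omega> u"
  shows "L2 \<Omega> (\<lambda>x. u x $ i)" "l2norm \<Omega> (\<lambda>x. u x $ i) \<le> l2norm \<Omega> u"
proof -
  have [measurable]: "u \<in> borel_measurable (lebesgue_on \<Omega>)" using assms L2_iff[OF meas] by blast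
  have "(\<lambda>y. y $ i) \<in> borel_measurable (borel :: ('b^'n) measure)"
    by (intro borel_measurable_continuous_onI continuous_intros)
  then have m: "(\<lambda>x. u x $ i) \<in> borel_measurable (lebesgue_on \<Omega>)" by measurable
  show "L2 \<Omega> (\<lambda>x. u x $ i)" "l2norm \<Omega> (\<lambda>x. u x $ i) \<le> l2norm \<Omega> u"
    using L2_le[OF assms m] by (simp_all add: Finite_Cartesian_Product.norm_nth_le)
qed

lemma L2_inner:
  assumes "L2 \<Omega> u" "L2 \<Omega> v"
  shows "integrable (lebesgue_on \<Omega>) (\<lambda>x. norm (u x) * norm (v x))"
    "(\<integral>x. norm (u x) * norm (v x) \<partial>lebesgue_on \<Omega>) \<le> l2norm \<Omega> u * l2norm \<Omega> v"
    "integrable (lebesgue_on \<Omega>) (\<lambda>x. u x \<bullet> v x)"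
    "\<bar>l2inner \<Omega> u v\<bar> \<le> l2norm \<Omega> u * l2norm \<Omega> v"
proof -
  have [measurable]: "u \<in> borel_measurable (lebesgue_on \<Omega>)" "v \<in> borel_measurable (lebesgue_on \<Omega>)"
    and i: "integrable (lebesgue_on \<Omega>) (\<lambda>x. (norm (u x))\<^sup>2)" "integrable (lebesgue_on \<Omega>) (\<lambda>x. (norm (v x))\<^sup>2)"
    using assms L2_iff[OF meas] by blast+
  note cs = real_Cauchy_Schwarz[of "\<lambda>x. norm (u x)" "lebesgue_on \<Omega>" "\<lambda>x. norm (v x)"]
  show a: "integrable (lebesgue_on \<Omega>) (\<lambda>x. norm (u x) * norm (v x))"
    by (rule cs(1)) (use i in auto)
  show b: "(\<integral>x. norm (u x) * norm (v x) \<partial>lebesgue_on \<Omega>) \<le> l2norm \<Omega> u * l2norm \<Omega> v"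
    using cs(3) i unfolding l2norm_power2(3)[OF meas] by simp
  show c: "integrable (lebesgue_on \<Omega>) (\<lambda>x. u x \<bullet> v x)"
    by (rule Bochner_Integration.integrable_bound[OF a]) (auto simp: Cauchy_Schwarz_ineq2)
  have "\<bar>l2inner \<Omega> u v\<bar> \<le> (\<integral>x. \<bar>u x \<bullet> v x\<bar> \<partial>lebesgue_on \<Omega>)"
    unfolding l2inner_eq[OF meas] by (rule integral_abs_bound)
  also have "\<dots> \<le> (\<integral>x. norm (u x) * norm (v x) \<partial>lebesgue_on \<Omega>)"
    using a c by (intro integral_mono) (auto simp: Cauchy_Schwarz_ineq2)
  finally show "\<bar>l2inner \<Omega> u v\<bar> \<le> l2norm \<Omega> u * l2norm \<Omega> v" using b by linarith
qed

lemma l2inner_lincomb_left: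
  assumes "L2 \<Omega> u" "L2 \<Omega> v" "L2 \<Omega> w"
  shows "l2inner \<Omega> (\<lambda>x. a *\<^sub>R u x + b *\<^sub>R v x) w = a * l2inner \<Omega> u w + b * l2inner \<Omega> v w"
  unfolding l2inner_eq[OF meas] using L2_inner(3)[OF assms(1,3)] L2_inner(3)[OF assms(2,3)]
  by (simp add: inner_add_left)

lemma l2inner_diff_left:
  assumes "L2 \<Omega> u" "L2 \<Omega> v" "L2 \<Omega> w"
  shows "l2inner \<Omega> (\<lambda>x. u x - v x) w = l2inner \<Omega> u w - l2inner \<Omega> v w"
  using l2inner_lincomb_left[OF assms, of 1 "-1"] by simp

lemma l2inner_commute: "l2inner \<Omega> u v = l2inner \<Omega> v u"
  unfolding l2inner_def by (simp add: inner_commute)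

lemma l2inner_diff_right:
  assumes "L2 \<Omega> u" "L2 \<Omega> v" "L2 \<Omega> w"
  shows "l2inner \<Omega> w (\<lambda>x. u x - v x) = l2inner \<Omega> w u - l2inner \<Omega> w v"
  using l2inner_diff_left[OF assms] by (simp add: l2inner_commute)

lemma l2norm_triangle:
  assumes "L2 \<Omega> u" "L2 \<Omega> v"
  shows "l2norm \<Omega> (\<lambda>x. u x + v x) \<le> l2norm \<Omega> u + l2norm \<Omega> v"
proof (rule power2_le_imp_le)
  have "(l2norm \<Omega> (\<lambda>x. u x + v x))\<^sup>2 = (\<integral>x. u x \<bullet> u x + v x \<bullet> v x + 2 * (u x \<bullet> v x) \<partial>lebesgue_on \<Omega>)"
    unfolding l2norm_power2(1)[OF meas] power2_norm_eq_inner
    by (intro Bochner_Integration.integral_cong) (auto simp: inner_add_left inner_add_right inner_commute)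
  also have "\<dots> = (l2norm \<Omega> u)\<^sup>2 + (l2norm \<Omega> v)\<^sup>2 + 2 * l2inner \<Omega> u v"
    using L2_inner(3)[OF assms] L2_inner(3)[OF assms(1,1)] L2_inner(3)[OF assms(2,2)]
    unfolding l2norm_power2(1)[OF meas] l2inner_eq[OF meas] power2_norm_eq_inner by simp
  also have "\<dots> \<le> (l2norm \<Omega> u + l2norm \<Omega> v)\<^sup>2"
    using L2_inner(4)[OF assms] by (simp add: power2_sum)
  finally show "(l2norm \<Omega> (\<lambda>x. u x + v x))\<^sup>2 \<le> (l2norm \<Omega> u + l2norm \<Omega> v)\<^sup>2" .
qed (simp add: l2norm_power2(2)[OF meas])

lemma l2norm_uminus: "l2norm \<Omega> (\<lambda>x. - u x) = l2norm \<Omega> u"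
  unfolding l2norm_def l2inner_def by simp

lemma l2norm_minus_commute: "l2norm \<Omega> (\<lambda>x. u x - v x) = l2norm \<Omega> (\<lambda>x. v x - u x)"
  using l2norm_uminus[of "\<lambda>x. u x - v x"] by simp

lemma l2norm_diff_le:
  assumes "L2 \<Omega> u" "L2 \<Omega> v"
  shows "\<bar>l2norm \<Omega> u - l2norm \<Omega> v\<bar> \<le> l2norm \<Omega> (\<lambda>x. u x - v x)"
  using l2norm_triangle[OF L2_diff[OF assms] assms(2)] l2norm_triangle[OF L2_diff[OF assms(2,1)] assms(1)]
    l2norm_minus_commute[of u v] by simp

lemma l2norm_tendsto:
  assumes "\<And>k. L2 \<Omega> (u k)" "L2 \<Omega> v" "(\<lambda>k. l2norm \<Omega> (\<lambda>x. u k x - v x)) \<longlonglongrightarrow> 0"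
  shows "(\<lambda>k. l2norm \<Omega> (u k)) \<longlonglongrightarrow> l2norm \<Omega> v"
proof -
  have "(\<lambda>k. l2norm \<Omega> (u k) - l2norm \<Omega> v) \<longlonglongrightarrow> 0"
    by (rule Lim_null_comparison[OF _ assms(3)]) (simp add: l2norm_diff_le[OF assms(1,2)])
  then show ?thesis by (simp add: LIM_zero_iff)
qed

text \<open>The difference splits into \<open>(u k - a, v k)\<close> and
  \<open>(a, v k - b)\<close>; the norms of \<open>v k\<close> converge, so the first part also
  vanishes.\<close>

lemma l2inner_tendsto:
  assumes "\<And>k. L2 \<Omega> (u k)" "L2 \<Omega> a" "(\<lambda>k. l2norm \<Omega> (\<lambda>x. u k x - a x)) \<longlonglongrightarrow> 0"
    "\<And>k. L2 \<Omega> (v k)" "L2 \<Omega> b" "(\<lambda>k. l2norm \<Omega> (\<lambda>x. v k x - b x)) \<longlonglongrightarrow> 0"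
  shows "(\<lambda>k. l2inner \<Omega> (u k) (v k)) \<longlonglongrightarrow> l2inner \<Omega> a b"
proof -
  have "(\<lambda>k. l2norm \<Omega> (\<lambda>x. u k x - a x) * l2norm \<Omega> (v k) + l2norm \<Omega> a * l2norm \<Omega> (\<lambda>x. v k x - b x))
      \<longlonglongrightarrow> 0 * l2norm \<Omega> b + l2norm \<Omega> a * 0"
    by (intro tendsto_intros assms(3,6) l2norm_tendsto[OF assms(4,5,6)])
  then have lim: "(\<lambda>k. l2norm \<Omega> (\<lambda>x. u k x - a x) * l2norm \<Omega> (v k) + l2norm \<Omega> a * l2norm \<Omega> (\<lambda>x. v k x - b x)) \<longlonglongrightarrow> 0"
    by simp
  have "norm (l2inner \<Omega> (u k) (v k) - l2inner \<Omega> a b)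
      \<le> l2norm \<Omega> (\<lambda>x. u k x - a x) * l2norm \<Omega> (v k) + l2norm \<Omega> a * l2norm \<Omega> (\<lambda>x. v k x - b x)" for k
  proof -
    have "l2inner \<Omega> (u k) (v k) - l2inner \<Omega> a b
        = l2inner \<Omega> (\<lambda>x. u k x - a x) (v k) + l2inner \<Omega> a (\<lambda>x. v k x - b x)"
      using l2inner_diff_left[OF assms(1,2,4)] l2inner_diff_right[OF assms(4,5,2)] by simp
    then show ?thesis
      using L2_inner(4)[OF L2_diff[OF assms(1,2)] assms(4), of k k] L2_inner(4)[OF assms(2) L2_diff[OF assms(4,5)], of k]
      by simp
  qed
  then have "(\<lambda>k. l2inner \<Omega> (u k) (v k) - l2inner \<Omega> a b) \<longlonglongrightarrow> 0"
    by (intro Lim_null_comparison[OF _ lim]) simp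
  then show ?thesis by (simp add: LIM_zero_iff)
qed

end

text \<open>The bridge between two conventions: inequalities for test functions are proved on the
  whole space with \<open>lborel\<close>, norms of fields use the completed measure restricted to
  \<Omega>.\<close>

lemma integral_lebesgue_on_support:
  fixes g :: "real^'d \<Rightarrow> real"
  assumes "\<Omega> \<in> sets lebesgue" "g \<in> borel_measurable borel" "\<And>x. x \<notin> \<Omega> \<Longrightarrow> g x = 0"
  shows "(\<integral>x. g x \<partial>lebesgue_on \<Omega>) = (\<integral>x. g x \<partial>lborel)"
    "integrable (lebesgue_on \<Omega>) g = integrable lborel g"
proof -
  have eq: "(\<lambda>x. indicat_real \<Omega> x * g x) = g"
  proof
    fix x show "indicat_real \<Omega> x * g x = g x" using assms(3)[of x] by (cases "x \<in> \<Omega>") auto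
  qed
  show "(\<integral>x. g x \<partial>lebesgue_on \<Omega>) = (\<integral>x. g x \<partial>lborel)"
    using assms(1,2) by (simp add: integral_restrict_space eq integral_completion)
  show "integrable (lebesgue_on \<Omega>) g = integrable lborel g"
    using assms(1,2) by (simp add: integrable_restrict_space eq integrable_completion)
qed

lemma pgrad_borel: "testfn \<Omega> \<phi> \<Longrightarrow> pgrad \<phi> \<in> borel_measurable borel"
  unfolding pgrad_def[abs_def]
  by (intro borel_measurable_continuous_onI continuous_on_vec_lambda testfn_continuous)

lemma borel_imp_lebesgue_on:
  fixes g :: "real^'d \<Rightarrow> 'b::euclidean_space"
  assumes "g \<in> borel_measurable borel"
  shows "g \<in> borel_measurable (lebesgue_on \<Omega>)"
  using assms by (simp add: measurable_completion measurable_restrict_space1)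

lemma testfn_L2:
  assumes "\<Omega> \<in> sets lebesgue" "testfn \<Omega> \<phi>"
  shows "L2 \<Omega> \<phi>" "L2 \<Omega> (pgrad \<phi>)" "l2norm \<Omega> \<phi> = sqrt (\<integral>x. (\<phi> x)\<^sup>2 \<partial>lborel)"
    "l2norm \<Omega> (pgrad \<phi>) = sqrt (\<integral>x. (norm (pgrad \<phi> x))\<^sup>2 \<partial>lborel)"
proof -
  note [measurable] = testfn_borel[OF assms(2)] pgrad_borel[OF assms(2)]
  have out: "(\<phi> x)\<^sup>2 = 0" "(norm (pgrad \<phi> x))\<^sup>2 = 0" if "x \<notin> \<Omega>" for x
    using testfn_outside[OF assms(2) that] by (auto simp: norm_pgrad_power2)
  note a = integral_lebesgue_on_support[OF assms(1) _ out(1)]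
  note b = integral_lebesgue_on_support[OF assms(1) _ out(2)]
  show "L2 \<Omega> \<phi>" "L2 \<Omega> (pgrad \<phi>)"
    unfolding L2_iff[OF assms(1)] using a(2) b(2) testfn_integrable_squares[OF assms(2)]
    by (auto intro!: borel_imp_lebesgue_on)
  show "l2norm \<Omega> \<phi> = sqrt (\<integral>x. (\<phi> x)\<^sup>2 \<partial>lborel)"
    "l2norm \<Omega> (pgrad \<phi>) = sqrt (\<integral>x. (norm (pgrad \<phi> x))\<^sup>2 \<partial>lborel)"
    unfolding l2norm_power2(3)[OF assms(1)] using a(1) b(1) by simp_all
qed

text \<open>The gradient is carried along as a second argument, so that uniqueness of weak gradients is
  not needed for the inequalities and for integration by parts.\<close>

definition H10 :: "(real^'d) set \<Rightarrow> (real^'d \<Rightarrow> real) \<Rightarrow> (real^'d \<Rightarrow> real^'d) \<Rightarrow> bool" where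
  "H10 \<Omega> a g \<longleftrightarrow> L2 \<Omega> a \<and> L2 \<Omega> g \<and> (\<exists>\<psi>. (\<forall>k::nat. testfn \<Omega> (\<psi> k)) \<and>
     (\<lambda>k. l2norm \<Omega> (\<lambda>x. \<psi> k x - a x)) \<longlonglongrightarrow> 0 \<and> (\<lambda>k. l2norm \<Omega> (\<lambda>x. pgrad (\<psi> k) x - g x)) \<longlonglongrightarrow> 0)"

lemma H10E:
  assumes "H10 \<Omega> a g" "\<Omega> \<in> sets lebesgue"
  obtains \<psi> :: "nat \<Rightarrow> real^'d \<Rightarrow> real" where "\<And>k. testfn \<Omega> (\<psi> k)"
    "(\<lambda>k. l2norm \<Omega> (\<lambda>x. \<psi> k x - a x)) \<longlonglongrightarrow> 0" "(\<lambda>k. l2norm \<Omega> (\<lambda>x. pgrad (\<psi> k) x - g x)) \<longlonglongrightarrow> 0"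
    "(\<lambda>k. l2norm \<Omega> (\<psi> k)) \<longlonglongrightarrow> l2norm \<Omega> a" "(\<lambda>k. l2norm \<Omega> (pgrad (\<psi> k))) \<longlonglongrightarrow> l2norm \<Omega> g"
proof -
  from assms(1) have "\<exists>\<psi>. (\<forall>k::nat. testfn \<Omega> (\<psi> k)) \<and>
     (\<lambda>k. l2norm \<Omega> (\<lambda>x. \<psi> k x - a x)) \<longlonglongrightarrow> 0 \<and> (\<lambda>k. l2norm \<Omega> (\<lambda>x. pgrad (\<psi> k) x - g x)) \<longlonglongrightarrow> 0"
    unfolding H10_def by (elim conjE)
  then obtain \<psi> :: "nat \<Rightarrow> real^'d \<Rightarrow> real" where \<psi>: "\<And>k. testfn \<Omega> (\<psi> k)"
    "(\<lambda>k. l2norm \<Omega> (\<lambda>x. \<psi> k x - a x)) \<longlonglongrightarrow> 0" "(\<lambda>k. l2norm \<Omega> (\<lambda>x. pgrad (\<psi> k) x - g x)) \<longlonglongrightarrow> 0"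
    by (elim exE conjE) (rule that, simp_all)
  have L: "L2 \<Omega> a" "L2 \<Omega> g" using assms(1) unfolding H10_def by auto
  show thesis
    using that[OF \<psi>] l2norm_tendsto[OF assms(2) testfn_L2(1)[OF assms(2) \<psi>(1)] L(1) \<psi>(2)]
      l2norm_tendsto[OF assms(2) testfn_L2(2)[OF assms(2) \<psi>(1)] L(2) \<psi>(3)] by blast
qed

lemma H10_testfn:
  assumes "\<Omega> \<in> sets lebesgue" "testfn \<Omega> \<phi>"
  shows "H10 \<Omega> \<phi> (pgrad \<phi>)"
proof -
  have "l2norm \<Omega> (\<lambda>x. \<phi> x - \<phi> x) = 0" "l2norm \<Omega> (\<lambda>x. pgrad \<phi> x - pgrad \<phi> x) = 0"
    unfolding l2norm_def l2inner_def set_lebesgue_integral_def by simp_all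
  then have "\<exists>\<psi>. (\<forall>k::nat. testfn \<Omega> (\<psi> k)) \<and>
     (\<lambda>k. l2norm \<Omega> (\<lambda>x. \<psi> k x - \<phi> x)) \<longlonglongrightarrow> 0 \<and> (\<lambda>k. l2norm \<Omega> (\<lambda>x. pgrad (\<psi> k) x - pgrad \<phi> x)) \<longlonglongrightarrow> 0"
    using assms(2) by (intro exI[of _ "\<lambda>k. \<phi>"]) simp
  then show ?thesis
    unfolding H10_def using testfn_L2(1,2)[OF assms] by blast
qed

lemma H10_diff:
  fixes \<Omega> :: "(real^'a) set"
  assumes \<Omega>: "\<Omega> \<in> sets lebesgue" and a: "H10 \<Omega> a g" and b: "H10 \<Omega> b h"
  shows "H10 \<Omega> (\<lambda>x. a x - b x) (\<lambda>x. g x - h x)"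
proof -
  obtain \<phi> where \<phi>: "\<And>k. testfn \<Omega> (\<phi> k)" "(\<lambda>k. l2norm \<Omega> (\<lambda>x. \<phi> k x - a x)) \<longlonglongrightarrow> 0"
    "(\<lambda>k. l2norm \<Omega> (\<lambda>x. pgrad (\<phi> k) x - g x)) \<longlonglongrightarrow> 0" by (rule H10E[OF a \<Omega>], rule that)
  obtain \<psi> where \<psi>: "\<And>k. testfn \<Omega> (\<psi> k)" "(\<lambda>k. l2norm \<Omega> (\<lambda>x. \<psi> k x - b x)) \<longlonglongrightarrow> 0"
    "(\<lambda>k. l2norm \<Omega> (\<lambda>x. pgrad (\<psi> k) x - h x)) \<longlonglongrightarrow> 0" by (rule H10E[OF b \<Omega>], rule that)
  have L: "L2 \<Omega> a" "L2 \<Omega> g" "L2 \<Omega> b" "L2 \<Omega> h" using a b unfolding H10_def by auto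
  note \<phi>L = testfn_L2(1,2)[OF \<Omega> \<phi>(1)] and \<psi>L = testfn_L2(1,2)[OF \<Omega> \<psi>(1)]
  define \<eta> where "\<eta> k = (\<lambda>x. \<phi> k x - \<psi> k x)" for k
  have \<eta>: "testfn \<Omega> (\<eta> k)" "pgrad (\<eta> k) x = pgrad (\<phi> k) x - pgrad (\<psi> k) x" for k x
    using testfn_lincomb[OF \<phi>(1) \<psi>(1), of 1 k "-1" k] unfolding \<eta>_def pgrad_def by (auto simp: vec_eq_iff)
  have tri: "l2norm \<Omega> (\<lambda>x. (u x - u' x) - (v x - v' x)) \<le> l2norm \<Omega> (\<lambda>x. u x - v x) + l2norm \<Omega> (\<lambda>x. u' x - v' x)"
    if "L2 \<Omega> u" "L2 \<Omega> v" "L2 \<Omega> u'" "L2 \<Omega> v'" for u v u' v' :: "real^'a \<Rightarrow> 'b::euclidean_space"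
  proof -
    have "(\<lambda>x. (u x - u' x) - (v x - v' x)) = (\<lambda>x. (u x - v x) + (v' x - u' x))"
      by (auto simp: algebra_simps)
    then show ?thesis
      using l2norm_triangle[OF \<Omega> L2_diff[OF \<Omega> that(1,2)] L2_diff[OF \<Omega> that(4,3)]]
      by (simp add: l2norm_minus_commute[OF \<Omega>, of v' u'])
  qed
  have z: "(\<lambda>k. l2norm \<Omega> (\<lambda>x. \<phi> k x - a x) + l2norm \<Omega> (\<lambda>x. \<psi> k x - b x)) \<longlonglongrightarrow> 0"
    "(\<lambda>k. l2norm \<Omega> (\<lambda>x. pgrad (\<phi> k) x - g x) + l2norm \<Omega> (\<lambda>x. pgrad (\<psi> k) x - h x)) \<longlonglongrightarrow> 0"
    using tendsto_add[OF \<phi>(2) \<psi>(2)] tendsto_add[OF \<phi>(3) \<psi>(3)] by simp_all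
  have "(\<lambda>k. l2norm \<Omega> (\<lambda>x. \<eta> k x - (a x - b x))) \<longlonglongrightarrow> 0"
    by (rule Lim_null_comparison[OF _ z(1)])
       (use tri[OF \<phi>L(1) L(1) \<psi>L(1) L(3)] in \<open>simp add: \<eta>_def l2norm_power2(2)[OF \<Omega>]\<close>)
  moreover have "(\<lambda>k. l2norm \<Omega> (\<lambda>x. pgrad (\<eta> k) x - (g x - h x))) \<longlonglongrightarrow> 0"
    by (rule Lim_null_comparison[OF _ z(2)])
       (use tri[OF \<phi>L(2) L(2) \<psi>L(2) L(4)] in \<open>simp add: \<eta>(2) l2norm_power2(2)[OF \<Omega>]\<close>)
  ultimately show ?thesis
    unfolding H10_def using L2_diff[OF \<Omega> L(1,3)] L2_diff[OF \<Omega> L(2,4)] \<eta>(1) by blast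
qed

text \<open>The inequality for test functions survives the limit because both norms converge. It
  later shows that the supremum defining \<open>hm1norm\<close> is taken over a bounded set.\<close>

lemma H10_Poincare:
  fixes \<Omega> :: "(real^'d) set"
  assumes \<Omega>: "\<Omega> \<in> sets lebesgue" "bounded \<Omega>"
  obtains C where "C > 0" "\<And>a g. H10 \<Omega> a g \<Longrightarrow> l2norm \<Omega> a \<le> C * l2norm \<Omega> g"
proof -
  obtain R where R: "R > 0" "\<Omega> \<subseteq> cball 0 R"
    using bounded_subset_ballD[OF \<Omega>(2), of 0] ball_subset_cball by (meson order_trans)
  have *: "l2norm \<Omega> \<phi> \<le> 2 * R * l2norm \<Omega> (pgrad \<phi>)" if "testfn \<Omega> \<phi>" for \<phi> :: "real^'d \<Rightarrow> real"
  proof -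
    have "l2norm \<Omega> \<phi> \<le> sqrt (4 * R\<^sup>2 * (\<integral>x. (norm (pgrad \<phi> x))\<^sup>2 \<partial>lborel))"
      using testfn_Poincare[OF that R(2)] R(1) unfolding testfn_L2(3)[OF \<Omega>(1) that] by simp
    also have "\<dots> = 2 * R * l2norm \<Omega> (pgrad \<phi>)"
      unfolding testfn_L2(4)[OF \<Omega>(1) that] using R(1) by (simp add: real_sqrt_mult)
    finally show ?thesis .
  qed
  show thesis
  proof (rule that[of "2 * R"])
    fix a :: "real^'d \<Rightarrow> real" and g assume H: "H10 \<Omega> a g"
    obtain \<psi> :: "nat \<Rightarrow> real^'d \<Rightarrow> real" where \<psi>: "\<And>k. testfn \<Omega> (\<psi> k)"
      "(\<lambda>k. l2norm \<Omega> (\<psi> k)) \<longlonglongrightarrow> l2norm \<Omega> a" "(\<lambda>k. l2norm \<Omega> (pgrad (\<psi> k))) \<longlonglongrightarrow> l2norm \<Omega> g"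
      by (rule H10E[OF H \<Omega>(1)], rule that)
    show "l2norm \<Omega> a \<le> 2 * R * l2norm \<Omega> g"
      by (rule LIMSEQ_le[OF \<psi>(2) tendsto_mult_left[OF \<psi>(3)]]) (use *[OF \<psi>(1)] in auto)
  qed (use R in auto)
qed

text \<open>Convergence of both factors in L^2 gives convergence of the product in L^1, by splitting
  the difference as (\<phi> - a) \<psi> + a (\<psi> - b).\<close>

lemma integral_mult_tendsto:
  fixes a b :: "real^'d \<Rightarrow> real"
  assumes \<Omega>: "\<Omega> \<in> sets lebesgue"
    and \<phi>: "\<And>k. L2 \<Omega> (\<phi> k)" "L2 \<Omega> a" "(\<lambda>k. l2norm \<Omega> (\<lambda>x. \<phi> k x - a x)) \<longlonglongrightarrow> 0"
    and \<psi>: "\<And>k. L2 \<Omega> (\<psi> k)" "L2 \<Omega> b" "(\<lambda>k. l2norm \<Omega> (\<lambda>x. \<psi> k x - b x)) \<longlonglongrightarrow> 0"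
  shows "(\<lambda>k. \<integral>x. \<bar>\<phi> k x * \<psi> k x - a x * b x\<bar> \<partial>lebesgue_on \<Omega>) \<longlonglongrightarrow> 0"
proof (rule Lim_null_comparison)
  have "(\<lambda>k. l2norm \<Omega> (\<lambda>x. \<phi> k x - a x) * l2norm \<Omega> (\<psi> k) + l2norm \<Omega> a * l2norm \<Omega> (\<lambda>x. \<psi> k x - b x))
      \<longlonglongrightarrow> 0 * l2norm \<Omega> b + l2norm \<Omega> a * 0"
    by (intro tendsto_intros \<phi>(3) \<psi>(3) l2norm_tendsto[OF \<Omega> \<psi>])
  then show "(\<lambda>k. l2norm \<Omega> (\<lambda>x. \<phi> k x - a x) * l2norm \<Omega> (\<psi> k) + l2norm \<Omega> a * l2norm \<Omega> (\<lambda>x. \<psi> k x - b x)) \<longlonglongrightarrow> 0"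
    by simp
  have "(\<integral>x. \<bar>\<phi> k x * \<psi> k x - a x * b x\<bar> \<partial>lebesgue_on \<Omega>)
      \<le> l2norm \<Omega> (\<lambda>x. \<phi> k x - a x) * l2norm \<Omega> (\<psi> k) + l2norm \<Omega> a * l2norm \<Omega> (\<lambda>x. \<psi> k x - b x)" for k
  proof -
    note 1 = L2_inner[OF \<Omega> L2_diff[OF \<Omega> \<phi>(1,2)] \<psi>(1), of k k]
    note 2 = L2_inner[OF \<Omega> \<phi>(2) L2_diff[OF \<Omega> \<psi>(1,2)], of k]
    have "(\<integral>x. \<bar>\<phi> k x * \<psi> k x - a x * b x\<bar> \<partial>lebesgue_on \<Omega>)
       \<le> (\<integral>x. norm (\<phi> k x - a x) * norm (\<psi> k x) + norm (a x) * norm (\<psi> k x - b x) \<partial>lebesgue_on \<Omega>)"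
    proof (rule integral_mono)
      show "integrable (lebesgue_on \<Omega>) (\<lambda>x. \<bar>\<phi> k x * \<psi> k x - a x * b x\<bar>)"
        using L2_inner(3)[OF \<Omega> \<phi>(1) \<psi>(1), of k k] L2_inner(3)[OF \<Omega> \<phi>(2) \<psi>(2)] by (auto simp: mult_ac)
      show "integrable (lebesgue_on \<Omega>) (\<lambda>x. norm (\<phi> k x - a x) * norm (\<psi> k x) + norm (a x) * norm (\<psi> k x - b x))"
        using 1(1) 2(1) by simp
      show "\<bar>\<phi> k x * \<psi> k x - a x * b x\<bar> \<le> norm (\<phi> k x - a x) * norm (\<psi> k x) + norm (a x) * norm (\<psi> k x - b x)" for x
      proof -
        have "\<phi> k x * \<psi> k x - a x * b x = (\<phi> k x - a x) * \<psi> k x + a x * (\<psi> k x - b x)"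
          by (simp add: algebra_simps)
        then show ?thesis using abs_triangle_ineq[of "(\<phi> k x - a x) * \<psi> k x" "a x * (\<psi> k x - b x)"]
          by (simp add: abs_mult)
      qed
    qed
    also have "\<dots> = (\<integral>x. norm (\<phi> k x - a x) * norm (\<psi> k x) \<partial>lebesgue_on \<Omega>) + (\<integral>x. norm (a x) * norm (\<psi> k x - b x) \<partial>lebesgue_on \<Omega>)"
      by (rule Bochner_Integration.integral_add[OF 1(1) 2(1)])
    finally show ?thesis using 1(2) 2(2) by linarith
  qed
  then show "\<forall>\<^sub>F k in sequentially. norm (\<integral>x. \<bar>\<phi> k x * \<psi> k x - a x * b x\<bar> \<partial>lebesgue_on \<Omega>)
     \<le> l2norm \<Omega> (\<lambda>x. \<phi> k x - a x) * l2norm \<Omega> (\<psi> k) + l2norm \<Omega> a * l2norm \<Omega> (\<lambda>x. \<psi> k x - b x)"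
    by simp
qed

text \<open>A subsequence converges almost everywhere, and Fatou's lemma passes the L^2 bound to the
  limit. The bound \<open>c k\<close> varies with k because it is made of the norms of approximating
  test functions, which merely converge.\<close>

lemma L1_limit_L2_bound:
  fixes p :: "real^'d \<Rightarrow> real"
  assumes \<Omega>: "\<Omega> \<in> sets lebesgue"
    and P: "\<And>k. L2 \<Omega> (P k)" "\<And>k. integrable (lebesgue_on \<Omega>) (P k)" "integrable (lebesgue_on \<Omega>) p"
    and lim: "(\<lambda>k::nat. \<integral>x. \<bar>P k x - p x\<bar> \<partial>lebesgue_on \<Omega>) \<longlonglongrightarrow> 0"
    and c: "\<And>k. (l2norm \<Omega> (P k))\<^sup>2 \<le> c k" "c \<longlonglongrightarrow> c0"
  shows "L2 \<Omega> p" "(l2norm \<Omega> p)\<^sup>2 \<le> c0"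
proof -
  have [measurable]: "P k \<in> borel_measurable (lebesgue_on \<Omega>)" "p \<in> borel_measurable (lebesgue_on \<Omega>)" for k
    using P by auto
  have c0: "c0 \<ge> 0"
    by (rule LIMSEQ_le_const[OF c(2)]) (meson c(1) order_trans zero_le_power2)
  obtain r where r: "strict_mono r" "AE x in lebesgue_on \<Omega>. (\<lambda>n. P (r n) x - p x) \<longlonglongrightarrow> 0"
    using tendsto_L1_AE_subseq[of "lebesgue_on \<Omega>" "\<lambda>k x. P k x - p x"] P lim by auto
  have "(\<integral>\<^sup>+x. ennreal ((p x)\<^sup>2) \<partial>lebesgue_on \<Omega>) = (\<integral>\<^sup>+x. liminf (\<lambda>n. ennreal ((P (r n) x)\<^sup>2)) \<partial>lebesgue_on \<Omega>)"
  proof (rule nn_integral_cong_AE)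
    show "AE x in lebesgue_on \<Omega>. ennreal ((p x)\<^sup>2) = liminf (\<lambda>n. ennreal ((P (r n) x)\<^sup>2))"
      using r(2)
    proof eventually_elim
      case (elim x)
      then have "(\<lambda>n. P (r n) x) \<longlonglongrightarrow> p x" by (simp add: LIM_zero_iff)
      then have "(\<lambda>n. ennreal ((P (r n) x)\<^sup>2)) \<longlonglongrightarrow> ennreal ((p x)\<^sup>2)" by (intro tendsto_intros)
      then show ?case by (intro lim_imp_Liminf[symmetric]) simp_all
    qed
  qed
  also have "\<dots> \<le> liminf (\<lambda>n. \<integral>\<^sup>+x. ennreal ((P (r n) x)\<^sup>2) \<partial>lebesgue_on \<Omega>)"
    by (rule nn_integral_liminf) measurable
  also have "\<dots> \<le> liminf (\<lambda>n. ennreal (c (r n)))"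
  proof (intro Liminf_mono always_eventually allI)
    fix n
    have "integrable (lebesgue_on \<Omega>) (\<lambda>x. (P (r n) x)\<^sup>2)" using P(1)[of "r n"] by (simp add: L2_iff[OF \<Omega>])
    then have "(\<integral>\<^sup>+x. ennreal ((P (r n) x)\<^sup>2) \<partial>lebesgue_on \<Omega>) = ennreal ((l2norm \<Omega> (P (r n)))\<^sup>2)"
      unfolding l2norm_power2(1)[OF \<Omega>] by (simp add: nn_integral_eq_integral)
    then show "(\<integral>\<^sup>+x. ennreal ((P (r n) x)\<^sup>2) \<partial>lebesgue_on \<Omega>) \<le> ennreal (c (r n))"
      using c(1)[of "r n"] by (simp add: ennreal_leI)
  qed
  also have "\<dots> = ennreal c0"
  proof -
    have "(\<lambda>n. c (r n)) \<longlonglongrightarrow> c0" using LIMSEQ_subseq_LIMSEQ[OF c(2) r(1)] by (simp add: comp_def)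
    then have "(\<lambda>n. ennreal (c (r n))) \<longlonglongrightarrow> ennreal c0" by (intro tendsto_intros)
    then show ?thesis by (intro lim_imp_Liminf) simp_all
  qed
  finally have le: "(\<integral>\<^sup>+x. ennreal ((p x)\<^sup>2) \<partial>lebesgue_on \<Omega>) \<le> ennreal c0" .
  have int: "integrable (lebesgue_on \<Omega>) (\<lambda>x. (p x)\<^sup>2)"
    using order_le_less_trans[OF le ennreal_less_top] by (intro integrableI_bounded) auto
  then show "L2 \<Omega> p" unfolding L2_iff[OF \<Omega>] by simp
  have "ennreal ((l2norm \<Omega> p)\<^sup>2) \<le> ennreal c0"
    using le unfolding l2norm_power2(1)[OF \<Omega>] by (simp add: nn_integral_eq_integral[OF int])
  then show "(l2norm \<Omega> p)\<^sup>2 \<le> c0" using c0 by simp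
qed

text \<open>The products of approximating test functions are at first known to converge only in L^1;
  the uniform product bound with \<open>L1_limit_L2_bound\<close> lifts the limit to L^2. That the
  product is square-integrable is what makes the trilinear integrals of the convective form
  exist.\<close>

lemma H10_product:
  fixes \<Omega> :: "(real^'d) set"
  assumes dim: "CARD('d) = 2 \<or> CARD('d) = 3" and \<Omega>: "\<Omega> \<in> sets lebesgue" "bounded \<Omega>"
  obtains C where "C > 0"
    "\<And>a g b h. H10 \<Omega> a g \<Longrightarrow> H10 \<Omega> b h \<Longrightarrow> L2 \<Omega> (\<lambda>x. a x * b x)"
    "\<And>a g b h. H10 \<Omega> a g \<Longrightarrow> H10 \<Omega> b h \<Longrightarrow>
       l2norm \<Omega> (\<lambda>x. a x * b x) \<le> C * l2norm \<Omega> g * sqrt (l2norm \<Omega> b * l2norm \<Omega> h)"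
proof -
  obtain C where C: "C > 0" "\<And>\<phi> \<psi> :: real^'d \<Rightarrow> real. testfn \<Omega> \<phi> \<Longrightarrow> testfn \<Omega> \<psi> \<Longrightarrow>
    (\<integral>x. (\<phi> x)\<^sup>2 * (\<psi> x)\<^sup>2 \<partial>lborel) \<le> C * (\<integral>x. (norm (pgrad \<phi> x))\<^sup>2 \<partial>lborel)
      * (sqrt (\<integral>x. (\<psi> x)\<^sup>2 \<partial>lborel) * sqrt (\<integral>x. (norm (pgrad \<psi> x))\<^sup>2 \<partial>lborel))"
    using testfn_product_bound[OF dim \<Omega>(2)] by blast
  have main: "L2 \<Omega> (\<lambda>x. a x * b x) \<and>
      (l2norm \<Omega> (\<lambda>x. a x * b x))\<^sup>2 \<le> C * (l2norm \<Omega> g)\<^sup>2 * (l2norm \<Omega> b * l2norm \<Omega> h)"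
    if a: "H10 \<Omega> a g" and b: "H10 \<Omega> b h" for a g b h
  proof -
    obtain \<phi> where \<phi>: "\<And>k. testfn \<Omega> (\<phi> k)" "(\<lambda>k. l2norm \<Omega> (\<lambda>x. \<phi> k x - a x)) \<longlonglongrightarrow> 0"
      "(\<lambda>k. l2norm \<Omega> (pgrad (\<phi> k))) \<longlonglongrightarrow> l2norm \<Omega> g" by (rule H10E[OF a \<Omega>(1)], rule that)
    obtain \<psi> where \<psi>: "\<And>k. testfn \<Omega> (\<psi> k)" "(\<lambda>k. l2norm \<Omega> (\<lambda>x. \<psi> k x - b x)) \<longlonglongrightarrow> 0"
      "(\<lambda>k. l2norm \<Omega> (\<psi> k)) \<longlonglongrightarrow> l2norm \<Omega> b"
      "(\<lambda>k. l2norm \<Omega> (pgrad (\<psi> k))) \<longlonglongrightarrow> l2norm \<Omega> h" by (rule H10E[OF b \<Omega>(1)], rule that)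
    have L: "L2 \<Omega> a" "L2 \<Omega> b" using a b unfolding H10_def by auto
    note \<phi>L = testfn_L2[OF \<Omega>(1) \<phi>(1)] and \<psi>L = testfn_L2[OF \<Omega>(1) \<psi>(1)]
    have t: "testfn \<Omega> (\<lambda>x. \<phi> k x * \<psi> k x)" for k by (rule testfn_mult_testfn[OF \<phi>(1) \<psi>(1)])
    define c where "c k = C * (l2norm \<Omega> (pgrad (\<phi> k)))\<^sup>2 * (l2norm \<Omega> (\<psi> k) * l2norm \<Omega> (pgrad (\<psi> k)))" for k
    have cl: "c \<longlonglongrightarrow> C * (l2norm \<Omega> g)\<^sup>2 * (l2norm \<Omega> b * l2norm \<Omega> h)"
      unfolding c_def by (intro tendsto_intros \<phi> \<psi>)
    have ck: "(l2norm \<Omega> (\<lambda>x. \<phi> k x * \<psi> k x))\<^sup>2 \<le> c k" for k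
      using C(2)[OF \<phi>(1) \<psi>(1), of k k]
      unfolding c_def testfn_L2(3)[OF \<Omega>(1) t] \<phi>L(4) \<psi>L(3,4) by (simp add: power_mult_distrib)
    have int: "integrable (lebesgue_on \<Omega>) (\<lambda>x. \<phi> k x * \<psi> k x)" "integrable (lebesgue_on \<Omega>) (\<lambda>x. a x * b x)" for k
      using L2_inner(3)[OF \<Omega>(1) \<phi>L(1) \<psi>L(1), of k k] L2_inner(3)[OF \<Omega>(1) L] by (auto simp: mult_ac)
    show ?thesis
      using L1_limit_L2_bound[OF \<Omega>(1) testfn_L2(1)[OF \<Omega>(1) t] int
          integral_mult_tendsto[OF \<Omega>(1) \<phi>L(1) L(1) \<phi>(2) \<psi>L(1) L(2) \<psi>(2)] ck cl] by blast
  qed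
  show thesis
  proof (rule that[of "sqrt C"])
    fix a g b h assume H: "H10 \<Omega> a g" "H10 \<Omega> b h"
    show "L2 \<Omega> (\<lambda>x. a x * b x)" using main[OF H] by blast
    have "(l2norm \<Omega> (\<lambda>x. a x * b x))\<^sup>2 \<le> (sqrt C * l2norm \<Omega> g * sqrt (l2norm \<Omega> b * l2norm \<Omega> h))\<^sup>2"
      using main[OF H] C(1) 
        real_sqrt_pow2[OF mult_nonneg_nonneg[OF l2norm_power2(2)[OF \<Omega>(1)] l2norm_power2(2)[OF \<Omega>(1)]], of b h]
      by (simp add: power_mult_distrib)
    then show "l2norm \<Omega> (\<lambda>x. a x * b x) \<le> sqrt C * l2norm \<Omega> g * sqrt (l2norm \<Omega> b * l2norm \<Omega> h)"
      by (rule power2_le_imp_le) (intro mult_nonneg_nonneg real_sqrt_ge_zero l2norm_power2(2)[OF \<Omega>(1)] less_imp_le[OF C(1)])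
  qed (use C in auto)
qed

text \<open>The product bound, now available for limits too, is applied to the two parts of the
  split difference. In (\<phi> - a) \<psi> the small factor enters by its gradient norm, in a
  (\<psi> - b) by its interpolated norm. This improves the L^1 convergence of products to
  L^2.\<close>

lemma H10_mult_tendsto:
  fixes \<Omega> :: "(real^'d) set"
  assumes dim: "CARD('d) = 2 \<or> CARD('d) = 3" and \<Omega>: "\<Omega> \<in> sets lebesgue" "bounded \<Omega>"
    and a: "H10 \<Omega> a g" and b: "H10 \<Omega> b h"
    and \<phi>: "\<And>k. testfn \<Omega> (\<phi> k)" "(\<lambda>k. l2norm \<Omega> (\<lambda>x. \<phi> k x - a x)) \<longlonglongrightarrow> 0"
      "(\<lambda>k. l2norm \<Omega> (\<lambda>x. pgrad (\<phi> k) x - g x)) \<longlonglongrightarrow> 0"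
    and \<psi>: "\<And>k. testfn \<Omega> (\<psi> k)" "(\<lambda>k. l2norm \<Omega> (\<lambda>x. \<psi> k x - b x)) \<longlonglongrightarrow> 0"
      "(\<lambda>k. l2norm \<Omega> (\<lambda>x. pgrad (\<psi> k) x - h x)) \<longlonglongrightarrow> 0"
      "(\<lambda>k. l2norm \<Omega> (\<psi> k)) \<longlonglongrightarrow> l2norm \<Omega> b" "(\<lambda>k. l2norm \<Omega> (pgrad (\<psi> k))) \<longlonglongrightarrow> l2norm \<Omega> h"
  shows "(\<lambda>k. l2norm \<Omega> (\<lambda>x. \<phi> k x * \<psi> k x - a x * b x)) \<longlonglongrightarrow> 0"
proof -
  obtain C where C: "C > 0"
    "\<And>a g b h. H10 \<Omega> a g \<Longrightarrow> H10 \<Omega> b h \<Longrightarrow> L2 \<Omega> (\<lambda>x. a x * b x)"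
    "\<And>a g b h. H10 \<Omega> a g \<Longrightarrow> H10 \<Omega> b h \<Longrightarrow>
       l2norm \<Omega> (\<lambda>x. a x * b x) \<le> C * l2norm \<Omega> g * sqrt (l2norm \<Omega> b * l2norm \<Omega> h)"
    by (rule H10_product[OF dim \<Omega>], rule that)
  note \<phi>H = H10_testfn[OF \<Omega>(1) \<phi>(1)] and \<psi>H = H10_testfn[OF \<Omega>(1) \<psi>(1)]
  define e where "e k = C * l2norm \<Omega> (\<lambda>x. pgrad (\<phi> k) x - g x) * sqrt (l2norm \<Omega> (\<psi> k) * l2norm \<Omega> (pgrad (\<psi> k)))
    + C * l2norm \<Omega> g * sqrt (l2norm \<Omega> (\<lambda>x. \<psi> k x - b x) * l2norm \<Omega> (\<lambda>x. pgrad (\<psi> k) x - h x))" for k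
  have "e \<longlonglongrightarrow> C * 0 * sqrt (l2norm \<Omega> b * l2norm \<Omega> h) + C * l2norm \<Omega> g * sqrt (0 * 0)"
    unfolding e_def by (intro tendsto_intros \<phi> \<psi>)
  then have e: "e \<longlonglongrightarrow> 0" by simp
  have "l2norm \<Omega> (\<lambda>x. \<phi> k x * \<psi> k x - a x * b x) \<le> e k" for k
  proof -
    note 1 = H10_diff[OF \<Omega>(1) \<phi>H a, of k] \<psi>H[of k] and 2 = a H10_diff[OF \<Omega>(1) \<psi>H b, of k]
    have "(\<lambda>x. \<phi> k x * \<psi> k x - a x * b x) = (\<lambda>x. (\<phi> k x - a x) * \<psi> k x + a x * (\<psi> k x - b x))"
      by (auto simp: algebra_simps)
    then have "l2norm \<Omega> (\<lambda>x. \<phi> k x * \<psi> k x - a x * b x)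
        \<le> l2norm \<Omega> (\<lambda>x. (\<phi> k x - a x) * \<psi> k x) + l2norm \<Omega> (\<lambda>x. a x * (\<psi> k x - b x))"
      using l2norm_triangle[OF \<Omega>(1) C(2)[OF 1] C(2)[OF 2]] by simp
    then show ?thesis using C(3)[OF 1] C(3)[OF 2] unfolding e_def by linarith
  qed
  then show ?thesis
    by (intro Lim_null_comparison[OF _ e]) (simp add: l2norm_power2(2)[OF \<Omega>(1)])
qed

text \<open>The derivative of the product a b c in direction j integrates to zero.\<close>

lemma testfn_parts:
  assumes \<Omega>: "\<Omega> \<in> sets lebesgue" and a: "testfn \<Omega> a" and b: "testfn \<Omega> b" and c: "testfn \<Omega> c"
  shows "l2inner \<Omega> (\<lambda>x. pgrad a x $ j) (\<lambda>x. b x * c x) + l2inner \<Omega> (\<lambda>x. pgrad b x $ j) (\<lambda>x. a x * c x)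
    + l2inner \<Omega> (\<lambda>x. pgrad c x $ j) (\<lambda>x. a x * b x) = 0"
proof -
  note [measurable] = testfn_borel[OF a] testfn_borel[OF b] testfn_borel[OF c]
  note ab = testfn_mult_testfn[OF a b] and ac = testfn_mult_testfn[OF a c] and bc = testfn_mult_testfn[OF b c]
  note abc = testfn_mult_testfn[OF ab(1) c]
  have eq: "l2inner \<Omega> (\<lambda>x. pgrad u x $ j) (\<lambda>x. v x) = (\<integral>x. pderiv u j x * v x \<partial>lborel)
      \<and> integrable lborel (\<lambda>x. pderiv u j x * v x)"
    if u: "testfn \<Omega> u" and v: "testfn \<Omega> v" for u v
  proof -
    note [measurable] = testfn_borel[OF u] testfn_borel[OF v]
    have "l2inner \<Omega> (\<lambda>x. pgrad u x $ j) (\<lambda>x. v x) = (\<integral>x. pderiv u j x * v x \<partial>lebesgue_on \<Omega>)"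
      unfolding l2inner_eq[OF \<Omega>] pgrad_def by simp
    also have "\<dots> = (\<integral>x. pderiv u j x * v x \<partial>lborel)"
      by (rule integral_lebesgue_on_support[OF \<Omega>]) (auto simp: testfn_outside[OF v])
    finally show ?thesis using testfn_integrable_mult(2)[OF u testfn_continuous(1)[OF v]] by simp
  qed
  have "0 = (\<integral>x. pderiv (\<lambda>x. a x * b x * c x) j x \<partial>lborel)"
    using integral_pderiv_eq_0[OF abc(1)] by simp
  also have "\<dots> = (\<integral>x. pderiv a j x * (b x * c x) + pderiv b j x * (a x * c x) + pderiv c j x * (a x * b x) \<partial>lborel)"
    unfolding abc(2) ab(2) by (simp add: algebra_simps)
  also have "\<dots> = l2inner \<Omega> (\<lambda>x. pgrad a x $ j) (\<lambda>x. b x * c x) + l2inner \<Omega> (\<lambda>x. pgrad b x $ j) (\<lambda>x. a x * c x)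
    + l2inner \<Omega> (\<lambda>x. pgrad c x $ j) (\<lambda>x. a x * b x)"
    using eq[OF a bc(1)] eq[OF b ac(1)] eq[OF c ab(1)] by simp
  finally show ?thesis by simp
qed

text \<open>Each term pairs a gradient component with a product of two functions. Both converge in
  L^2 along the approximating test functions, so the identity for test functions passes to the
  limit.\<close>

lemma H10_parts:
  fixes \<Omega> :: "(real^'d) set"
  assumes dim: "CARD('d) = 2 \<or> CARD('d) = 3" and \<Omega>: "\<Omega> \<in> sets lebesgue" "bounded \<Omega>"
    and a: "H10 \<Omega> a \<alpha>" and b: "H10 \<Omega> b \<beta>" and c: "H10 \<Omega> c \<gamma>"
  shows "l2inner \<Omega> (\<lambda>x. \<alpha> x $ j) (\<lambda>x. b x * c x) + l2inner \<Omega> (\<lambda>x. \<beta> x $ j) (\<lambda>x. a x * c x)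
    + l2inner \<Omega> (\<lambda>x. \<gamma> x $ j) (\<lambda>x. a x * b x) = 0"
proof -
  obtain A where A: "\<And>k. testfn \<Omega> (A k)" "(\<lambda>k. l2norm \<Omega> (\<lambda>x. A k x - a x)) \<longlonglongrightarrow> 0"
    "(\<lambda>k. l2norm \<Omega> (\<lambda>x. pgrad (A k) x - \<alpha> x)) \<longlonglongrightarrow> 0"
    "(\<lambda>k. l2norm \<Omega> (A k)) \<longlonglongrightarrow> l2norm \<Omega> a" "(\<lambda>k. l2norm \<Omega> (pgrad (A k))) \<longlonglongrightarrow> l2norm \<Omega> \<alpha>"
    by (rule H10E[OF a \<Omega>(1)], rule that)
  obtain B where B: "\<And>k. testfn \<Omega> (B k)" "(\<lambda>k. l2norm \<Omega> (\<lambda>x. B k x - b x)) \<longlonglongrightarrow> 0"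
    "(\<lambda>k. l2norm \<Omega> (\<lambda>x. pgrad (B k) x - \<beta> x)) \<longlonglongrightarrow> 0"
    "(\<lambda>k. l2norm \<Omega> (B k)) \<longlonglongrightarrow> l2norm \<Omega> b" "(\<lambda>k. l2norm \<Omega> (pgrad (B k))) \<longlonglongrightarrow> l2norm \<Omega> \<beta>"
    by (rule H10E[OF b \<Omega>(1)], rule that)
  obtain D where D: "\<And>k. testfn \<Omega> (D k)" "(\<lambda>k. l2norm \<Omega> (\<lambda>x. D k x - c x)) \<longlonglongrightarrow> 0"
    "(\<lambda>k. l2norm \<Omega> (\<lambda>x. pgrad (D k) x - \<gamma> x)) \<longlonglongrightarrow> 0"
    "(\<lambda>k. l2norm \<Omega> (D k)) \<longlonglongrightarrow> l2norm \<Omega> c" "(\<lambda>k. l2norm \<Omega> (pgrad (D k))) \<longlonglongrightarrow> l2norm \<Omega> \<gamma>"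
    by (rule H10E[OF c \<Omega>(1)], rule that)
  obtain C where C: "C > 0"
    "\<And>a g b h. H10 \<Omega> a g \<Longrightarrow> H10 \<Omega> b h \<Longrightarrow> L2 \<Omega> (\<lambda>x. a x * b x)"
    "\<And>a g b h. H10 \<Omega> a g \<Longrightarrow> H10 \<Omega> b h \<Longrightarrow>
       l2norm \<Omega> (\<lambda>x. a x * b x) \<le> C * l2norm \<Omega> g * sqrt (l2norm \<Omega> b * l2norm \<Omega> h)"
    by (rule H10_product[OF dim \<Omega>], rule that)
  have comp: "(\<lambda>k. l2norm \<Omega> (\<lambda>x. pgrad (P k) x $ j - p x $ j)) \<longlonglongrightarrow> 0"
    if "\<And>k. testfn \<Omega> (P k)" "L2 \<Omega> p" "(\<lambda>k. l2norm \<Omega> (\<lambda>x. pgrad (P k) x - p x)) \<longlonglongrightarrow> 0"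
    for P and p :: "real^'d \<Rightarrow> real^'d"
  proof (rule Lim_null_comparison[OF _ that(3)])
    have "l2norm \<Omega> (\<lambda>x. pgrad (P k) x $ j - p x $ j) \<le> l2norm \<Omega> (\<lambda>x. pgrad (P k) x - p x)" for k
      using L2_nth(2)[OF \<Omega>(1) L2_diff[OF \<Omega>(1) testfn_L2(2)[OF \<Omega>(1) that(1)] that(2)], of k j] by simp
    then show "\<forall>\<^sub>F k in sequentially. norm (l2norm \<Omega> (\<lambda>x. pgrad (P k) x $ j - p x $ j)) \<le> l2norm \<Omega> (\<lambda>x. pgrad (P k) x - p x)"
      by (simp add: l2norm_power2(2)[OF \<Omega>(1)])
  qed
  have lim: "(\<lambda>k. l2inner \<Omega> (\<lambda>x. pgrad (P k) x $ j) (\<lambda>x. U k x * V k x)) \<longlonglongrightarrow> l2inner \<Omega> (\<lambda>x. p x $ j) (\<lambda>x. u x * v x)"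
    if "\<And>k. testfn \<Omega> (P k)" "L2 \<Omega> p" "(\<lambda>k. l2norm \<Omega> (\<lambda>x. pgrad (P k) x - p x)) \<longlonglongrightarrow> 0"
      "\<And>k. testfn \<Omega> (U k)" "\<And>k. testfn \<Omega> (V k)" "L2 \<Omega> (\<lambda>x. u x * v x)"
      "(\<lambda>k. l2norm \<Omega> (\<lambda>x. U k x * V k x - u x * v x)) \<longlonglongrightarrow> 0"
    for P U V u v and p :: "real^'d \<Rightarrow> real^'d"
    by (rule l2inner_tendsto[OF \<Omega>(1) L2_nth(1)[OF \<Omega>(1) testfn_L2(2)[OF \<Omega>(1) that(1)]] L2_nth(1)[OF \<Omega>(1) that(2)]
       comp[OF that(1-3)] testfn_L2(1)[OF \<Omega>(1) testfn_mult_testfn(1)[OF that(4,5)]] that(6,7)])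
  have L: "L2 \<Omega> \<alpha>" "L2 \<Omega> \<beta>" "L2 \<Omega> \<gamma>" using a b c unfolding H10_def by auto
  note mt = H10_mult_tendsto[OF dim \<Omega>]
  have "(\<lambda>k. l2inner \<Omega> (\<lambda>x. pgrad (A k) x $ j) (\<lambda>x. B k x * D k x) + l2inner \<Omega> (\<lambda>x. pgrad (B k) x $ j) (\<lambda>x. A k x * D k x)
    + l2inner \<Omega> (\<lambda>x. pgrad (D k) x $ j) (\<lambda>x. A k x * B k x)) \<longlonglongrightarrow>
    l2inner \<Omega> (\<lambda>x. \<alpha> x $ j) (\<lambda>x. b x * c x) + l2inner \<Omega> (\<lambda>x. \<beta> x $ j) (\<lambda>x. a x * c x)
    + l2inner \<Omega> (\<lambda>x. \<gamma> x $ j) (\<lambda>x. a x * b x)"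
    by (intro tendsto_add lim[OF A(1) L(1) A(3) B(1) D(1) C(2)[OF b c] mt[OF b c B(1-3) D]]
      lim[OF B(1) L(2) B(3) A(1) D(1) C(2)[OF a c] mt[OF a c A(1-3) D]]
      lim[OF D(1) L(3) D(3) A(1) B(1) C(2)[OF a b] mt[OF a b A(1-3) B]])
  then show ?thesis
    unfolding testfn_parts[OF \<Omega>(1) A(1) B(1) D(1)] by (simp add: LIMSEQ_const_iff)
qed

section \<open>Uniqueness of weak gradients\<close>

text \<open>Squaring removes the corner of the positive part at 0; the result is C^1, the smoothness
  that \<open>testfn\<close> demands.\<close>

lemma DERIV_pos_part_square:
  "((\<lambda>t::real. (max 0 t)\<^sup>2) has_real_derivative 2 * max 0 t) (at t)"
proof -
  consider "t < 0" | "t > 0" | "t = 0" by linarith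
  then show ?thesis
  proof cases
    case 1
    have "((\<lambda>t::real. 0) has_real_derivative 0) (at t)" by simp
    then have "((\<lambda>t::real. (max 0 t)\<^sup>2) has_real_derivative 0) (at t)"
      by (rule has_field_derivative_transform_within_open[where S = "{..<0}"]) (use 1 in auto)
    then show ?thesis using 1 by simp
  next
    case 2
    have "((\<lambda>t::real. t\<^sup>2) has_real_derivative 2 * t) (at t)"
      by (auto intro!: derivative_eq_intros)
    then have "((\<lambda>t::real. (max 0 t)\<^sup>2) has_real_derivative 2 * t) (at t)"
      by (rule has_field_derivative_transform_within_open[where S = "{0<..}"]) (use 2 in auto)
    then show ?thesis using 2 by simp
  next
    case 3
    have "(\<lambda>h::real. (max 0 h)\<^sup>2 / h) \<midarrow>0\<rightarrow> 0"
    proof (rule Lim_null_comparison)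
      show "((\<lambda>h::real. \<bar>h\<bar>) \<longlongrightarrow> 0) (at 0)" by (rule tendsto_rabs_zero) simp
      have "norm ((max 0 h)\<^sup>2 / h) \<le> \<bar>h\<bar>" for h :: real
        by (cases "h > 0") (auto simp: power2_eq_square max_def)
      then show "\<forall>\<^sub>F h::real in at 0. norm ((max 0 h)\<^sup>2 / h) \<le> \<bar>h\<bar>" by simp
    qed
    then show ?thesis unfolding DERIV_def 3 by simp
  qed
qed

text \<open>A C^1 bump that is polynomial on its ball and positive exactly there.\<close>

definition bump :: "real^'d \<Rightarrow> real \<Rightarrow> real^'d \<Rightarrow> real" where
  "bump c r x = (max 0 (r\<^sup>2 - (x - c) \<bullet> (x - c)))\<^sup>2"

lemma bump_pos_iff: "r > 0 \<Longrightarrow> bump c r x > 0 \<longleftrightarrow> x \<in> ball c r"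
proof -
  assume r: "r > 0"
  have "bump c r x > 0 \<longleftrightarrow> (norm (x - c))\<^sup>2 < r\<^sup>2"
    unfolding bump_def power2_norm_eq_inner by (auto simp: max_def)
  also have "\<dots> \<longleftrightarrow> norm (x - c) < r"
    using r by (metis less_imp_le norm_ge_zero power2_less_imp_less power_strict_mono zero_less_numeral)
  finally show ?thesis by (simp add: dist_norm norm_minus_commute)
qed

lemma testfn_bump:
  assumes "cball c r \<subseteq> \<Omega>" "r > 0"
  shows "testfn \<Omega> (bump c r)"
proof (rule testfnI[of _ _ "cball c r"])
  define D where "D x h = 2 * max 0 (r\<^sup>2 - (x - c) \<bullet> (x - c)) * - (2 * ((x - c) \<bullet> h))" for x h
  have d: "((\<lambda>x. r\<^sup>2 - (x - c) \<bullet> (x - c)) has_derivative (\<lambda>h. - (2 * ((x - c) \<bullet> h)))) (at x)" for x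
    by (auto intro!: derivative_eq_intros simp: inner_commute)
  show "(bump c r has_derivative D x) (at x)" for x
    using has_derivative_compose[OF d DERIV_pos_part_square[unfolded has_field_derivative_def]]
    unfolding bump_def[abs_def] D_def by simp
  show "continuous_on UNIV (\<lambda>x. D x (axis j 1))" for j
    unfolding D_def by (intro continuous_intros)
  fix x assume "x \<notin> cball c r"
  then have "\<not> bump c r x > 0" using bump_pos_iff[OF assms(2), of c x] by auto
  moreover have "bump c r x \<ge> 0" by (simp add: bump_def)
  ultimately show "bump c r x = 0" by linarith
qed (use assms in auto)

text \<open>U is a countable union of balls. A finite sum of bumps is a test function, and once n is
  large it is positive at a given point of U, while it is always zero off U. The profile 1 - exp(-n
  t) sends positive values to 1, fixes 0, and keeps the uniform bound 1 needed for dominated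
  convergence.\<close>

lemma testfn_approx_indicator:
  fixes U \<Omega> :: "(real^'d) set"
  assumes "open U" "U \<subseteq> \<Omega>"
  obtains \<phi> :: "nat \<Rightarrow> real^'d \<Rightarrow> real" where "\<And>n. testfn \<Omega> (\<phi> n)" "\<And>n x. \<bar>\<phi> n x\<bar> \<le> 1"
    "\<And>x. (\<lambda>n. \<phi> n x) \<longlonglongrightarrow> indicator U x"
proof (cases "U = {}")
  case True
  then show thesis by (intro that[of "\<lambda>n x. 0"]) (auto simp: testfn_zero)
next
  case False
  \<comment> \<open>The closed balls are required to lie in U, so that the bumps have compact
    support inside \<Omega>.\<close>
  define \<F> where "\<F> = {ball c r | c r. r > 0 \<and> cball c r \<subseteq> U}"
  have U: "\<Union>\<F> = U"
  proof
    show "\<Union>\<F> \<subseteq> U" unfolding \<F>_def using ball_subset_cball by fastforce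
    show "U \<subseteq> \<Union>\<F>"
    proof
      fix x assume "x \<in> U"
      then obtain r where "r > 0" "cball x r \<subseteq> U" using assms(1) open_contains_cball by metis
      then show "x \<in> \<Union>\<F>" unfolding \<F>_def by (auto intro!: exI[of _ "ball x r"])
    qed
  qed
  obtain \<G> where \<G>: "\<G> \<subseteq> \<F>" "countable \<G>" "\<Union>\<G> = U"
    using Lindelof[of \<F>] unfolding U unfolding \<F>_def by blast
  then have ne: "\<G> \<noteq> {}" using False by auto
  \<comment> \<open>\<open>from_nat_into\<close> enumerates finite and infinite countable families
    alike, with repetitions, provided they are nonempty; this is why the empty U was split
    off.\<close>
  have "\<exists>c r. from_nat_into \<G> k = ball c r \<and> r > 0 \<and> cball c r \<subseteq> U" for k
    using from_nat_into[OF ne, of k] \<G>(1) unfolding \<F>_def by blast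
  then obtain c r where cr: "\<And>k. from_nat_into \<G> k = ball (c k) (r k)" "\<And>k. r k > 0" "\<And>k. cball (c k) (r k) \<subseteq> U"
    by metis
  have Ueq: "U = (\<Union>k. ball (c k) (r k))"
    using \<G>(3) range_from_nat_into[OF ne \<G>(2)] cr(1) by (metis (no_types, lifting) SUP_cong image_image)
  define S where "S n x = (\<Sum>k<n. bump (c k) (r k) x)" for n x
  have S: "testfn \<Omega> (S n)" for n
    unfolding S_def using order_trans[OF cr(3) assms(2)] cr(2) by (intro testfn_sum testfn_bump) auto
  have S0: "S n x \<ge> 0" for n x unfolding S_def bump_def by (intro sum_nonneg) simp
  \<comment> \<open>where \<open>S\<close> is eventually positive, i.e. on \<open>U\<close>, the exponential tends to 0\<close>
  define \<phi> where "\<phi> n x = 1 - exp (- (real n * S n x))" for n x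
  show thesis
  proof (rule that[of \<phi>])
    fix n
    have d: "((\<lambda>t. 1 - exp (- (real n * t))) has_real_derivative real n * exp (- (real n * t))) (at t)" for t
      by (auto intro!: derivative_eq_intros)
    show "testfn \<Omega> (\<phi> n)"
      unfolding \<phi>_def by (rule testfn_compose(1)[OF S d]) (auto intro!: continuous_intros)
    show "\<bar>\<phi> n x\<bar> \<le> 1" for x
      using mult_nonneg_nonneg[OF of_nat_0_le_iff[of n] S0[of n x]] unfolding \<phi>_def by (simp add: abs_le_iff)
  next
    fix x
    show "(\<lambda>n. \<phi> n x) \<longlonglongrightarrow> indicator U x"
    proof (cases "x \<in> U")
      case True
      then obtain k0 where k0: "x \<in> ball (c k0) (r k0)" using Ueq by blast
      define b where "b = bump (c k0) (r k0) x"
      have b: "b > 0" unfolding b_def using bump_pos_iff[OF cr(2)] k0 by blast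
      \<comment> \<open>The sum runs over k < n, so the ball containing x contributes as soon as n
        exceeds k0.\<close>
      have le: "\<bar>\<phi> n x - 1\<bar> \<le> exp (- (real n * b))" if "n > k0" for n
      proof -
        have "b \<le> S n x"
          unfolding S_def b_def using that by (intro member_le_sum) (auto simp: bump_def)
        then have "real n * b \<le> real n * S n x" by (intro mult_left_mono) auto
        then show ?thesis unfolding \<phi>_def by simp
      qed
      have "(\<lambda>n. exp (- b) ^ n) \<longlonglongrightarrow> 0" by (rule LIMSEQ_realpow_zero) (use b in auto)
      then have "(\<lambda>n. exp (- (real n * b))) \<longlonglongrightarrow> 0" by (simp add: exp_of_nat_mult[symmetric])
      then have "(\<lambda>n. \<phi> n x - 1) \<longlonglongrightarrow> 0"
        by (rule Lim_null_comparison[rotated]) (use le in \<open>auto simp: eventually_at_top_dense\<close>)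
      then show ?thesis using True by (simp add: LIM_zero_iff)
    next
      case False
      have "bump (c k) (r k) x = 0" for k
      proof -
        have "\<not> bump (c k) (r k) x > 0" using False bump_pos_iff[OF cr(2)] Ueq by blast
        then show ?thesis unfolding bump_def by simp
      qed
      then have "\<phi> n x = 0" for n unfolding \<phi>_def S_def by simp
      then show ?thesis using False by simp
    qed
  qed
qed

text \<open>Open sets are closed under intersection and generate the Borel sets, so by Dynkin
  induction f integrates to zero over every Borel set, and an integrable density with this property
  vanishes almost everywhere.\<close>

lemma AE_zero_if_open_integrals_zero:
  fixes f :: "'a::euclidean_space \<Rightarrow> real"
  assumes f: "integrable lborel f" and zero: "\<And>U. open U \<Longrightarrow> (LINT x:U|lborel. f x) = 0"
  shows "AE x in lborel. f x = 0"
proof (rule sigma_finite_measure.density_zero[OF sigma_finite_lborel f])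
  fix A :: "'a set" assume "A \<in> sets lborel"
  then have A: "A \<in> sigma_sets UNIV {S. open S}" by (simp add: borel_def)
  have sb: "X \<in> sets lborel" if "X \<in> sigma_sets UNIV {S. open S}" for X :: "'a set"
    using that by (simp add: borel_def)
  have si: "set_integrable lborel X f" if "X \<in> sets lborel" for X
    unfolding set_integrable_def using integrable_mult_indicator[OF that f] .
  have "Int_stable {S :: 'a set. open S}" by (auto simp: Int_stable_def)
  moreover have "{S :: 'a set. open S} \<subseteq> Pow UNIV" by simp
  ultimately show "set_lebesgue_integral lborel A f = 0" using A
  proof (induction rule: sigma_sets_induct_disjoint)
    case (basic U)
    then show ?case using zero by simp
  next
    case empty
    show ?case by (simp add: set_lebesgue_integral_def)
  next
    \<comment> \<open>The whole space is open, so the total integral is zero and complements inherit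
      the property.\<close>
    case (compl X)
    have "(LINT x:UNIV|lborel. f x) = (LINT x:X \<union> (UNIV - X)|lborel. f x)" by simp
    also have "\<dots> = (LINT x:X|lborel. f x) + (LINT x:UNIV - X|lborel. f x)"
      using sb[OF compl(1)] by (intro set_integral_Un si) auto
    finally show ?case using compl(2) zero[of UNIV] by simp
  next
    case (union X)
    have X: "X i \<in> sets lborel" for i using union(2) by (intro sb) auto
    have disj: "X i \<inter> X j = {}" if "i \<noteq> j" for i j
      using union(1) that by (auto simp: disjoint_family_on_def)
    have "(\<Union>i. X i) \<in> sets lborel" using X by blast
    note XU = X si[OF this]
    have "(LINT x:(\<Union>i. X i)|lborel. f x) = (\<Sum>i. (LINT x:X i|lborel. f x))"
      by (rule lebesgue_integral_countable_add[OF XU(1) disj XU(2)])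
    then show ?case using union(3) by simp
  qed
qed

text \<open>Testing with approximations of an indicator gives zero integral over every open subset
  of \<Omega>, by dominated convergence with majorant |g|. Extension by zero then reduces the claim
  to the case of the whole space.\<close>

lemma fundamental_lemma_variations:
  fixes \<Omega> :: "(real^'d) set"
  assumes \<Omega>: "open \<Omega>" and g: "integrable (lebesgue_on \<Omega>) g"
    and zero: "\<And>\<phi>. testfn \<Omega> \<phi> \<Longrightarrow> (\<integral>x. g x * \<phi> x \<partial>lebesgue_on \<Omega>) = 0"
  shows "AE x in lebesgue_on \<Omega>. g x = (0::real)"
proof -
  have m: "\<Omega> \<in> sets lebesgue" using \<Omega> by simp
  have [measurable]: "g \<in> borel_measurable (lebesgue_on \<Omega>)" using g by auto
  have openzero: "(\<integral>x. g x * indicator U x \<partial>lebesgue_on \<Omega>) = 0" if U: "open U" "U \<subseteq> \<Omega>" for U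
  proof -
    obtain \<phi> :: "nat \<Rightarrow> real^'d \<Rightarrow> real" where \<phi>: "\<And>n. testfn \<Omega> (\<phi> n)" "\<And>n x. \<bar>\<phi> n x\<bar> \<le> 1"
      "\<And>x. (\<lambda>n. \<phi> n x) \<longlonglongrightarrow> indicator U x"
      by (rule testfn_approx_indicator[OF U], rule that)
    have [measurable]: "\<phi> n \<in> borel_measurable (lebesgue_on \<Omega>)" for n
      using testfn_borel(1)[OF \<phi>(1)] by (rule borel_imp_lebesgue_on)
    have [measurable]: "(indicator U :: real^'d \<Rightarrow> real) \<in> borel_measurable (lebesgue_on \<Omega>)"
      using U(1) by (intro borel_imp_lebesgue_on) simp
    have "(\<lambda>n. \<integral>x. g x * \<phi> n x \<partial>lebesgue_on \<Omega>) \<longlonglongrightarrow> (\<integral>x. g x * indicator U x \<partial>lebesgue_on \<Omega>)"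
    proof (rule integral_dominated_convergence[where w = "\<lambda>x. \<bar>g x\<bar>"])
      show "AE x in lebesgue_on \<Omega>. (\<lambda>n. g x * \<phi> n x) \<longlonglongrightarrow> g x * indicator U x"
        by (intro AE_I2 tendsto_intros \<phi>(3))
      show "AE x in lebesgue_on \<Omega>. norm (g x * \<phi> n x) \<le> \<bar>g x\<bar>" for n
        using \<phi>(2) by (intro AE_I2) (simp add: abs_mult mult_left_le)
    qed (use g in auto)
    then show ?thesis using zero[OF \<phi>(1)] by (simp add: LIMSEQ_const_iff)
  qed
  define f where "f x = indicator \<Omega> x * g x" for x
  have f: "integrable lebesgue f"
    using g m unfolding f_def by (simp add: integrable_restrict_space)
  \<comment> \<open>f is only Lebesgue measurable, whereas the Dynkin argument runs on Borel sets; a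
    Borel representative mediates between the two.\<close>
  then obtain f' where f': "f' \<in> borel_measurable lborel" "AE x in lborel. f x = f' x"
    using completion_ex_borel_measurable_real[of f lborel] by auto
  have eq: "AE x in lebesgue. f x = f' x" using f'(2) by (rule AE_completion)
  have f'm: "f' \<in> borel_measurable lebesgue" using f'(1) by (simp add: measurable_completion)
  have "integrable lebesgue f'"
    by (rule integrable_cong_AE_imp[OF f f'm]) (use eq in auto)
  then have f'i: "integrable lborel f'" using f'(1) by (simp add: integrable_completion)
  have "AE x in lborel. f' x = 0"
  proof (rule AE_zero_if_open_integrals_zero[OF f'i])
    fix U :: "(real^'d) set" assume U: "open U"
    have [measurable]: "(indicator U :: real^'d \<Rightarrow> real) \<in> borel_measurable lborel" using U by simp
    have "(LINT x:U|lborel. f' x) = (\<integral>x. indicator U x * f' x \<partial>lebesgue)"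
      unfolding set_lebesgue_integral_def using f'(1) by (subst integral_completion) auto
    also have "\<dots> = (\<integral>x. indicator U x * f x \<partial>lebesgue)"
    proof (rule integral_cong_AE)
      have i: "(indicator U :: real^'d \<Rightarrow> real) \<in> borel_measurable lebesgue"
        using U by (intro borel_measurable_indicator) simp
      show "(\<lambda>x. indicator U x * f' x) \<in> borel_measurable lebesgue" "(\<lambda>x. indicator U x * f x) \<in> borel_measurable lebesgue"
        using f'm f i by (intro borel_measurable_times; auto)+
    qed (use eq in auto)
    also have "\<dots> = (\<integral>x. g x * indicator (U \<inter> \<Omega>) x \<partial>lebesgue_on \<Omega>)"
    proof -
      have "(\<lambda>x. indicat_real \<Omega> x * (g x * indicator (U \<inter> \<Omega>) x)) = (\<lambda>x. indicator U x * f x)"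
        by (auto simp: f_def indicator_def)
      then show ?thesis using m by (simp add: integral_restrict_space)
    qed
    also have "\<dots> = 0" using U \<Omega> by (intro openzero) auto
    finally show "(LINT x:U|lborel. f' x) = 0" .
  qed
  then have "AE x in lebesgue. f' x = 0" by (rule AE_completion)
  with eq have "AE x in lebesgue. x \<in> \<Omega> \<longrightarrow> g x = 0"
    by eventually_elim (auto simp: f_def)
  then show ?thesis using m by (simp add: AE_restrict_space_iff)
qed

section \<open>The convective form on the velocity space\<close>

lemma set_integral_eq_lebesgue_on:
  fixes g :: "real^'d \<Rightarrow> real"
  assumes "\<Omega> \<in> sets lebesgue"
  shows "(LINT x:\<Omega>|lebesgue. g x) = (\<integral>x. g x \<partial>lebesgue_on \<Omega>)"
  unfolding set_lebesgue_integral_def using assms by (simp add: integral_restrict_space)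

lemma L2_vecI:
  fixes u :: "real^'d \<Rightarrow> 'b::euclidean_space^'n"
  assumes \<Omega>: "\<Omega> \<in> sets lebesgue" and u: "\<And>i. L2 \<Omega> (\<lambda>x. u x $ i)"
  shows "L2 \<Omega> u"
proof -
  have m: "(\<lambda>x. u x $ i) \<in> borel_measurable (lebesgue_on \<Omega>)"
    and int: "integrable (lebesgue_on \<Omega>) (\<lambda>x. (norm (u x $ i))\<^sup>2)" for i
    using u[of i] unfolding L2_iff[OF \<Omega>] by blast+
  have "u \<in> borel_measurable (lebesgue_on \<Omega>)"
  proof (rule borel_measurable_euclidean_space[THEN iffD2], intro ballI)
    fix b :: "'b^'n" assume "b \<in> Basis"
    then obtain i c where "b = axis i c" by (auto simp: Basis_vec_def)
    then show "(\<lambda>x. u x \<bullet> b) \<in> borel_measurable (lebesgue_on \<Omega>)"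
      using borel_measurable_inner[OF m[of i] borel_measurable_const[of c]] by (simp add: inner_axis)
  qed
  moreover have "(norm (u x))\<^sup>2 = (\<Sum>i\<in>UNIV. (norm (u x $ i))\<^sup>2)" for x
    unfolding norm_vec_def L2_set_def by (simp add: sum_nonneg)
  ultimately show ?thesis unfolding L2_iff[OF \<Omega>] using int by simp
qed

lemma jac_nth: "jac \<Psi> x $ i = pgrad (\<lambda>y. \<Psi> y $ i) x"
  unfolding jac_def pgrad_def by simp

lemma testvfield_L2:
  assumes "\<Omega> \<in> sets lebesgue" "testvfield \<Omega> \<Psi>"
  shows "L2 \<Omega> \<Psi>" "L2 \<Omega> (jac \<Psi>)"
proof -
  have t: "testfn \<Omega> (\<lambda>x. \<Psi> x $ i)" for i using assms(2) unfolding testvfield_def by blast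
  show "L2 \<Omega> \<Psi>" by (rule L2_vecI[OF assms(1) testfn_L2(1)[OF assms(1) t]])
  show "L2 \<Omega> (jac \<Psi>)"
    by (rule L2_vecI[OF assms(1)]) (use testfn_L2(2)[OF assms(1) t] in \<open>simp add: jac_nth\<close>)
qed

lemma Xsp_L2:
  assumes "u \<in> Xsp \<Omega>"
  shows "L2 \<Omega> u" "L2 \<Omega> (grad \<Omega> u)" "weak_grad \<Omega> u (grad \<Omega> u)"
proof -
  have H: "H1 \<Omega> u" using assms unfolding Xsp_def by blast
  then show "L2 \<Omega> u" unfolding H1_def by blast
  have "\<exists>G. L2 \<Omega> G \<and> weak_grad \<Omega> u G" using H unfolding H1_def by blast
  then have "L2 \<Omega> (grad \<Omega> u) \<and> weak_grad \<Omega> u (grad \<Omega> u)"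
    unfolding grad_def by (rule someI_ex)
  then show "L2 \<Omega> (grad \<Omega> u)" "weak_grad \<Omega> u (grad \<Omega> u)" by auto
qed

text \<open>The components of the vector fields approximating u approximate the components of u,
  since a component norm never exceeds the norm of the field. All scalar results thereby apply to
  velocities.\<close>

lemma Xsp_H10:
  fixes \<Omega> :: "(real^'d) set"
  assumes \<Omega>: "\<Omega> \<in> sets lebesgue" and u: "u \<in> Xsp \<Omega>"
  shows "H10 \<Omega> (\<lambda>x. u x $ i) (\<lambda>x. grad \<Omega> u x $ i)"
proof -
  obtain \<Psi> :: "nat \<Rightarrow> 'd vfield" where \<Psi>: "\<And>k. testvfield \<Omega> (\<Psi> k)"
    "(\<lambda>k. l2norm \<Omega> (\<lambda>x. \<Psi> k x - u x)) \<longlonglongrightarrow> 0"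
    "(\<lambda>k. l2norm \<Omega> (\<lambda>x. jac (\<Psi> k) x - grad \<Omega> u x)) \<longlonglongrightarrow> 0"
    using u unfolding Xsp_def by blast
  note L = Xsp_L2[OF u] and \<Psi>L = testvfield_L2[OF \<Omega> \<Psi>(1)]
  have "(\<lambda>k. l2norm \<Omega> (\<lambda>x. \<Psi> k x $ i - u x $ i)) \<longlonglongrightarrow> 0"
    by (rule Lim_null_comparison[OF _ \<Psi>(2)])
       (use L2_nth(2)[OF \<Omega> L2_diff[OF \<Omega> \<Psi>L(1) L(1)], of _ i] in \<open>simp add: l2norm_power2(2)[OF \<Omega>]\<close>)
  moreover have "(\<lambda>k. l2norm \<Omega> (\<lambda>x. pgrad (\<lambda>y. \<Psi> k y $ i) x - grad \<Omega> u x $ i)) \<longlonglongrightarrow> 0"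
    by (rule Lim_null_comparison[OF _ \<Psi>(3)])
       (use L2_nth(2)[OF \<Omega> L2_diff[OF \<Omega> \<Psi>L(2) L(2)], of _ i] in \<open>simp add: l2norm_power2(2)[OF \<Omega>] jac_nth\<close>)
  moreover have "testfn \<Omega> (\<lambda>x. \<Psi> k x $ i)" for k using \<Psi>(1) unfolding testvfield_def by blast
  ultimately show ?thesis
    unfolding H10_def using L2_nth(1)[OF \<Omega> L(1)] L2_nth(1)[OF \<Omega> L(2)]
    by (intro conjI exI[of _ "\<lambda>k x. \<Psi> k x $ i"]) simp_all
qed

section \<open>Additivity of the selected gradient up to null sets\<close>

lemma L2_const: "\<Omega> \<in> sets lebesgue \<Longrightarrow> bounded \<Omega> \<Longrightarrow> L2 \<Omega> (\<lambda>x. c)"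
proof -
  assume \<Omega>: "\<Omega> \<in> sets lebesgue" "bounded \<Omega>"
  then have "\<Omega> \<in> lmeasurable" by (simp add: bounded_set_imp_lmeasurable)
  then have "integrable (lebesgue_on \<Omega>) (\<lambda>x. (norm c)\<^sup>2)" 
    by (intro finite_measure.integrable_const finite_measure_lebesgue_on)
  then show ?thesis unfolding L2_iff[OF \<Omega>(1)] by simp
qed

text \<open>Every entry of the difference is orthogonal to all test functions. It is integrable, as
  pairing with the constant 1 on a bounded domain shows, so the fundamental lemma applies.\<close>

lemma weak_grad_unique:
  fixes \<Omega> :: "(real^'d) set"
  assumes \<Omega>: "open \<Omega>" "bounded \<Omega>" and L: "L2 \<Omega> G" "L2 \<Omega> H" and w: "weak_grad \<Omega> u G" "weak_grad \<Omega> u H"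
  shows "AE x in lebesgue_on \<Omega>. G x = H x"
proof -
  have m: "\<Omega> \<in> sets lebesgue" using \<Omega> by simp
  have "AE x in lebesgue_on \<Omega>. G x $ i $ j - H x $ i $ j = 0" for i j
  proof (rule fundamental_lemma_variations[OF \<Omega>(1)])
    note Lij = L2_nth(1)[OF m L2_nth(1)[OF m L(1)], of i j] L2_nth(1)[OF m L2_nth(1)[OF m L(2)], of i j]
    show "integrable (lebesgue_on \<Omega>) (\<lambda>x. G x $ i $ j - H x $ i $ j)"
      using L2_inner(3)[OF m L2_diff[OF m Lij] L2_const[OF m \<Omega>(2), of "1::real"]] by simp
    fix \<phi> assume \<phi>: "testfn \<Omega> \<phi>"
    note i = L2_inner(3)[OF m Lij(1) testfn_L2(1)[OF m \<phi>]] L2_inner(3)[OF m Lij(2) testfn_L2(1)[OF m \<phi>]]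
    have "(\<integral>x. G x $ i $ j * \<phi> x \<partial>lebesgue_on \<Omega>) = (\<integral>x. H x $ i $ j * \<phi> x \<partial>lebesgue_on \<Omega>)"
      using w \<phi> unfolding weak_grad_def set_integral_eq_lebesgue_on[OF m] by force
    then show "(\<integral>x. (G x $ i $ j - H x $ i $ j) * \<phi> x \<partial>lebesgue_on \<Omega>) = 0"
      using i by (simp add: left_diff_distrib right_diff_distrib mult.commute)
  qed
  then have "AE x in lebesgue_on \<Omega>. \<forall>i j. G x $ i $ j - H x $ i $ j = 0"
    by (simp add: AE_all_countable)
  then show ?thesis by eventually_elim (simp add: vec_eq_iff)
qed

lemma weak_grad_diff:
  fixes \<Omega> :: "(real^'d) set"
  assumes m: "\<Omega> \<in> sets lebesgue" and L: "L2 \<Omega> u" "L2 \<Omega> v" "L2 \<Omega> G" "L2 \<Omega> H"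
    and w: "weak_grad \<Omega> u G" "weak_grad \<Omega> v H"
  shows "weak_grad \<Omega> (\<lambda>x. u x - v x) (\<lambda>x. G x - H x)"
  unfolding weak_grad_def set_integral_eq_lebesgue_on[OF m]
proof (intro allI impI)
  fix \<phi> i j assume \<phi>: "testfn \<Omega> \<phi>"
  have d: "L2 \<Omega> (\<lambda>x. pderiv \<phi> j x)" using L2_nth(1)[OF m testfn_L2(2)[OF m \<phi>], of j] by (simp add: pgrad_def)
  note i1 = L2_inner(3)[OF m L2_nth(1)[OF m L(1)] d, of i] L2_inner(3)[OF m L2_nth(1)[OF m L(2)] d, of i]
  note i2 = L2_inner(3)[OF m L2_nth(1)[OF m L2_nth(1)[OF m L(3)]] testfn_L2(1)[OF m \<phi>], of i j]
    L2_inner(3)[OF m L2_nth(1)[OF m L2_nth(1)[OF m L(4)]] testfn_L2(1)[OF m \<phi>], of i j]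
  have "(\<integral>x. u x $ i * pderiv \<phi> j x \<partial>lebesgue_on \<Omega>) = - (\<integral>x. G x $ i $ j * \<phi> x \<partial>lebesgue_on \<Omega>)"
    "(\<integral>x. v x $ i * pderiv \<phi> j x \<partial>lebesgue_on \<Omega>) = - (\<integral>x. H x $ i $ j * \<phi> x \<partial>lebesgue_on \<Omega>)"
    using w \<phi> unfolding weak_grad_def set_integral_eq_lebesgue_on[OF m] by blast+
  then show "(\<integral>x. (u x - v x) $ i * pderiv \<phi> j x \<partial>lebesgue_on \<Omega>) = - (\<integral>x. (G x - H x) $ i $ j * \<phi> x \<partial>lebesgue_on \<Omega>)"
    using i1 i2 by (simp add: left_diff_distrib right_diff_distrib mult.commute)
qed

text \<open>\<open>grad\<close> is a choice, so the gradient of a difference need not equal the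
  difference of gradients pointwise. Both are weak gradients of the same field, and the norm does
  not see null sets.\<close>

lemma gradnorm_diff:
  fixes \<Omega> :: "(real^'d) set"
  assumes \<Omega>: "open \<Omega>" "bounded \<Omega>" and u: "u \<in> Xsp \<Omega>" and v: "v \<in> Xsp \<Omega>" and w: "(\<lambda>x. u x - v x) \<in> Xsp \<Omega>"
  shows "l2norm \<Omega> (\<lambda>x. grad \<Omega> u x - grad \<Omega> v x) = gradnorm \<Omega> (\<lambda>x. u x - v x)"
proof -
  have m: "\<Omega> \<in> sets lebesgue" using \<Omega> by simp
  note uL = Xsp_L2[OF u] and vL = Xsp_L2[OF v] and wL = Xsp_L2[OF w]
  have D: "L2 \<Omega> (\<lambda>x. grad \<Omega> u x - grad \<Omega> v x)" by (rule L2_diff[OF m uL(2) vL(2)])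
  have ae: "AE x in lebesgue_on \<Omega>. grad \<Omega> u x - grad \<Omega> v x = grad \<Omega> (\<lambda>x. u x - v x) x"
    by (rule weak_grad_unique[OF \<Omega> D wL(2) weak_grad_diff[OF m uL(1) vL(1) uL(2) vL(2) uL(3) vL(3)] wL(3)])
  have [measurable]: "(\<lambda>x. grad \<Omega> u x - grad \<Omega> v x) \<in> borel_measurable (lebesgue_on \<Omega>)"
    "grad \<Omega> (\<lambda>x. u x - v x) \<in> borel_measurable (lebesgue_on \<Omega>)"
    using D wL(2) unfolding L2_iff[OF m] by blast+
  have "(\<integral>x. (norm (grad \<Omega> u x - grad \<Omega> v x))\<^sup>2 \<partial>lebesgue_on \<Omega>)
      = (\<integral>x. (norm (grad \<Omega> (\<lambda>x. u x - v x) x))\<^sup>2 \<partial>lebesgue_on \<Omega>)"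
    by (rule integral_cong_AE) (use ae in auto)
  then show ?thesis unfolding gradnorm_def l2norm_power2(3)[OF m] by simp
qed

text \<open>Square-integrability of the products makes every scalar summand integrable, which
  justifies exchanging the sums with the integral.\<close>

lemma convective_form_eq:
  fixes \<Omega> :: "(real^'d) set" and G :: "real^'d \<Rightarrow> real^'d^'d"
  assumes m: "\<Omega> \<in> sets lebesgue" and G: "L2 \<Omega> G" and uw: "\<And>i j. L2 \<Omega> (\<lambda>x. u x $ j * w x $ i)"
  shows "(LINT x:\<Omega>|lebesgue. (G x *v u x) \<bullet> w x)
    = (\<Sum>i\<in>UNIV. \<Sum>j\<in>UNIV. l2inner \<Omega> (\<lambda>x. G x $ i $ j) (\<lambda>x. u x $ j * w x $ i))"
proof -
  have "(G x *v u x) \<bullet> w x = (\<Sum>i\<in>UNIV. \<Sum>j\<in>UNIV. G x $ i $ j \<bullet> (u x $ j * w x $ i))" for x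
    unfolding inner_vec_def matrix_vector_mult_def by (simp add: sum_distrib_left sum_distrib_right mult_ac)
  then show ?thesis
    unfolding set_integral_eq_lebesgue_on[OF m] l2inner_eq[OF m]
    using L2_inner(3)[OF m L2_nth(1)[OF m L2_nth(1)[OF m G]] uw] by simp
qed

text \<open>With v = w - L, each pair of indices contributes two kinds of terms, a derivative of w
  times L v and a derivative of L times v w. In both, v is undifferentiated inside a product, where
  the interpolated norm is available.\<close>

lemma bstar_bound:
  fixes \<Omega> :: "(real^'d) set"
  assumes dim: "CARD('d) = 2 \<or> CARD('d) = 3" and \<Omega>: "open \<Omega>" "bounded \<Omega>"
  obtains C where "C > 0" "\<And>L w. L \<in> Xsp \<Omega> \<Longrightarrow> w \<in> Xsp \<Omega> \<Longrightarrow> (\<lambda>x. w x - L x) \<in> Xsp \<Omega> \<Longrightarrow>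
    \<bar>bstar \<Omega> L L w\<bar> \<le> C * gradnorm \<Omega> L * gradnorm \<Omega> w
      * sqrt (l2norm \<Omega> (\<lambda>x. w x - L x) * gradnorm \<Omega> (\<lambda>x. w x - L x))"
proof -
  have m: "\<Omega> \<in> sets lebesgue" using \<Omega> by simp
  note nn = l2norm_power2(2)[OF m]
  obtain C where C: "C > 0"
    "\<And>a g b h. H10 \<Omega> a g \<Longrightarrow> H10 \<Omega> b h \<Longrightarrow> L2 \<Omega> (\<lambda>x. a x * b x)"
    "\<And>a g b h. H10 \<Omega> a g \<Longrightarrow> H10 \<Omega> b h \<Longrightarrow>
       l2norm \<Omega> (\<lambda>x. a x * b x) \<le> C * l2norm \<Omega> g * sqrt (l2norm \<Omega> b * l2norm \<Omega> h)"
    by (rule H10_product[OF dim m \<Omega>(2)], rule that)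
  define d where "d = real CARD('d)"
  show thesis
  \<comment> \<open>Three terms per pair of indices, d^2 pairs, and the factor 1/2 of the
    skew-symmetric form.\<close>
  proof (rule that[of "3 / 2 * C * d\<^sup>2"])
    show "3 / 2 * C * d\<^sup>2 > 0" using C(1) by (simp add: d_def)
    fix L w assume L: "L \<in> Xsp \<Omega>" and w: "w \<in> Xsp \<Omega>" and v': "(\<lambda>x. w x - L x) \<in> Xsp \<Omega>"
    define v where "v x = w x - L x" for x
    define GL where "GL = grad \<Omega> L"
    define Gw where "Gw = grad \<Omega> w"
    define Gv where "Gv x = Gw x - GL x" for x
    define s where "s = sqrt (l2norm \<Omega> v * gradnorm \<Omega> v)"
    have HL: "H10 \<Omega> (\<lambda>x. L x $ i) (\<lambda>x. GL x $ i)" and Hw: "H10 \<Omega> (\<lambda>x. w x $ i) (\<lambda>x. Gw x $ i)" for i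
      unfolding GL_def Gw_def by (rule Xsp_H10[OF m L], rule Xsp_H10[OF m w])
    have Hv: "H10 \<Omega> (\<lambda>x. v x $ i) (\<lambda>x. Gv x $ i)" for i
      using H10_diff[OF m Hw[of i] HL[of i]] unfolding v_def Gv_def by simp
    have LG: "L2 \<Omega> GL" "L2 \<Omega> Gw" "L2 \<Omega> Gv" "L2 \<Omega> v" "L2 \<Omega> L"
      using Xsp_L2[OF L] Xsp_L2[OF w] L2_diff[OF m] unfolding GL_def Gw_def Gv_def[abs_def] v_def[abs_def] by auto
    \<comment> \<open>\<open>Gv\<close> is the difference of the selected gradients, so the algebra
      below holds pointwise; only its norm is identified with that of the gradient of v.\<close>
    have nGv: "l2norm \<Omega> Gv = gradnorm \<Omega> v"
      using gradnorm_diff[OF \<Omega> w L v'] unfolding Gv_def[abs_def] Gw_def GL_def v_def[abs_def] .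
    note LLw = C(2)[OF HL Hw] and LLL = C(2)[OF HL HL] and LLv = C(2)[OF HL Hv] and Lvw = C(2)[OF Hv Hw]
    have sv: "sqrt (l2norm \<Omega> (\<lambda>x. v x $ i) * l2norm \<Omega> (\<lambda>x. Gv x $ i)) \<le> s" for i
      unfolding s_def nGv[symmetric]
      by (intro real_sqrt_le_mono mult_mono L2_nth(2)[OF m] LG nn)
    have bLv: "l2norm \<Omega> (\<lambda>x. L x $ j * v x $ i) \<le> C * l2norm \<Omega> GL * s" for i j
    proof -
      have "C * l2norm \<Omega> (\<lambda>x. GL x $ j) * sqrt (l2norm \<Omega> (\<lambda>x. v x $ i) * l2norm \<Omega> (\<lambda>x. Gv x $ i)) \<le> C * l2norm \<Omega> GL * s"
        using C(1) sv by (intro mult_mono L2_nth(2)[OF m] LG nn mult_nonneg_nonneg real_sqrt_ge_zero) auto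
      then show ?thesis using C(3)[OF HL Hv, of j i] by linarith
    qed
    have bwv: "l2norm \<Omega> (\<lambda>x. v x $ i * w x $ i) \<le> C * l2norm \<Omega> Gw * s" for i
    proof -
      have "C * l2norm \<Omega> (\<lambda>x. Gw x $ i) * sqrt (l2norm \<Omega> (\<lambda>x. v x $ i) * l2norm \<Omega> (\<lambda>x. Gv x $ i)) \<le> C * l2norm \<Omega> Gw * s"
        using C(1) sv by (intro mult_mono L2_nth(2)[OF m] LG nn mult_nonneg_nonneg real_sqrt_ge_zero) auto
      then show ?thesis using C(3)[OF Hw Hv, of i i] by (simp add: mult.commute)
    qed
    define T where "T i j = l2inner \<Omega> (\<lambda>x. GL x $ i $ j) (\<lambda>x. L x $ j * w x $ i)
        - l2inner \<Omega> (\<lambda>x. Gw x $ i $ j) (\<lambda>x. L x $ j * L x $ i)" for i j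
    have comp: "L2 \<Omega> (\<lambda>x. GL x $ i $ j)" "L2 \<Omega> (\<lambda>x. Gw x $ i $ j)" "L2 \<Omega> (\<lambda>x. Gv x $ i $ j)" for i j
      using L2_nth(1)[OF m L2_nth(1)[OF m LG(1)]] L2_nth(1)[OF m L2_nth(1)[OF m LG(2)]] L2_nth(1)[OF m L2_nth(1)[OF m LG(3)]]
      by auto
    have ncomp: "l2norm \<Omega> (\<lambda>x. G x $ i $ j) \<le> l2norm \<Omega> G" if "L2 \<Omega> G" for G :: "real^'d \<Rightarrow> real^'d^'d" and i j
      using L2_nth(2)[OF m that, of i] L2_nth(2)[OF m L2_nth(1)[OF m that], of i j] by linarith
    \<comment> \<open>\<open>H10_parts\<close> trades the derivative of \<open>v\<close> for one of \<open>w\<close> and one of \<open>L\<close>\<close>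
    have T: "\<bar>T i j\<bar> \<le> 3 * C * l2norm \<Omega> GL * l2norm \<Omega> Gw * s" for i j
    proof -
      have 1: "l2inner \<Omega> (\<lambda>x. GL x $ i $ j) (\<lambda>x. L x $ j * w x $ i)
         = l2inner \<Omega> (\<lambda>x. Gw x $ i $ j) (\<lambda>x. L x $ j * w x $ i) - l2inner \<Omega> (\<lambda>x. Gv x $ i $ j) (\<lambda>x. L x $ j * w x $ i)"
        using l2inner_diff_left[OF m comp(2)[of i j] comp(3)[of i j] LLw[of j i]] by (simp add: Gv_def)
      have 2: "l2inner \<Omega> (\<lambda>x. Gw x $ i $ j) (\<lambda>x. L x $ j * L x $ i)
         = l2inner \<Omega> (\<lambda>x. Gw x $ i $ j) (\<lambda>x. L x $ j * w x $ i) - l2inner \<Omega> (\<lambda>x. Gw x $ i $ j) (\<lambda>x. L x $ j * v x $ i)"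
        using l2inner_diff_right[OF m LLw[of j i] LLv[of j i] comp(2)[of i j]] by (simp add: v_def algebra_simps)
      have 3: "l2inner \<Omega> (\<lambda>x. GL x $ j $ j) (\<lambda>x. v x $ i * w x $ i) + l2inner \<Omega> (\<lambda>x. Gv x $ i $ j) (\<lambda>x. L x $ j * w x $ i)
         + l2inner \<Omega> (\<lambda>x. Gw x $ i $ j) (\<lambda>x. L x $ j * v x $ i) = 0"
        by (rule H10_parts[OF dim m \<Omega>(2) HL Hv Hw])
      \<comment> \<open>The terms pairing the derivative of w with L w cancel, which is b*(L, w, w)
        = 0 for one pair of indices; equation 3 then eliminates the derivative of v.\<close>
      have "T i j = 2 * l2inner \<Omega> (\<lambda>x. Gw x $ i $ j) (\<lambda>x. L x $ j * v x $ i)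
          + l2inner \<Omega> (\<lambda>x. GL x $ j $ j) (\<lambda>x. v x $ i * w x $ i)"
        unfolding T_def 1 2 using 3 by linarith
      moreover have "\<bar>l2inner \<Omega> (\<lambda>x. Gw x $ i $ j) (\<lambda>x. L x $ j * v x $ i)\<bar> \<le> l2norm \<Omega> Gw * (C * l2norm \<Omega> GL * s)"
        by (rule order_trans[OF L2_inner(4)[OF m comp(2) LLv] mult_mono[OF ncomp[OF LG(2)] bLv nn nn]])
      moreover have "\<bar>l2inner \<Omega> (\<lambda>x. GL x $ j $ j) (\<lambda>x. v x $ i * w x $ i)\<bar> \<le> l2norm \<Omega> GL * (C * l2norm \<Omega> Gw * s)"
        by (rule order_trans[OF L2_inner(4)[OF m comp(1) Lvw] mult_mono[OF ncomp[OF LG(1)] bwv nn nn]])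
      ultimately have "\<bar>T i j\<bar> \<le> 2 * (l2norm \<Omega> Gw * (C * l2norm \<Omega> GL * s)) + l2norm \<Omega> GL * (C * l2norm \<Omega> Gw * s)"
        by linarith
      then show ?thesis by (simp add: mult_ac)
    qed
    have "bstar \<Omega> L L w = 1/2 * (\<Sum>i\<in>UNIV. \<Sum>j\<in>UNIV. T i j)"
      unfolding bstar_def T_def GL_def[symmetric] Gw_def[symmetric]
        convective_form_eq[OF m LG(1) LLw] convective_form_eq[OF m LG(2) LLL]
      by (simp add: sum_subtractf algebra_simps)
    moreover have "\<bar>\<Sum>i\<in>UNIV. \<Sum>j\<in>UNIV. T i j\<bar> \<le> d * (d * (3 * C * l2norm \<Omega> GL * l2norm \<Omega> Gw * s))"
    proof -
      have "\<bar>\<Sum>i\<in>UNIV. \<Sum>j\<in>UNIV. T i j\<bar> \<le> (\<Sum>i\<in>(UNIV::'d set). \<Sum>j\<in>(UNIV::'d set). 3 * C * l2norm \<Omega> GL * l2norm \<Omega> Gw * s)"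
        by (rule order_trans[OF sum_abs], rule sum_mono, rule order_trans[OF sum_abs], rule sum_mono, rule T)
      then show ?thesis by (simp add: d_def)
    qed
    ultimately have "\<bar>bstar \<Omega> L L w\<bar> \<le> 3 / 2 * C * d\<^sup>2 * l2norm \<Omega> GL * l2norm \<Omega> Gw * s"
      by (simp add: abs_mult power2_eq_square mult_ac)
    then show "\<bar>bstar \<Omega> L L w\<bar> \<le> 3 / 2 * C * d\<^sup>2 * gradnorm \<Omega> L * gradnorm \<Omega> w
      * sqrt (l2norm \<Omega> (\<lambda>x. w x - L x) * gradnorm \<Omega> (\<lambda>x. w x - L x))"
      unfolding s_def v_def[abs_def] GL_def Gw_def gradnorm_def .
  qed
qed

text \<open>A real supremum bounds its elements only if the set is bounded above, which
  Cauchy-Schwarz and Poincare ensure for square-integrable f.\<close>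

lemma hm1norm_bound:
  fixes \<Omega> :: "(real^'d) set"
  assumes \<Omega>: "open \<Omega>" "bounded \<Omega>" and f: "L2 \<Omega> f" and v: "v \<in> Xsp \<Omega>"
  shows "l2inner \<Omega> f v \<le> hm1norm \<Omega> f * gradnorm \<Omega> v"
proof -
  have m: "\<Omega> \<in> sets lebesgue" using \<Omega> by simp
  note nn = l2norm_power2(2)[OF m]
  obtain C where C: "C > 0" "\<And>a g. H10 \<Omega> a g \<Longrightarrow> l2norm \<Omega> a \<le> C * l2norm \<Omega> g"
    by (rule H10_Poincare[OF m \<Omega>(2)], rule that)
  define d where "d = real CARD('d)"
  define K where "K = l2norm \<Omega> f * (d * C)"
  have P: "l2norm \<Omega> u \<le> d * C * gradnorm \<Omega> u" if u: "u \<in> Xsp \<Omega>" for u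
  proof -
    have "(l2norm \<Omega> u)\<^sup>2 = (\<Sum>i\<in>UNIV. (l2norm \<Omega> (\<lambda>x. u x $ i))\<^sup>2)"
    proof -
      have "(norm (u x))\<^sup>2 = (\<Sum>i\<in>UNIV. (norm (u x $ i))\<^sup>2)" for x
        unfolding norm_vec_def L2_set_def by (simp add: sum_nonneg)
      moreover have "integrable (lebesgue_on \<Omega>) (\<lambda>x. (norm (u x $ i))\<^sup>2)" for i
        using L2_nth(1)[OF m Xsp_L2(1)[OF u], of i] unfolding L2_iff[OF m] by blast
      ultimately show ?thesis unfolding l2norm_power2(1)[OF m] by simp
    qed
    also have "\<dots> \<le> (\<Sum>i\<in>(UNIV::'d set). (C * gradnorm \<Omega> u)\<^sup>2)"
    proof (intro sum_mono power_mono nn)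
      fix i
      have "C * l2norm \<Omega> (\<lambda>x. grad \<Omega> u x $ i) \<le> C * gradnorm \<Omega> u"
        unfolding gradnorm_def using C(1) by (intro mult_left_mono L2_nth(2)[OF m Xsp_L2(2)[OF u]]) auto
      then show "l2norm \<Omega> (\<lambda>x. u x $ i) \<le> C * gradnorm \<Omega> u"
        using C(2)[OF Xsp_H10[OF m u, of i]] by linarith
    qed
    also have "\<dots> = d * (C * gradnorm \<Omega> u)\<^sup>2" by (simp add: d_def)
    also have "\<dots> \<le> d\<^sup>2 * (C * gradnorm \<Omega> u)\<^sup>2"
    proof (rule mult_right_mono)
      have "d \<ge> 1" unfolding d_def by (simp add: Suc_le_eq)
      then show "d \<le> d\<^sup>2" by (simp add: power2_eq_square)
    qed simp
    finally have "(l2norm \<Omega> u)\<^sup>2 \<le> (d * C * gradnorm \<Omega> u)\<^sup>2" by (simp add: power_mult_distrib mult_ac)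
    then show ?thesis
      by (rule power2_le_imp_le) (use C(1) in \<open>auto simp: gradnorm_def d_def intro!: mult_nonneg_nonneg nn\<close>)
  qed
  have le: "l2inner \<Omega> f u \<le> K * gradnorm \<Omega> u" if u: "u \<in> Xsp \<Omega>" for u
  proof -
    have "l2inner \<Omega> f u \<le> l2norm \<Omega> f * l2norm \<Omega> u"
      using L2_inner(4)[OF m f Xsp_L2(1)[OF u]] by linarith
    also have "\<dots> \<le> l2norm \<Omega> f * (d * C * gradnorm \<Omega> u)"
      by (rule mult_left_mono[OF P[OF u] nn])
    finally show ?thesis by (simp add: K_def mult_ac)
  qed
  show ?thesis
  proof (cases "gradnorm \<Omega> v = 0")
    \<comment> \<open>Fields with zero gradient norm are excluded from the supremum; for them the
      bound \<open>le\<close> already makes the pairing nonpositive.\<close>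
    case True
    then show ?thesis using le[OF v] by simp
  next
    case False
    then have pos: "gradnorm \<Omega> v > 0" using nn[of "grad \<Omega> v"] unfolding gradnorm_def by linarith
    have "l2inner \<Omega> f v / gradnorm \<Omega> v \<le> hm1norm \<Omega> f"
      unfolding hm1norm_def
    proof (rule cSup_upper)
      show "bdd_above {l2inner \<Omega> f v / gradnorm \<Omega> v |v. v \<in> Xsp \<Omega> \<and> gradnorm \<Omega> v \<noteq> 0}"
      proof (rule bdd_aboveI[of _ K])
        fix y assume "y \<in> {l2inner \<Omega> f v / gradnorm \<Omega> v |v. v \<in> Xsp \<Omega> \<and> gradnorm \<Omega> v \<noteq> 0}"
        then obtain u where u: "y = l2inner \<Omega> f u / gradnorm \<Omega> u" "u \<in> Xsp \<Omega>" "gradnorm \<Omega> u \<noteq> 0" by blast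
        then have "gradnorm \<Omega> u > 0" using nn[of "grad \<Omega> u"] unfolding gradnorm_def by linarith
        then show "y \<le> K" using le[OF u(2)] u(1) by (simp add: divide_le_eq)
      qed
    qed (use v False in blast)
    then show ?thesis using pos by (simp add: divide_le_eq)
  qed
qed

section \<open>The energy estimate\<close>

text \<open>Here a is the unfiltered value, x the filtered one, b and c the two previous ones.
  Solving the filter for a gives a - b = (3 x - 4 b + c) / 2, the second-order backward difference.
  Tested with a, it yields a telescoping energy plus 1/3 of the squared second difference of a, b,
  c.\<close>

lemma BE_AB2F_energy_identity:
  fixes a b c x :: "'v::real_inner"
  assumes "x = a - (1/3) *\<^sub>R (a - 2 *\<^sub>R b + c)"
  shows "(a - b) \<bullet> a = 1/4 * (norm x)\<^sup>2 + 1/4 * (norm (2 *\<^sub>R x - b))\<^sup>2 + 1/4 * (norm (x - b))\<^sup>2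
    - (1/4 * (norm b)\<^sup>2 + 1/4 * (norm (2 *\<^sub>R b - c))\<^sup>2 + 1/4 * (norm (b - c))\<^sup>2)
    + 1/3 * (norm (a - (2 *\<^sub>R b - c)))\<^sup>2"
proof -
  have sym: "b \<bullet> a = a \<bullet> b" "c \<bullet> a = a \<bullet> c" "c \<bullet> b = b \<bullet> c" by (simp_all add: inner_commute)
  show ?thesis
    unfolding assms power2_norm_eq_inner inner_diff_left inner_diff_right inner_add_left inner_add_right
      inner_scaleR_left inner_scaleR_right sym
    by (simp add: algebra_simps)
qed

lemma fin_subspace_lincomb:
  assumes "fin_subspace S" "u \<in> S" "v \<in> S"
  shows "(\<lambda>x. a *\<^sub>R u x + b *\<^sub>R v x) \<in> S"
proof -
  have "\<forall>u\<in>S. \<forall>v\<in>S. (\<lambda>x. u x + v x) \<in> S" "\<forall>c. \<forall>u\<in>S. (\<lambda>x. c *\<^sub>R u x) \<in> S"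
    using conjunct1[OF conjunct2[OF assms(1)[unfolded fin_subspace_def]]]
      conjunct1[OF conjunct2[OF conjunct2[OF assms(1)[unfolded fin_subspace_def]]]] .
  then show ?thesis using assms(2,3) by simp
qed

text \<open>Young's inequality gives half of the viscosity to g and leaves
  \<open>q^2 / (2 \<nu>)\<close>. Inserting the inverse inequality, this remainder times dt is 1/3
  \<open>nv^2\<close> times the quantity that the step restriction keeps below 1; the constant 3/2
  is 3 times the 1/2 from Young's inequality.\<close>

lemma absorb_convection:
  fixes \<nu> dt h Cinv C gL g nv gv B :: real
  assumes pos: "\<nu> > 0" "dt > 0" "h > 0" "Cinv > 0" "C > 0" and nn: "gL \<ge> 0" "g \<ge> 0" "nv \<ge> 0" "gv \<ge> 0"
    and inv: "gv \<le> Cinv / h * nv" and B: "\<bar>B\<bar> \<le> C * gL * g * sqrt (nv * gv)"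
    and cfl: "1 - (3/2 * C\<^sup>2 * Cinv) * dt / (\<nu> * h) * gL\<^sup>2 \<ge> 0"
  shows "dt * \<bar>B\<bar> \<le> \<nu> * dt / 2 * g\<^sup>2 + 1/3 * nv\<^sup>2"
proof -
  define q where "q = C * gL * (sqrt (Cinv / h) * nv)"
  have "nv * gv \<le> Cinv / h * nv\<^sup>2"
    using mult_left_mono[OF inv nn(3)] by (simp add: power2_eq_square mult_ac)
  then have "sqrt (nv * gv) \<le> sqrt (Cinv / h * nv\<^sup>2)" by (rule real_sqrt_le_mono)
  also have "\<dots> = sqrt (Cinv / h) * nv" using nn(3) by (simp add: real_sqrt_mult real_sqrt_divide)
  finally have "C * gL * g * sqrt (nv * gv) \<le> C * gL * g * (sqrt (Cinv / h) * nv)"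
    using pos nn by (intro mult_left_mono) auto
  then have "\<bar>B\<bar> \<le> g * q" using B unfolding q_def by (simp add: mult_ac)
  also have "g * q \<le> \<nu> / 2 * g\<^sup>2 + q\<^sup>2 / (2 * \<nu>)"
  proof -
    have "0 \<le> (\<nu> * g - q)\<^sup>2 / (2 * \<nu>)" using pos by simp
    also have "\<dots> = \<nu> / 2 * g\<^sup>2 + q\<^sup>2 / (2 * \<nu>) - g * q"
      using pos by (simp add: power2_eq_square field_simps)
    finally show ?thesis by simp
  qed
  finally have "dt * \<bar>B\<bar> \<le> dt * (\<nu> / 2 * g\<^sup>2 + q\<^sup>2 / (2 * \<nu>))"
    using pos by (intro mult_left_mono) auto
  also have "\<dots> = \<nu> * dt / 2 * g\<^sup>2 + 1/3 * (((3/2 * C\<^sup>2 * Cinv) * dt / (\<nu> * h) * gL\<^sup>2) * nv\<^sup>2)"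
    unfolding q_def using pos by (simp add: power_mult_distrib field_simps)
  also have "\<dots> \<le> \<nu> * dt / 2 * g\<^sup>2 + 1/3 * nv\<^sup>2"
    using mult_right_mono[of "(3/2 * C\<^sup>2 * Cinv) * dt / (\<nu> * h) * gL\<^sup>2" 1 "nv\<^sup>2"] cfl by simp
  finally show ?thesis .
qed

text \<open>Young's inequality weighted so that the forcing has coefficient exactly 1/\<nu>; it uses
  a quarter of the viscosity.\<close>

lemma absorb_forcing:
  fixes \<nu> dt F g r :: real
  assumes "\<nu> > 0" "dt > 0" "r \<le> F * g"
  shows "dt * r \<le> dt / \<nu> * F\<^sup>2 + \<nu> * dt / 4 * g\<^sup>2"
proof -
  have "F * g \<le> F\<^sup>2 / \<nu> + \<nu> / 4 * g\<^sup>2"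
  proof -
    have "0 \<le> (F - \<nu> / 2 * g)\<^sup>2 / \<nu>" using assms by simp
    also have "\<dots> = F\<^sup>2 / \<nu> + \<nu> / 4 * g\<^sup>2 - F * g"
      using assms by (simp add: power2_eq_square field_simps)
    finally show ?thesis by simp
  qed
  then have "dt * r \<le> dt * (F\<^sup>2 / \<nu> + \<nu> / 4 * g\<^sup>2)" using assms by (intro mult_left_mono) auto
  then show ?thesis by (simp add: algebra_simps)
qed

theorem mainTheorem9:
  fixes \<Omega> :: "(real^'d) set" and Cinv \<beta> :: real
  assumes dim: "CARD('d) = 2 \<or> CARD('d) = 3"
    and dom: "open \<Omega>" "bounded \<Omega>" "connected \<Omega>" "\<Omega> \<noteq> {}"
    and Cinv: "Cinv > 0" and beta: "\<beta> > 0"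
  shows "\<exists>Cstab>0. \<forall>h Xh Qh \<nu> dt N f u uhat p.
     h > 0 \<and> fin_subspace Xh \<and> Xh \<subseteq> Xsp \<Omega> \<and> fin_subspace Qh \<and> Qh \<subseteq> Qsp \<Omega> \<and>
     inf_sup \<Omega> \<beta> Xh Qh \<and>
     (\<forall>v\<in>Xh. gradnorm \<Omega> v \<le> Cinv / h * l2norm \<Omega> v) \<and>
     \<nu> > 0 \<and> dt > 0 \<and> N > 1 \<and> (\<forall>n. L2 \<Omega> (f n)) \<and>
     u 0 \<in> Vh \<Omega> Xh Qh \<and> u 1 \<in> Vh \<Omega> Xh Qh \<and>
     BE_AB2F \<Omega> Xh Qh \<nu> dt N f u uhat p \<and>
     (\<forall>n\<in>{1..N-1}. 1 - Cstab * dt / (\<nu> * h) *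
         (gradnorm \<Omega> (\<lambda>x. 2 *\<^sub>R u n x - u (n-1) x))\<^sup>2 \<ge> 0)
     \<longrightarrow>
     1/4 * (l2norm \<Omega> (u N))\<^sup>2 + 1/4 * (l2norm \<Omega> (\<lambda>x. 2 *\<^sub>R u N x - u (N-1) x))\<^sup>2
       + 1/4 * (l2norm \<Omega> (\<lambda>x. u N x - u (N-1) x))\<^sup>2
       + \<nu> * dt / 4 * (\<Sum>n=1..N-1. (gradnorm \<Omega>
            (\<lambda>x. (3/2) *\<^sub>R u (n+1) x - u n x + (1/2) *\<^sub>R u (n-1) x))\<^sup>2)
     \<le> (\<Sum>n=1..N-1. dt / \<nu> * (hm1norm \<Omega> (f (n+1)))\<^sup>2)
       + 1/4 * (l2norm \<Omega> (u 1))\<^sup>2 + 1/4 * (l2norm \<Omega> (\<lambda>x. 2 *\<^sub>R u 1 x - u 0 x))\<^sup>2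
       + 1/4 * (l2norm \<Omega> (\<lambda>x. u 1 x - u 0 x))\<^sup>2"
proof -
  have m: "\<Omega> \<in> sets lebesgue" using dom by simp
  obtain C where C: "C > 0" "\<And>L w. L \<in> Xsp \<Omega> \<Longrightarrow> w \<in> Xsp \<Omega> \<Longrightarrow> (\<lambda>x. w x - L x) \<in> Xsp \<Omega> \<Longrightarrow>
    \<bar>bstar \<Omega> L L w\<bar> \<le> C * gradnorm \<Omega> L * gradnorm \<Omega> w
      * sqrt (l2norm \<Omega> (\<lambda>x. w x - L x) * gradnorm \<Omega> (\<lambda>x. w x - L x))"
    by (rule bstar_bound[OF dim dom(1,2)], rule that)
  note nn = l2norm_power2(2)[OF m]
  have gnn: "gradnorm \<Omega> v \<ge> 0" for v unfolding gradnorm_def by (rule nn)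
  show ?thesis
  \<comment> \<open>C comes from the domain alone and is fixed before any discrete quantity, so the
    constant depends only on \<Omega> and \<open>Cinv\<close>.\<close>
  proof (intro exI[of _ "3/2 * C\<^sup>2 * Cinv"] conjI allI impI, goal_cases)
    case 1
    show ?case using C(1) Cinv by simp
  next
    case (2 h Xh Qh \<nu> dt N f u uhat p)
    then have h: "h > 0" and Xh: "fin_subspace Xh" "Xh \<subseteq> Xsp \<Omega>"
      and inv: "\<And>v. v \<in> Xh \<Longrightarrow> gradnorm \<Omega> v \<le> Cinv / h * l2norm \<Omega> v"
      and pos: "\<nu> > 0" "dt > 0" "N > 1" and f: "\<And>n. L2 \<Omega> (f n)"
      and u01: "u 0 \<in> Xh" "u 1 \<in> Xh"
      and scheme: "BE_AB2F \<Omega> Xh Qh \<nu> dt N f u uhat p"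
      and cfl: "\<And>n. n \<in> {1..N-1} \<Longrightarrow> 1 - (3/2 * C\<^sup>2 * Cinv) * dt / (\<nu> * h) *
         (gradnorm \<Omega> (\<lambda>x. 2 *\<^sub>R u n x - u (n-1) x))\<^sup>2 \<ge> 0"
      unfolding Vh_def by auto
    \<comment> \<open>The discrete energy couples two consecutive levels; it is used only for n at
      least 1, where \<open>n-1\<close> is a true predecessor.\<close>
    define E where "E n = 1/4 * (l2norm \<Omega> (u n))\<^sup>2 + 1/4 * (l2norm \<Omega> (\<lambda>x. 2 *\<^sub>R u n x - u (n-1) x))\<^sup>2
       + 1/4 * (l2norm \<Omega> (\<lambda>x. u n x - u (n-1) x))\<^sup>2" for n
    have uhatX: "uhat (n+1) \<in> Xh" and p: "p (n+1) \<in> Qh"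
      and mom: "\<And>v. v \<in> Xh \<Longrightarrow> l2inner \<Omega> (\<lambda>x. (uhat (n+1) x - u n x) /\<^sub>R dt) v
          + \<nu> * gradinner \<Omega> (uhat (n+1)) v
          + bstar \<Omega> (\<lambda>x. 2 *\<^sub>R u n x - u (n-1) x) (\<lambda>x. 2 *\<^sub>R u n x - u (n-1) x) v
          - l2inner \<Omega> (p (n+1)) (divg \<Omega> v) = l2inner \<Omega> (f (n+1)) v"
      and dv: "\<And>q. q \<in> Qh \<Longrightarrow> l2inner \<Omega> (divg \<Omega> (uhat (n+1))) q = 0"
      and un1: "u (n+1) = (\<lambda>x. uhat (n+1) x - (1/3) *\<^sub>R (uhat (n+1) x - 2 *\<^sub>R u n x + u (n-1) x))"
      if "n \<in> {1..N-1}" for n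
      using scheme that unfolding BE_AB2F_def by blast+
    have lc: "(\<lambda>x. a *\<^sub>R v x + b *\<^sub>R w x) \<in> Xh" if "v \<in> Xh" "w \<in> Xh" for a b v w
      by (rule fin_subspace_lincomb[OF Xh(1) that])
    \<comment> \<open>The filter combines the unfiltered value with the two preceding iterates, so
      membership needs strong induction with two starting values.\<close>
    have uX: "n \<le> N \<Longrightarrow> u n \<in> Xh" for n
    proof (induction n rule: less_induct)
      case (less n)
      consider "n = 0" | "n = 1" | k where "n = k + 1" "k \<in> {1..N-1}"
        using less.prems by (cases n) (auto, force)
      then show ?case
      proof cases
        case 1
        then show ?thesis using u01(1) by simp
      next
        case 2
        then show ?thesis using u01(2) by simp
      next
        case (3 k)
        have k: "u k \<in> Xh" "u (k-1) \<in> Xh" using less.IH less.prems 3(1) by auto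
        have "u n = (\<lambda>x. 1 *\<^sub>R ((2/3) *\<^sub>R uhat (k+1) x + (2/3) *\<^sub>R u k x) + (- 1/3) *\<^sub>R u (k-1) x)"
        proof
          fix x
          show "u n x = 1 *\<^sub>R ((2/3) *\<^sub>R uhat (k+1) x + (2/3) *\<^sub>R u k x) + (- 1/3) *\<^sub>R u (k-1) x"
            unfolding 3(1) un1[OF 3(2)] by (simp add: vec_eq_iff field_simps)
        qed
        then show ?thesis using lc[OF lc[OF uhatX[OF 3(2)] k(1)] k(2), of 1 "2/3" "2/3" "-1/3"] by simp
      qed
    qed
    have step: "E (n+1) + \<nu> * dt / 4 * (gradnorm \<Omega>
            (\<lambda>x. (3/2) *\<^sub>R u (n+1) x - u n x + (1/2) *\<^sub>R u (n-1) x))\<^sup>2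
        \<le> dt / \<nu> * (hm1norm \<Omega> (f (n+1)))\<^sup>2 + E n" if n: "n \<in> {1..N-1}" for n
    proof -
      define w where "w = uhat (n+1)"
      define L where "L x = 2 *\<^sub>R u n x - u (n-1) x" for x
      define v where "v x = w x - L x" for x
      have wX: "w \<in> Xh" using uhatX[OF n] by (simp add: w_def)
      have uXn: "u n \<in> Xh" "u (n-1) \<in> Xh" "u (n+1) \<in> Xh" using uX n by auto
      have LX: "L \<in> Xh" using lc[OF uXn(1,2), of 2 "-1"] by (simp add: L_def[abs_def])
      have vX: "v \<in> Xh" using lc[OF wX LX, of 1 "-1"] by (simp add: v_def[abs_def])
      \<comment> \<open>The combination in the dissipation sum inverts the filter and recovers the
        unfiltered velocity, the field the equation is tested with.\<close>
      have eqw: "(\<lambda>x. (3/2) *\<^sub>R u (n+1) x - u n x + (1/2) *\<^sub>R u (n-1) x) = w"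
        unfolding un1[OF n] w_def by (auto simp: vec_eq_iff field_simps)
      have X2: "L2 \<Omega> y" if "y \<in> Xh" for y using that Xh(2) Xsp_L2(1) by blast
      have int: "integrable (lebesgue_on \<Omega>) (\<lambda>x. (norm (y x))\<^sup>2)" if "y \<in> Xh" for y
        using X2[OF that] L2_iff[OF m] by blast
      have dX: "(\<lambda>x. 2 *\<^sub>R y x - z x) \<in> Xh" "(\<lambda>x. y x - z x) \<in> Xh" if "y \<in> Xh" "z \<in> Xh" for y z
        using lc[OF that, of 2 "-1"] lc[OF that, of 1 "-1"] by simp_all
      have energy: "l2inner \<Omega> (\<lambda>x. w x - u n x) w = E (n+1) - E n + 1/3 * (l2norm \<Omega> v)\<^sup>2"
      proof -
        have "(w x - u n x) \<bullet> w x = 1/4 * (norm (u (n+1) x))\<^sup>2 + 1/4 * (norm (2 *\<^sub>R u (n+1) x - u n x))\<^sup>2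
            + 1/4 * (norm (u (n+1) x - u n x))\<^sup>2
            - (1/4 * (norm (u n x))\<^sup>2 + 1/4 * (norm (2 *\<^sub>R u n x - u (n-1) x))\<^sup>2 + 1/4 * (norm (u n x - u (n-1) x))\<^sup>2)
            + 1/3 * (norm (v x))\<^sup>2" for x
          unfolding v_def L_def by (rule BE_AB2F_energy_identity) (simp only: un1[OF n] w_def)
        then show ?thesis
          unfolding l2inner_eq[OF m] E_def l2norm_power2(1)[OF m]
          using int[OF uXn(1)] int[OF uXn(3)] int[OF dX(1)[OF uXn(3,1)]] int[OF dX(2)[OF uXn(3,1)]]
            int[OF dX(1)[OF uXn(1,2)]] int[OF dX(2)[OF uXn(1,2)]] int[OF vX] by simp
      qed
      have "l2inner \<Omega> (\<lambda>x. (w x - u n x) /\<^sub>R dt) w = l2inner \<Omega> (\<lambda>x. w x - u n x) w / dt"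
        unfolding l2inner_eq[OF m] by (simp add: divide_inverse mult.commute)
      \<comment> \<open>The pressure drops out because it lies in \<open>Qh\<close> and the scheme
        makes w discretely divergence-free.\<close>
      moreover have "l2inner \<Omega> (p (n+1)) (divg \<Omega> w) = 0"
        using dv[OF n p[OF n]] l2inner_commute[of \<Omega> "p (n+1)" "divg \<Omega> w"] m unfolding w_def by simp
      moreover have "gradinner \<Omega> w w = (gradnorm \<Omega> w)\<^sup>2"
        unfolding gradinner_def gradnorm_def l2norm_power2(1)[OF m] l2inner_eq[OF m] power2_norm_eq_inner ..
      ultimately have "(E (n+1) - E n + 1/3 * (l2norm \<Omega> v)\<^sup>2) / dt + \<nu> * (gradnorm \<Omega> w)\<^sup>2 + bstar \<Omega> L L w
          = l2inner \<Omega> (f (n+1)) w"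
        using mom[OF n wX] energy unfolding L_def[abs_def] w_def by simp
      moreover have "dt * (A / dt + B + D) = A + dt * B + dt * D" for A B D
        using pos(2) by (simp add: distrib_left)
      ultimately have main: "E (n+1) - E n + 1/3 * (l2norm \<Omega> v)\<^sup>2 + dt * (\<nu> * (gradnorm \<Omega> w)\<^sup>2) + dt * bstar \<Omega> L L w
          = dt * l2inner \<Omega> (f (n+1)) w" by metis
      have v_eq: "v = (\<lambda>x. w x - L x)" by (simp add: v_def[abs_def])
      have "\<bar>bstar \<Omega> L L w\<bar> \<le> C * gradnorm \<Omega> L * gradnorm \<Omega> w * sqrt (l2norm \<Omega> v * gradnorm \<Omega> v)"
        by (rule C(2)[OF subsetD[OF Xh(2) LX] subsetD[OF Xh(2) wX], folded v_eq, OF subsetD[OF Xh(2) vX]])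
      then have "dt * \<bar>bstar \<Omega> L L w\<bar> \<le> \<nu> * dt / 2 * (gradnorm \<Omega> w)\<^sup>2 + 1/3 * (l2norm \<Omega> v)\<^sup>2"
        using cfl[OF n] unfolding L_def[abs_def, symmetric]
        by (intro absorb_convection[OF pos(1,2) h Cinv C(1) gnn gnn nn gnn inv[OF vX]])
      moreover have "dt * - \<bar>bstar \<Omega> L L w\<bar> \<le> dt * bstar \<Omega> L L w"
        using pos(2) by (intro mult_left_mono) auto
      moreover have "dt * l2inner \<Omega> (f (n+1)) w \<le> dt / \<nu> * (hm1norm \<Omega> (f (n+1)))\<^sup>2 + \<nu> * dt / 4 * (gradnorm \<Omega> w)\<^sup>2"
        by (rule absorb_forcing[OF pos(1,2) hm1norm_bound[OF dom(1,2) f subsetD[OF Xh(2) wX]]])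
      \<comment> \<open>The numerical dissipation cancels completely; of the viscosity, 1 - 1/2 -
        1/4 = 1/4 is left.\<close>
      ultimately show ?thesis using main unfolding eqw by (simp add: algebra_simps)
    qed
    \<comment> \<open>Summation of the one-step estimates, in which the energies telescope; K = N -
      1 gives the energy at level N because N > 1.\<close>
    have "E (K+1) + \<nu> * dt / 4 * (\<Sum>n=1..K. (gradnorm \<Omega>
            (\<lambda>x. (3/2) *\<^sub>R u (n+1) x - u n x + (1/2) *\<^sub>R u (n-1) x))\<^sup>2)
        \<le> (\<Sum>n=1..K. dt / \<nu> * (hm1norm \<Omega> (f (n+1)))\<^sup>2) + E 1" if "K \<le> N - 1" for K
      using that
    proof (induction K)
      case 0
      show ?case by simp
    next
      case (Suc K)
      then show ?case using step[of "K+1"] by (simp add: distrib_left)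
    qed
    from this[of "N-1"] show ?case
      using pos(3) by (simp add: E_def)
  qed
qed

end
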